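(* Let $k,s,r\ge 0$ be integers, $\rho>0$, $\alpha\in\mathbb{R}$. Take the HDG method with local spaces $\mathbf{V}(T)=[P_k(T)]^d$, $W(T)=P_r(T)$, $M(e)=P_s(e)$ and stabilization function $\tau|_{\partial T}=\rho^{-1}h_T^{-\alpha}$, and the hybridized mixed weak Galerkin finite element method (hybridized mixed WG-FEM) with the integers $k,s,r$ and parameters $\rho,\alpha$, on the same partitions $\mathcal{T}_h,\mathcal{E}_h$. If $s\ge k$ and $s\ge r$, then the two methods are equivalent: under the identification $$\mathbf{q}_0\leftrightarrow\tilde{\mathbf{q}}_h,\qquad u_h\leftrightarrow u_h,\qquad u_b\leftrightarrow\hat u_h,\qquad q_b\leftrightarrow\hat{\mathbf{q}}_h\cdot\mathbf{n}_T\ \text{ on each }\partial T,$$ a tuple of functions solves the hybridized mixed WG-FEM if and only if it solves the HDG method.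
   Context: **Model problem.** $-\nabla\cdot(a\nabla u)=f$ in $\Omega$, $u=0$ on $\partial\Omega$, where $\Omega\subset\mathbb{R}^d$ ($d=2,3$) is a bounded polygonal or polyhedral domain, $f\in L^2(\Omega)$, and $a=a(\mathbf{x})$ is a $d\times d$ tensor that is bounded, piecewise continuous, and uniformly symmetric and positive definite on $\Omega$. $(\cdot,\cdot)$, $(\cdot,\cdot)_T$, $\langle\cdot,\cdot\rangle_{\partial T}$ are the $L^2$ inner products on $\Omega$, $T$, $\partial T$. **Partitions.** $\mathcal{T}_h$ is a finite partition of $\Omega$ into polygons/polyhedra $T$, with diameter $h_T$ and unit outward normal $\mathbf{n}_T$ (or $\mathbf n$) on $\partial T$. $\mathcal{E}_h$ is a partition of the union of all element boundaries into flat $(d-1)$-dimensional pieces $e$, such that each $\partial T$, and each $(d-1)$-dimensional interface $\partial T_1\cap\partial T_2$, is a union of members of $\mathcal{E}_h$. $P_j(D)$ denotes polynomials of degree at most $j$ on $D$. **Hybridized mixed WG-FEM.** Let $W_h=\{w\in L^2(\Omega):w|_T\in P_r(T)\ \forall T\}$; $\tilde Z_{k,s}(T)=\{\mathbf{q}=\{\mathbf{q}_0,\mathbf{q}_b\}:\ \mathbf{q}_0\in[P_k(T)]^d,\ \mathbf{q}_b=q_b\mathbf{n}_T,\ q_b|_e\in P_s(e)\ \forall e\in\mathcal{E}_h,\ e\subset\partial T\}$; $\tilde Z_h=\prod_{T\in\mathcal{T}_h}\tilde Z_{k,s}(T)$ (no continuity of $q_b$ between elements is imposed); $\Lambda_h$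 the space of (single-valued) functions $\sigma$ on the union of the members of $\mathcal{E}_h$ with $\sigma|_e\in P_s(e)$ for all $e\in\mathcal{E}_h$; $\Lambda_h^0=\{\sigma\in\Lambda_h:\sigma|_{\partial\Omega}=0\}$. For $\mathbf{v}=\{\mathbf{v}_0,\mathbf{v}_b\}\in\tilde Z_{k,s}(T)$ the discrete weak divergence $\nabla_w\cdot\mathbf{v}\in P_r(T)$ is defined by $$(\nabla_w\cdot\mathbf{v},\phi)_T=-(\mathbf{v}_0,\nabla\phi)_T+\langle\mathbf{v}_b,\phi\mathbf{n}_T\rangle_{\partial T}\qquad\forall\phi\in P_r(T).$$ With $Q_b$ the $L^2$ projection on each $e\in\mathcal{E}_h$ onto $P_s(e)$, set $$s_T(\mathbf{q},\mathbf{v})=\rho h_T^{\alpha}\langle Q_b(\mathbf{q}_0\cdot\mathbf{n}_T)-q_b,\ Q_b(\mathbf{v}_0\cdot\mathbf{n}_T)-v_b\rangle_{\partial T}.$$ The method seeks $\mathbf{q}_h=\{\mathbf{q}_0,q_b\mathbf{n}_T\}\in\tilde Z_h$, $u_h\in W_h$, $u_b\in\Lambda_h^0$ such that $$s_T(\mathbf{q}_h,\mathbf{v})+(a^{-1}\mathbf{q}_0,\mathbf{v}_0)_T-(\nabla_w\cdot\mathbf{v},u_h)_T+\langle u_b,\mathbf{v}_b\cdot\mathbf{n}_T\rangle_{\partial T}=0\quad\forall\mathbf{v}\in\tilde Z_{k,s}(T),\ T\in\mathcal{T}_h,$$ $$(\nabla_w\cdot\mathbf{q}_h,w)_T=(f,w)_T\quad\forall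 w\in W_h,\ T\in\mathcal{T}_h,$$ $$\sum_{T\in\mathcal{T}_h}\langle\sigma,\mathbf{q}_b\cdot\mathbf{n}_T\rangle_{\partial T}=0\quad\forall\sigma\in\Lambda_h^0.$$ **HDG method.** Let $\mathbf{V}_h=\{\mathbf{v}\in[L^2(\Omega)]^d:\mathbf{v}|_T\in\mathbf{V}(T)\ \forall T\in\mathcal{T}_h\}$, $W_h=\{w\in L^2(\Omega):w|_T\in W(T)\ \forall T\in\mathcal{T}_h\}$, and $M_h$ the space of (single-valued) functions $\mu$ on the union of the members of $\mathcal{E}_h$ with $\mu|_e\in M(e)$ for all $e\in\mathcal{E}_h$. The method seeks $(\tilde{\mathbf{q}}_h,u_h,\hat u_h)\in\mathbf{V}_h\times W_h\times M_h$ such that for all $(\mathbf{v},w,\mu)\in\mathbf{V}_h\times W_h\times M_h$ $$\sum_T\big[(a^{-1}\tilde{\mathbf{q}}_h,\mathbf{v})_T-(u_h,\nabla\cdot\mathbf{v})_T+\langle\hat u_h,\mathbf{v}\cdot\mathbf{n}\rangle_{\partial T}\big]=0,$$ $$\sum_T\big[-(\tilde{\mathbf{q}}_h,\nabla w)_T+\langle\hat{\mathbf{q}}_h\cdot\mathbf{n},w\rangle_{\partial T}\big]=(f,w),$$ $$\sum_T\langle\hat{\mathbf{q}}_h\cdot\mathbf{n},\mu\rangle_{\partial T\setminus\partial\Omega}=0,\qquad\langle\hat u_h,\mu\rangle_{\partial\Omega}=0,$$ where $\hat{\mathbf{q}}_h\cdot\mathbf{n}=\tilde{\mathbf{q}}_h\cdot\mathbf{n}+\tau(u_h-\hat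 u_h)$ on $\partial T$ for each $T\in\mathcal{T}_h$. *)

theory Defs
  imports "HOL-Analysis.Analysis"
begin

section \<open>Polyhedral regions, surface measure, normals\<close>

text \<open>
  Relatively open, not necessarily convex, polyhedral sets of dimension m, without slits.
  Domains and mesh elements are open sets (m = d), mesh faces are relatively open subsets
  of hyperplanes (m = d - 1).
\<close>
definition polyhedral_region :: "int \<Rightarrow> (real^'d) set \<Rightarrow> bool" where
  "polyhedral_region m S \<longleftrightarrow>
     aff_dim S = m \<and> rel_interior (closure S) = S \<and>
     (\<exists>F. finite F \<and> (\<forall>P\<in>F. polytope P) \<and> closure S = \<Union>F)"

definition polyhedral_domain :: "(real^'d) set \<Rightarrow> bool" where
  "polyhedral_domain D \<longleftrightarrow> polyhedral_region (int CARD('d)) D \<and> connected D"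

definition flat_piece :: "(real^'d) set \<Rightarrow> bool" where
  "flat_piece e \<longleftrightarrow> polyhedral_region (int CARD('d) - 1) e"

text \<open>
  The (d-1)-dimensional Lebesgue measure on a flat piece e: the measure of A is the volume of
  the prism of height 1 over A, i.e. of the points within distance 1/2 of the hyperplane
  spanned by e whose orthogonal projection onto that hyperplane lies in A.
\<close>
definition surface_measure :: "(real^'d) set \<Rightarrow> (real^'d) measure" where
  "surface_measure e =
     completion (restrict_space
       (distr (restrict_space lborel {x. infdist x (affine hull e) \<le> 1/2}) borel
          (closest_point (affine hull e))) e)"

definition is_outward_normal :: "(real^'d) set \<Rightarrow> real^'d \<Rightarrow> real^'d \<Rightarrow> bool" where
  "is_outward_normal T x \<nu> \<longleftrightarrow>
     norm \<nu> = 1 \<and> (\<exists>\<epsilon>>0. \<forall>y\<in>ball x \<epsilon>. y \<in> T \<longleftrightarrow> \<nu> \<bullet> (y - x) < 0)"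

text \<open>The value 0 is a dummy for edges and vertices, where there is no normal.\<close>
definition outward_normal :: "(real^'d) set \<Rightarrow> real^'d \<Rightarrow> real^'d" where
  "outward_normal T x =
     (if \<exists>\<nu>. is_outward_normal T x \<nu> then (THE \<nu>. is_outward_normal T x \<nu>) else 0)"

section \<open>Partitions\<close>

text \<open>
  Elements T and pieces e are (relatively) open and pairwise disjoint; their closures cover.
  A piece is flat as a part of an element boundary: the outward normal of the element is
  constant on it up to a set of surface measure zero. (Lying in a hyperplane is not enough for
  this: near a vertex an element may occupy two opposite quadrants.)
\<close>
definition is_mesh :: "(real^'d) set \<Rightarrow> (real^'d) set set \<Rightarrow> (real^'d) set set \<Rightarrow> bool" where
  "is_mesh \<Omega> \<T> \<E> \<longleftrightarrow>
     finite \<T> \<and> (\<forall>T\<in>\<T>. polyhedral_domain T \<and> T \<subseteq> \<Omega>) \<and>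
     pairwise disjnt \<T> \<and> closure \<Omega> = (\<Union>T\<in>\<T>. closure T) \<and>
     finite \<E> \<and> (\<forall>e\<in>\<E>. flat_piece e) \<and>
     pairwise disjnt \<E> \<and> (\<Union>T\<in>\<T>. frontier T) = (\<Union>e\<in>\<E>. closure e) \<and>
     (\<forall>T\<in>\<T>. frontier T = (\<Union>e\<in>{e\<in>\<E>. e \<subseteq> frontier T}. closure e)) \<and>
     (\<forall>T\<in>\<T>. \<forall>T'\<in>\<T>. T \<noteq> T' \<longrightarrow>
        (\<forall>e\<in>\<E>. e \<subseteq> frontier T \<inter> frontier T' \<or>
           (AE x in surface_measure e. x \<notin> frontier T \<inter> frontier T'))) \<and>
     (\<forall>T\<in>\<T>. \<forall>e\<in>\<E>. e \<subseteq> frontier T \<longrightarrow>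
        (\<exists>\<nu>. AE x in surface_measure e. is_outward_normal T x \<nu>))"

section \<open>Inner products, traces, differential operators\<close>

definition vol_ip ::
    "(real^'d) set \<Rightarrow> (real^'d \<Rightarrow> 'b::real_inner) \<Rightarrow> (real^'d \<Rightarrow> 'b) \<Rightarrow> real" where
  "vol_ip D g h = (LINT x|lebesgue_on D. g x \<bullet> h x)"

text \<open>The inner product on S, for a subset S of the union of all element boundaries.\<close>
definition surf_ip ::
    "(real^'d) set set \<Rightarrow> (real^'d) set \<Rightarrow> (real^'d \<Rightarrow> 'b::real_inner) \<Rightarrow> (real^'d \<Rightarrow> 'b) \<Rightarrow> real" where
  "surf_ip \<E> S g h = (\<Sum>e\<in>\<E>. LINT x:S|surface_measure e. g x \<bullet> h x)"

definition ae_on :: "(real^'d) set set \<Rightarrow> (real^'d) set \<Rightarrow> (real^'d \<Rightarrow> bool) \<Rightarrow> bool" where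
  "ae_on \<E> S P \<longleftrightarrow> (\<forall>e\<in>\<E>. AE x in surface_measure e. x \<in> S \<longrightarrow> P x)"

definition L2 :: "(real^'d) set \<Rightarrow> (real^'d \<Rightarrow> 'b::euclidean_space) set" where
  "L2 D = {g. g \<in> borel_measurable (lebesgue_on D) \<and>
              integrable (lebesgue_on D) (\<lambda>x. (norm (g x))\<^sup>2)}"

text \<open>The boundary values of the restriction of g to the open set T.\<close>
definition bdry_trace :: "(real^'d) set \<Rightarrow> (real^'d \<Rightarrow> 'b::t2_space) \<Rightarrow> real^'d \<Rightarrow> 'b" where
  "bdry_trace T g x = Lim (at x within T) g"

definition gradient :: "(real^'d \<Rightarrow> real) \<Rightarrow> real^'d \<Rightarrow> real^'d" where
  "gradient g x = (\<chi> i. frechet_derivative g (at x) (axis i 1))"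

definition divergence :: "(real^'d \<Rightarrow> real^'d) \<Rightarrow> real^'d \<Rightarrow> real" where
  "divergence v x = (\<Sum>i\<in>UNIV. frechet_derivative v (at x) (axis i 1) $ i)"

section \<open>Polynomial spaces\<close>

definition polys :: "nat \<Rightarrow> (real^'d \<Rightarrow> real) set" where
  "polys j = {p. \<exists>c. p = (\<lambda>x. \<Sum>m | sum m (UNIV::'d set) \<le> j. c m * (\<Prod>i\<in>UNIV. x $ i ^ m i))}"

text \<open>
  Spaces of functions on a set D are represented by the functions on the whole space whose
  restriction to D belongs to the space. On a mesh face, functions are taken up to a
  null set of the surface measure.
\<close>
definition poly_on :: "nat \<Rightarrow> (real^'d) set \<Rightarrow> (real^'d \<Rightarrow> real) set" where
  "poly_on j D = {g. \<exists>p\<in>polys j. \<forall>x\<in>D. g x = p x}"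

definition vec_poly_on :: "nat \<Rightarrow> (real^'d) set \<Rightarrow> (real^'d \<Rightarrow> real^'d) set" where
  "vec_poly_on j D = {v. \<forall>i. (\<lambda>x. v x $ i) \<in> poly_on j D}"

definition face_poly :: "nat \<Rightarrow> (real^'d) set \<Rightarrow> (real^'d \<Rightarrow> real) set" where
  "face_poly j e = {g. \<exists>p\<in>polys j. AE x in surface_measure e. g x = p x}"

definition broken_space ::
    "(real^'d) set \<Rightarrow> (real^'d) set set \<Rightarrow> ((real^'d) set \<Rightarrow> (real^'d \<Rightarrow> 'b::euclidean_space) set)
      \<Rightarrow> (real^'d \<Rightarrow> 'b) set" where
  "broken_space \<Omega> \<T> X = {g\<in>L2 \<Omega>. \<forall>T\<in>\<T>. g \<in> X T}"

definition skeleton_space ::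
    "(real^'d) set set \<Rightarrow> ((real^'d) set \<Rightarrow> (real^'d \<Rightarrow> real) set) \<Rightarrow> (real^'d \<Rightarrow> real) set" where
  "skeleton_space \<E> M = {\<mu>. \<forall>e\<in>\<E>. \<mu> \<in> M e}"

section \<open>Data of the model problem\<close>

definition piecewise_continuous_on ::
    "(real^'d) set \<Rightarrow> (real^'d \<Rightarrow> 'b::topological_space) \<Rightarrow> bool" where
  "piecewise_continuous_on \<Omega> g \<longleftrightarrow>
     (\<exists>\<D>. finite \<D> \<and> (\<forall>D\<in>\<D>. open D \<and> D \<subseteq> \<Omega> \<and> continuous_on D g) \<and>
          pairwise disjnt \<D> \<and> negligible (\<Omega> - \<Union>\<D>))"

definition admissible_coefficient :: "(real^'d) set \<Rightarrow> (real^'d \<Rightarrow> real^'d^'d) \<Rightarrow> bool" where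
  "admissible_coefficient \<Omega> a \<longleftrightarrow>
     bounded (a ` \<Omega>) \<and> piecewise_continuous_on \<Omega> a \<and>
     (\<forall>x\<in>\<Omega>. transpose (a x) = a x) \<and>
     (\<exists>c>0. \<forall>x\<in>\<Omega>. \<forall>\<xi>. c * (norm \<xi>)\<^sup>2 \<le> \<xi> \<bullet> (a x *v \<xi>))"

section \<open>Hybridized mixed weak Galerkin method\<close>

text \<open>
  A weak vector field on T is a pair (v0, vb) with scalar vb; its boundary vector component is
  vb times the outward normal.
\<close>
definition Z_local ::
    "(real^'d) set set \<Rightarrow> nat \<Rightarrow> nat \<Rightarrow> (real^'d) set \<Rightarrow> ((real^'d \<Rightarrow> real^'d) \<times> (real^'d \<Rightarrow> real)) set" where
  "Z_local \<E> k s T =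
     {(v0, vb). v0 \<in> vec_poly_on k T \<and> (\<forall>e\<in>\<E>. e \<subseteq> frontier T \<longrightarrow> vb \<in> face_poly s e)}"

definition weak_div ::
    "(real^'d) set set \<Rightarrow> nat \<Rightarrow> (real^'d) set \<Rightarrow> (real^'d \<Rightarrow> real^'d) \<Rightarrow> (real^'d \<Rightarrow> real) \<Rightarrow> real^'d \<Rightarrow> real" where
  "weak_div \<E> r T v0 vb =
     (SOME p. p \<in> poly_on r T \<and>
        (\<forall>\<phi>\<in>poly_on r T.
           vol_ip T p \<phi> =
             - vol_ip T v0 (gradient \<phi>) +
             surf_ip \<E> (frontier T) (\<lambda>x. vb x *\<^sub>R outward_normal T x)
                                    (\<lambda>x. bdry_trace T \<phi> x *\<^sub>R outward_normal T x)))"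

text \<open>
  The face-wise projection of a function on the boundary of T; it is determined up to a
  null set of the boundary.
\<close>
definition Q_b ::
    "(real^'d) set set \<Rightarrow> nat \<Rightarrow> (real^'d) set \<Rightarrow> (real^'d \<Rightarrow> real) \<Rightarrow> real^'d \<Rightarrow> real" where
  "Q_b \<E> s T g =
     (SOME p. \<forall>e\<in>\<E>. e \<subseteq> frontier T \<longrightarrow>
        p \<in> face_poly s e \<and>
        (\<forall>\<phi>\<in>face_poly s e. (LINT x|surface_measure e. (g x - p x) * \<phi> x) = 0))"

definition stabilizer ::
    "(real^'d) set set \<Rightarrow> nat \<Rightarrow> real \<Rightarrow> real \<Rightarrow> (real^'d) set \<Rightarrow>
      (real^'d \<Rightarrow> real^'d) \<Rightarrow> (real^'d \<Rightarrow> real) \<Rightarrow> (real^'d \<Rightarrow> real^'d) \<Rightarrow> (real^'d \<Rightarrow> real) \<Rightarrow> real" where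
  "stabilizer \<E> s \<rho> \<alpha> T q0 qb v0 vb =
     \<rho> * diameter T powr \<alpha> *
     surf_ip \<E> (frontier T)
       (\<lambda>x. Q_b \<E> s T (\<lambda>y. bdry_trace T q0 y \<bullet> outward_normal T y) x - qb x)
       (\<lambda>x. Q_b \<E> s T (\<lambda>y. bdry_trace T v0 y \<bullet> outward_normal T y) x - vb x)"

text \<open>Here qb T is the boundary component of the unknown on the element T.\<close>
definition wg_solution ::
    "(real^'d) set \<Rightarrow> (real^'d) set set \<Rightarrow> (real^'d) set set \<Rightarrow> (real^'d \<Rightarrow> real^'d^'d) \<Rightarrow> (real^'d \<Rightarrow> real)
      \<Rightarrow> nat \<Rightarrow> nat \<Rightarrow> nat \<Rightarrow> real \<Rightarrow> real
      \<Rightarrow> (real^'d \<Rightarrow> real^'d) \<Rightarrow> ((real^'d) set \<Rightarrow> real^'d \<Rightarrow> real) \<Rightarrow> (real^'d \<Rightarrow> real) \<Rightarrow> (real^'d \<Rightarrow> real)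
      \<Rightarrow> bool" where
  "wg_solution \<Omega> \<T> \<E> a f k s r \<rho> \<alpha> q0 qb uh ub \<longleftrightarrow>
     (let W = broken_space \<Omega> \<T> (poly_on r);
          \<Lambda>\<^sub>0 = {\<sigma>\<in>skeleton_space \<E> (face_poly s). ae_on \<E> (frontier \<Omega>) (\<lambda>x. \<sigma> x = 0)}
      in (\<forall>T\<in>\<T>. (q0, qb T) \<in> Z_local \<E> k s T) \<and> uh \<in> W \<and> ub \<in> \<Lambda>\<^sub>0 \<and>
         (\<forall>T\<in>\<T>. \<forall>(v0, vb)\<in>Z_local \<E> k s T.
            stabilizer \<E> s \<rho> \<alpha> T q0 (qb T) v0 vb
            + vol_ip T (\<lambda>x. matrix_inv (a x) *v q0 x) v0
            - vol_ip T (weak_div \<E> r T v0 vb) uh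
            + surf_ip \<E> (frontier T) ub
                (\<lambda>x. (vb x *\<^sub>R outward_normal T x) \<bullet> outward_normal T x) = 0) \<and>
         (\<forall>w\<in>W. \<forall>T\<in>\<T>. vol_ip T (weak_div \<E> r T q0 (qb T)) w = vol_ip T f w) \<and>
         (\<forall>\<sigma>\<in>\<Lambda>\<^sub>0. (\<Sum>T\<in>\<T>. surf_ip \<E> (frontier T) \<sigma>
            (\<lambda>x. (qb T x *\<^sub>R outward_normal T x) \<bullet> outward_normal T x)) = 0))"

section \<open>HDG method\<close>

definition hdg_flux ::
    "((real^'d) set \<Rightarrow> real^'d \<Rightarrow> real) \<Rightarrow>
      (real^'d \<Rightarrow> real^'d) \<Rightarrow> (real^'d \<Rightarrow> real) \<Rightarrow> (real^'d \<Rightarrow> real) \<Rightarrow> (real^'d) set \<Rightarrow> real^'d \<Rightarrow> real" where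
  "hdg_flux \<tau> q u uhat T x =
     bdry_trace T q x \<bullet> outward_normal T x + \<tau> T x * (bdry_trace T u x - uhat x)"

definition hdg_solution ::
    "(real^'d) set \<Rightarrow> (real^'d) set set \<Rightarrow> (real^'d) set set \<Rightarrow> (real^'d \<Rightarrow> real^'d^'d) \<Rightarrow> (real^'d \<Rightarrow> real)
      \<Rightarrow> ((real^'d) set \<Rightarrow> (real^'d \<Rightarrow> real^'d) set) \<Rightarrow> ((real^'d) set \<Rightarrow> (real^'d \<Rightarrow> real) set)
      \<Rightarrow> ((real^'d) set \<Rightarrow> (real^'d \<Rightarrow> real) set) \<Rightarrow> ((real^'d) set \<Rightarrow> real^'d \<Rightarrow> real)
      \<Rightarrow> (real^'d \<Rightarrow> real^'d) \<Rightarrow> (real^'d \<Rightarrow> real) \<Rightarrow> (real^'d \<Rightarrow> real) \<Rightarrow> bool" where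
  "hdg_solution \<Omega> \<T> \<E> a f V W M \<tau> q u uhat \<longleftrightarrow>
     q \<in> broken_space \<Omega> \<T> V \<and> u \<in> broken_space \<Omega> \<T> W \<and> uhat \<in> skeleton_space \<E> M \<and>
     (\<forall>v\<in>broken_space \<Omega> \<T> V.
        (\<Sum>T\<in>\<T>. vol_ip T (\<lambda>x. matrix_inv (a x) *v q x) v - vol_ip T u (divergence v)
           + surf_ip \<E> (frontier T) uhat (\<lambda>x. bdry_trace T v x \<bullet> outward_normal T x)) = 0) \<and>
     (\<forall>w\<in>broken_space \<Omega> \<T> W.
        (\<Sum>T\<in>\<T>. - vol_ip T q (gradient w)
           + surf_ip \<E> (frontier T) (hdg_flux \<tau> q u uhat T) (bdry_trace T w)) = vol_ip \<Omega> f w) \<and>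
     (\<forall>\<mu>\<in>skeleton_space \<E> M.
        (\<Sum>T\<in>\<T>. surf_ip \<E> (frontier T - frontier \<Omega>) (hdg_flux \<tau> q u uhat T) \<mu>) = 0) \<and>
     (\<forall>\<mu>\<in>skeleton_space \<E> M. surf_ip \<E> (frontier \<Omega>) uhat \<mu> = 0)"

end

(*
  Testing the local weak Galerkin equation with {v0, vb} and integrating by parts on the element T,
  its left-hand side equals the local HDG expression for v0 plus
  rho h^alpha <flux - qb, Q_b(v0 . n) - vb>, where flux is the HDG flux: the projection Q_b acts as
  the identity on v0 . n because s >= k, and the trace of u_h is admissible as vb because s >= r.
  Hence the equation holds for all {v0, vb} if and only if qb is the flux and the HDG equation holds
  on T. The other equations agree after localizing the HDG test functions to single elements.

  Integration by parts needs the divergence theorem on an arbitrary polyhedral element. For a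
  translation by t v, almost every point x satisfies
     1_T(x - t v) - 1_T(x) = sum over the faces e of sgn(n_e . v) 1[the segment (x - t v, x) meets e],
  and an oblique prism over e has volume t |n_e . v| area(e). Integrating a function against this
  identity and letting t tend to 0 gives the theorem; no decomposition into simplices is needed.
*)
theory Submission
  imports Defs
begin

section \<open>Surface measure and oblique prisms\<close>

text \<open>Faces carry only \<open>surface_measure\<close>, the volume of a straight prism of
  height one, so every surface statement has to be read off from Lebesgue measure; a shear compares
  the straight prism with the oblique ones that a translation sweeps out. About the geometry little
  is known: the outward normal exists only almost everywhere on a face, and the edges are only known
  to lie in finitely many affine sets of dimension at most d - 2. Both exceptional sets remain null
  after being swept along a direction, which is all that counting the crossings of a line demands.

  A second obstacle is that \<open>weak_div\<close> and \<open>Q_b\<close> are choices. Their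
  defining identities become usable only once a solution has been exhibited; for the weak divergence
  this takes a Riesz representation on polynomials.

  Finally, one method restricts the test functions on the outer boundary and the other the domain of
  integration. These match because each mesh piece lies, up to a null set, either in the boundary of
  the domain or off it. This is not demanded by \<open>is_mesh\<close>; it is derived from the
  outward normals and from the fact that the domain is the interior of its closure.\<close>

lemma hyperplane_projection:
  fixes \<nu> :: "'a::euclidean_space"
  assumes "norm \<nu> = 1"
  shows "closest_point {x. \<nu> \<bullet> x = c} x = x - (\<nu> \<bullet> x - c) *\<^sub>R \<nu>"
    and "infdist x {x. \<nu> \<bullet> x = c} = \<bar>\<nu> \<bullet> x - c\<bar>"
proof -
  let ?H = "{x. \<nu> \<bullet> x = c}" and ?y = "x - (\<nu> \<bullet> x - c) *\<^sub>R \<nu>"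
  have n: "\<nu> \<bullet> \<nu> = 1"
    using assms by (simp add: dot_square_norm)
  have y: "?y \<in> ?H"
    by (simp add: inner_diff_right n)
  have le: "dist x ?y \<le> dist x z" if "z \<in> ?H" for z
  proof -
    have "dist x ?y = \<bar>\<nu> \<bullet> x - c\<bar>"
      by (simp add: dist_norm assms)
    also have "\<dots> = \<bar>\<nu> \<bullet> (x - z)\<bar>"
      using that by (simp add: inner_diff_right)
    also have "\<dots> \<le> norm \<nu> * norm (x - z)"
      by (rule Cauchy_Schwarz_ineq2)
    finally show ?thesis
      by (simp add: assms dist_norm)
  qed
  show cp: "closest_point ?H x = ?y"
    by (rule closest_point_unique[symmetric])
      (use y le in \<open>auto simp: convex_hyperplane closed_hyperplane\<close>)
  have "infdist x ?H = dist x ?y"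
  proof (rule antisym)
    show "infdist x ?H \<le> dist x ?y"
      using y by (rule infdist_le)
    show "dist x ?y \<le> infdist x ?H"
      using y le by (subst infdist_notempty) (auto intro!: cINF_greatest)
  qed
  then show "infdist x ?H = \<bar>\<nu> \<bullet> x - c\<bar>"
    by (simp add: dist_norm assms)
qed

lemma nn_integral_lborel_translate:
  fixes f :: "'a::euclidean_space \<Rightarrow> ennreal"
  assumes [measurable]: "f \<in> borel_measurable borel"
  shows "(\<integral>\<^sup>+x. f (x + a) \<partial>lborel) = (\<integral>\<^sup>+x. f x \<partial>lborel)"
proof -
  have "(\<integral>\<^sup>+x. f x \<partial>lborel) = (\<integral>\<^sup>+x. f x \<partial>distr lborel borel ((+) a))"
    by (simp add: lborel_distr_plus)
  also have "\<dots> = (\<integral>\<^sup>+x. f (x + a) \<partial>lborel)"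
    by (subst nn_integral_distr) (auto simp: add.commute)
  finally show ?thesis by simp
qed

text \<open>Cavalieri's principle: the two integrals are reduced to each other by integrating over one
  auxiliary dimension and shearing.\<close>
lemma oblique_slab:
  fixes \<nu> v :: "'a::euclidean_space" and F :: "'a \<Rightarrow> ennreal"
  assumes nu: "norm \<nu> = 1" and nv: "\<nu> \<bullet> v \<noteq> 0" and t: "t > 0"
    and [measurable]: "F \<in> borel_measurable borel"
  shows "(\<integral>\<^sup>+z. F (z - ((\<nu> \<bullet> z - c) / (\<nu> \<bullet> v)) *\<^sub>R v)
             * indicator {0<..<t} ((\<nu> \<bullet> z - c) / (\<nu> \<bullet> v)) \<partial>lborel)
       = ennreal (t * \<bar>\<nu> \<bullet> v\<bar>)
           * (\<integral>\<^sup>+x. F (x - (\<nu> \<bullet> x - c) *\<^sub>R \<nu>) * indicator {-1/2..1/2} (\<nu> \<bullet> x - c) \<partial>lborel)"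
proof -
  define b where "b = \<nu> \<bullet> v"
  define h where "h x = \<nu> \<bullet> x - c" for x
  \<comment> \<open>Both \<open>v\<close> scaled by \<open>1 / b\<close> and \<open>\<nu>\<close>
    raise the height \<open>h\<close> by exactly one, so their difference \<open>u\<close> is
    tangential and a shear along \<open>u\<close> preserves \<open>h\<close>.\<close>
  define u where "u = (1 / b) *\<^sub>R v - \<nu>"
  have b: "b \<noteq> 0" using nv by (simp add: b_def)
  have [measurable]: "h \<in> borel_measurable borel"
    unfolding h_def by measurable
  have n: "\<nu> \<bullet> \<nu> = 1"
    using nu by (simp add: dot_square_norm)
  have \<nu>u: "\<nu> \<bullet> u = 0"
    using b by (simp add: u_def inner_diff_right n b_def)
  let ?I = "indicator {-1/2..1/2} :: real \<Rightarrow> ennreal" and ?J = "indicator {0<..<t} :: real \<Rightarrow> ennreal"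
  let ?L = "lborel :: 'a measure"
  \<comment> \<open>The auxiliary variable \<open>w\<close> enters through this factor of integral
    one. At the start \<open>?J\<close> restricts the point and \<open>?I\<close> the auxiliary
    variable; at the end the two windows have exchanged their roles.\<close>
  have I1: "(\<integral>\<^sup>+w. ?I w \<partial>lborel) = 1"
    by simp
  have J1: "(\<integral>\<^sup>+\<mu>. ?J ((\<mu> + q) / b) \<partial>lborel) = ennreal (t * \<bar>b\<bar>)" for q
  proof -
    have "ennreal t = (\<integral>\<^sup>+s. ?J s \<partial>lborel)"
      using t by simp
    also have "\<dots> = ennreal \<bar>1 / b\<bar> * (\<integral>\<^sup>+\<mu>. ?J (q / b + (1 / b) * \<mu>) \<partial>lborel)"
      by (rule nn_integral_real_affine) (use b in auto)
    also have "(\<lambda>\<mu>. ?J (q / b + (1 / b) * \<mu>)) = (\<lambda>\<mu>. ?J ((\<mu> + q) / b))"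
      by (simp add: add_divide_distrib add.commute)
    finally have "ennreal \<bar>b\<bar> * ennreal t
        = ennreal \<bar>b\<bar> * ennreal \<bar>1 / b\<bar> * (\<integral>\<^sup>+\<mu>. ?J ((\<mu> + q) / b) \<partial>lborel)"
      by (simp add: mult.assoc)
    also have "ennreal \<bar>b\<bar> * ennreal \<bar>1 / b\<bar> = 1"
      using b by (simp add: ennreal_mult[symmetric] abs_mult[symmetric])
    finally show ?thesis
      using t by (simp add: ennreal_mult[symmetric] mult.commute)
  qed
  have "(\<integral>\<^sup>+z. F (z - (h z / b) *\<^sub>R v) * ?J (h z / b) \<partial>?L)
      = (\<integral>\<^sup>+z. (\<integral>\<^sup>+w. F (z - (h z / b) *\<^sub>R v) * ?J (h z / b) * ?I w \<partial>lborel) \<partial>?L)"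
    by (simp add: nn_integral_cmult I1)
  also have "\<dots> = (\<integral>\<^sup>+w. (\<integral>\<^sup>+z. F (z - (h z / b) *\<^sub>R v) * ?J (h z / b) * ?I w \<partial>?L) \<partial>lborel)"
    by (rule lborel_pair.Fubini') simp
  also have "\<dots> = (\<integral>\<^sup>+w. (\<integral>\<^sup>+X. F ((X + w *\<^sub>R u) - (h (X + w *\<^sub>R u) / b) *\<^sub>R v)
        * ?J (h (X + w *\<^sub>R u) / b) * ?I w \<partial>?L) \<partial>lborel)"
    by (rule nn_integral_cong, rule nn_integral_lborel_translate[symmetric]) simp
  also have "\<dots> = (\<integral>\<^sup>+w. (\<integral>\<^sup>+X. F (X + w *\<^sub>R u - (h X / b) *\<^sub>R v) * ?J (h X / b) * ?I w \<partial>?L) \<partial>lborel)"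
    by (simp add: h_def inner_add_right \<nu>u)
  also have "\<dots> = (\<integral>\<^sup>+X. (\<integral>\<^sup>+w. F (X + w *\<^sub>R u - (h X / b) *\<^sub>R v) * ?J (h X / b) * ?I w \<partial>lborel) \<partial>?L)"
    by (rule lborel_pair.Fubini'[symmetric]) simp
  \<comment> \<open>The substitution \<open>w = h X - \<mu>\<close>, followed by the translation of
    \<open>X\<close> by a multiple of \<open>v\<close> that raises its height by
    \<open>\<mu>\<close>, turns the argument of \<open>?I\<close> into the height of the new point
    and the argument of \<open>F\<close> into its orthogonal projection.\<close>
  also have "\<dots> = (\<integral>\<^sup>+X. (\<integral>\<^sup>+\<mu>. F (X + (h X - \<mu>) *\<^sub>R u - (h X / b) *\<^sub>R v) * ?J (h X / b) * ?I (h X - \<mu>) \<partial>lborel) \<partial>?L)"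
  proof (rule nn_integral_cong)
    fix X :: 'a
    show "(\<integral>\<^sup>+w. F (X + w *\<^sub>R u - (h X / b) *\<^sub>R v) * ?J (h X / b) * ?I w \<partial>lborel)
        = (\<integral>\<^sup>+\<mu>. F (X + (h X - \<mu>) *\<^sub>R u - (h X / b) *\<^sub>R v) * ?J (h X / b) * ?I (h X - \<mu>) \<partial>lborel)"
      by (subst nn_integral_real_affine[where c = "-1" and t = "h X"]) simp_all
  qed
  also have "\<dots> = (\<integral>\<^sup>+\<mu>. (\<integral>\<^sup>+X. F (X + (h X - \<mu>) *\<^sub>R u - (h X / b) *\<^sub>R v) * ?J (h X / b) * ?I (h X - \<mu>) \<partial>?L) \<partial>lborel)"
    by (rule lborel_pair.Fubini') simp
  also have "\<dots> = (\<integral>\<^sup>+\<mu>. (\<integral>\<^sup>+x. F (x - h x *\<^sub>R \<nu>) * ?J ((\<mu> + h x) / b) * ?I (h x) \<partial>?L) \<partial>lborel)"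
  proof (rule nn_integral_cong)
    fix \<mu> :: real
    have l: "h (x + (\<mu> / b) *\<^sub>R v) = \<mu> + h x" for x
      using b by (simp add: h_def inner_add_right b_def)
    have a: "x + (\<mu> / b) *\<^sub>R v + (\<mu> + h x - \<mu>) *\<^sub>R u - ((\<mu> + h x) / b) *\<^sub>R v = x - h x *\<^sub>R \<nu>" for x
      by (simp add: u_def algebra_simps add_divide_distrib)
    have "(\<integral>\<^sup>+X. F (X + (h X - \<mu>) *\<^sub>R u - (h X / b) *\<^sub>R v) * ?J (h X / b) * ?I (h X - \<mu>) \<partial>?L)
       = (\<integral>\<^sup>+x. F ((x + (\<mu> / b) *\<^sub>R v) + (h (x + (\<mu> / b) *\<^sub>R v) - \<mu>) *\<^sub>R u - (h (x + (\<mu> / b) *\<^sub>R v) / b) *\<^sub>R v)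
           * ?J (h (x + (\<mu> / b) *\<^sub>R v) / b) * ?I (h (x + (\<mu> / b) *\<^sub>R v) - \<mu>) \<partial>?L)"
      by (rule nn_integral_lborel_translate[symmetric]) simp
    then show "(\<integral>\<^sup>+X. F (X + (h X - \<mu>) *\<^sub>R u - (h X / b) *\<^sub>R v) * ?J (h X / b) * ?I (h X - \<mu>) \<partial>?L)
       = (\<integral>\<^sup>+x. F (x - h x *\<^sub>R \<nu>) * ?J ((\<mu> + h x) / b) * ?I (h x) \<partial>?L)"
      unfolding l a by simp
  qed
  also have "\<dots> = (\<integral>\<^sup>+x. (\<integral>\<^sup>+\<mu>. F (x - h x *\<^sub>R \<nu>) * ?J ((\<mu> + h x) / b) * ?I (h x) \<partial>lborel) \<partial>?L)"
    by (rule lborel_pair.Fubini'[symmetric]) simp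
  also have "\<dots> = (\<integral>\<^sup>+x. (F (x - h x *\<^sub>R \<nu>) * ?I (h x)) * (\<integral>\<^sup>+\<mu>. ?J ((\<mu> + h x) / b) \<partial>lborel) \<partial>?L)"
    by (rule nn_integral_cong, subst nn_integral_cmult[symmetric]) (simp_all add: mult_ac)
  also have "\<dots> = ennreal (t * \<bar>b\<bar>) * (\<integral>\<^sup>+x. F (x - h x *\<^sub>R \<nu>) * ?I (h x) \<partial>?L)"
    by (subst nn_integral_cmult[symmetric]) (simp_all add: J1 mult.commute)
  finally show ?thesis
    by (simp add: h_def b_def)
qed

text \<open>The points whose backward open segment of length parameter \<open>t\<close> along
  \<open>v\<close> meets \<open>e\<close>. In this form a face enters the count of crossings; hits
  at the two ends of the segment are left out.\<close>

definition prism :: "'a::euclidean_space set \<Rightarrow> 'a \<Rightarrow> real \<Rightarrow> 'a set" where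
  "prism e v t = {x. \<exists>s. 0 < s \<and> s < t \<and> x - s *\<^sub>R v \<in> e}"

text \<open>Here \<open>\<nu>\<close> is either of the two unit normals of the hyperplane; its sign
  is fixed only when the face is seen as part of the boundary of an element.\<close>

locale flat_face =
  fixes e :: "(real^'d) set" and \<nu> :: "real^'d" and c :: real
  assumes norm_nu: "norm \<nu> = 1"
    and hull: "affine hull e = {x. \<nu> \<bullet> x = c}"
    and borel [measurable]: "e \<in> sets borel"
    and bdd: "bounded e"
begin

abbreviation base :: "(real^'d) measure" where
  "base \<equiv> restrict_space
       (distr (restrict_space lborel {x. infdist x (affine hull e) \<le> 1/2}) borel
          (closest_point (affine hull e))) e"

text \<open>For transversal \<open>v\<close> this is the one parameter \<open>s\<close> for which
  \<open>z - s *\<^sub>R v\<close> lies in the hyperplane of \<open>e\<close>.\<close>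

definition height :: "real^'d \<Rightarrow> real^'d \<Rightarrow> real" where
  "height v z = (\<nu> \<bullet> z - c) / (\<nu> \<bullet> v)"

lemma height_measurable [measurable]: "height v \<in> borel_measurable borel"
  unfolding height_def by measurable

lemma in_plane: "x \<in> e \<Longrightarrow> \<nu> \<bullet> x = c"
  using hull hull_subset[of e affine] by auto

lemma space_base: "space base = e"
  by (simp add: space_restrict_space)

lemma space_surface: "space (surface_measure e) = e"
  unfolding surface_measure_def by (simp add: space_restrict_space)

lemma borel_measurable_base:
  assumes "g \<in> borel_measurable borel"
  shows "g \<in> borel_measurable base"
  by (rule measurable_restrict_space1) (use assms in simp)

lemma closest_point_measurable [measurable]:
  "closest_point (affine hull e) \<in> borel_measurable borel"
  unfolding hull hyperplane_projection[OF norm_nu] by measurable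

lemma slab: "{x. infdist x (affine hull e) \<le> 1/2} = {x. \<nu> \<bullet> x - c \<in> {-1/2..1/2}}"
  unfolding hull hyperplane_projection[OF norm_nu]
  by (intro Collect_cong) (simp only: atLeastAtMost_iff, linarith)

lemma slab_borel: "{x. infdist x (affine hull e) \<le> 1/2} \<in> sets borel"
  unfolding slab by measurable

lemma nn_integral_base:
  assumes [measurable]: "g \<in> borel_measurable borel"
  shows "(\<integral>\<^sup>+y. g y \<partial>base) = (\<integral>\<^sup>+x. g (x - (\<nu> \<bullet> x - c) *\<^sub>R \<nu>) * indicator e (x - (\<nu> \<bullet> x - c) *\<^sub>R \<nu>)
            * indicator {-1/2..1/2} (\<nu> \<bullet> x - c) \<partial>lborel)"
proof -
  have "(\<integral>\<^sup>+y. g y \<partial>base) = (\<integral>\<^sup>+y. g y * indicator e y \<partial>distr (restrict_space lborel {x. infdist x (affine hull e) \<le> 1/2}) borel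
          (closest_point (affine hull e)))"
    by (rule nn_integral_restrict_space) simp
  also have "\<dots> = (\<integral>\<^sup>+x. g (closest_point (affine hull e) x) * indicator e (closest_point (affine hull e) x)
       \<partial>restrict_space lborel {x. infdist x (affine hull e) \<le> 1/2})"
    by (rule nn_integral_distr) (auto intro!: measurable_restrict_space1)
  also have "\<dots> = (\<integral>\<^sup>+x. g (closest_point (affine hull e) x) * indicator e (closest_point (affine hull e) x)
       * indicator {x. infdist x (affine hull e) \<le> 1/2} x \<partial>lborel)"
    by (rule nn_integral_restrict_space) (use slab_borel in simp)
  also have "\<dots> = (\<integral>\<^sup>+x. g (x - (\<nu> \<bullet> x - c) *\<^sub>R \<nu>) * indicator e (x - (\<nu> \<bullet> x - c) *\<^sub>R \<nu>)
            * indicator {-1/2..1/2} (\<nu> \<bullet> x - c) \<partial>lborel)"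
    unfolding slab unfolding hull hyperplane_projection[OF norm_nu] by (simp add: indicator_def)
  finally show ?thesis .
qed

lemma prism_iff:
  assumes "\<nu> \<bullet> v \<noteq> 0"
  shows "z \<in> prism e v t \<longleftrightarrow> height v z \<in> {0<..<t} \<and> z - height v z *\<^sub>R v \<in> e"
proof
  assume "z \<in> prism e v t"
  then obtain s where s: "0 < s" "s < t" "z - s *\<^sub>R v \<in> e"
    by (auto simp: prism_def)
  then have "height v z = s"
    using in_plane[OF s(3)] assms by (auto simp: height_def inner_diff_right field_simps)
  then show "height v z \<in> {0<..<t} \<and> z - height v z *\<^sub>R v \<in> e"
    using s by simp
qed (auto simp: prism_def)

lemma prism_measurable [measurable]:
  assumes "\<nu> \<bullet> v \<noteq> 0"
  shows "prism e v t \<in> sets borel"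
proof -
  have "prism e v t = {z \<in> space borel. height v z \<in> {0<..<t} \<and> z - height v z *\<^sub>R v \<in> e}"
    using prism_iff[OF assms] by auto
  also have "\<dots> \<in> sets borel"
    by measurable
  finally show ?thesis .
qed

text \<open>The surface integral is by definition an integral over the slab of height one in the
  normal direction, and \<open>oblique_slab\<close> trades this slab for one of height
  \<open>t\<close> in direction \<open>v\<close>. Completing the measure does not affect the
  integral.\<close>

lemma nn_integral_prism:
  assumes v: "\<nu> \<bullet> v \<noteq> 0" and t: "t > 0" and [measurable]: "g \<in> borel_measurable borel"
  shows "(\<integral>\<^sup>+z. g (z - height v z *\<^sub>R v) * indicator (prism e v t) z \<partial>lborel)
     = ennreal (t * \<bar>\<nu> \<bullet> v\<bar>) * (\<integral>\<^sup>+y. g y \<partial>surface_measure e)"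
proof -
  have i: "indicator (prism e v t) z = (indicator e (z - height v z *\<^sub>R v) * indicator {0<..<t} (height v z) :: ennreal)" for z
    using prism_iff[OF v] by (auto simp: indicator_def)
  have "(\<integral>\<^sup>+y. g y \<partial>surface_measure e) = (\<integral>\<^sup>+y. g y \<partial>base)"
    unfolding surface_measure_def by (rule nn_integral_completion)
  note this[unfolded nn_integral_base[OF assms(3)]]
  then show ?thesis
    using oblique_slab[OF norm_nu v t, of "\<lambda>x. g x * indicator e x" c]
    by (simp add: i height_def[symmetric] mult.assoc)
qed

lemma bounded_prism: "bounded (prism e v t)"
proof -
  have "prism e v t \<subseteq> (\<lambda>(y, s). y + s *\<^sub>R v) ` (closure e \<times> {0..t})"
  proof
    fix x assume "x \<in> prism e v t"
    then obtain s where s: "0 < s" "s < t" "x - s *\<^sub>R v \<in> e"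
      by (auto simp: prism_def)
    then have "(x - s *\<^sub>R v, s) \<in> closure e \<times> {0..t}"
      using closure_subset by auto
    then show "x \<in> (\<lambda>(y, s). y + s *\<^sub>R v) ` (closure e \<times> {0..t})"
      by (rule rev_image_eqI) simp
  qed
  moreover have "compact ((\<lambda>(y, s). y + s *\<^sub>R v) ` (closure e \<times> {0..t}))"
    using bdd by (intro compact_continuous_image compact_Times)
      (auto intro!: continuous_intros simp: case_prod_unfold)
  ultimately show ?thesis
    using bounded_subset compact_imp_bounded by blast
qed

text \<open>The total mass is the volume of the straight prism of height one over \<open>e\<close>,
  which is a bounded set.\<close>

lemma finite_surface: "finite_measure (surface_measure e)"
proof
  have nn: "\<nu> \<bullet> \<nu> \<noteq> 0"
    using norm_nu by (auto simp: dot_square_norm)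
  have "emeasure (surface_measure e) (space (surface_measure e)) = (\<integral>\<^sup>+y. 1 \<partial>surface_measure e)"
    by simp
  also have "ennreal (1 * \<bar>\<nu> \<bullet> \<nu>\<bar>) * (\<integral>\<^sup>+y. 1 \<partial>surface_measure e) = (\<integral>\<^sup>+z. indicator (prism e \<nu> 1) z \<partial>lborel)"
    using nn_integral_prism[OF nn, of 1 "\<lambda>_. 1"] by simp
  then have "(\<integral>\<^sup>+y. 1 \<partial>surface_measure e) = emeasure lborel (prism e \<nu> 1)"
    using norm_nu prism_measurable[OF nn] by (simp add: dot_square_norm)
  also have "\<dots> < \<infinity>"
    using emeasure_bounded_finite[OF bounded_prism] .
  finally show "emeasure (surface_measure e) (space (surface_measure e)) \<noteq> \<infinity>"
    by simp
qed

lemma surface_measurable: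
  assumes "g \<in> borel_measurable borel"
  shows "g \<in> borel_measurable (surface_measure e)"
  unfolding surface_measure_def
  by (rule measurable_completion, rule borel_measurable_base, rule assms)

lemma integrable_surface:
  fixes g :: "real^'d \<Rightarrow> real"
  assumes "continuous_on UNIV g"
  shows "integrable (surface_measure e) g"
proof -
  interpret finite_measure "surface_measure e"
    by (rule finite_surface)
  have "compact (g ` closure e)"
    using assms bdd by (intro compact_continuous_image) (auto intro: continuous_on_subset)
  then obtain B where B: "\<forall>y\<in>g ` closure e. norm y \<le> B"
    using compact_imp_bounded bounded_iff by blast
  show ?thesis
  proof (rule integrable_const_bound[where B = B])
    show "AE x in surface_measure e. norm (g x) \<le> B"
      using B closure_subset by (intro AE_I2) (auto simp: space_surface)
    show "g \<in> borel_measurable (surface_measure e)"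
      using assms by (intro surface_measurable borel_measurable_continuous_onI)
  qed
qed

text \<open>The positive and the negative part are each an instance of
  \<open>nn_integral_prism\<close>; the absolute value gives integrability.\<close>

lemma integral_prism:
  fixes g :: "real^'d \<Rightarrow> real"
  assumes v: "\<nu> \<bullet> v \<noteq> 0" and t: "t > 0" and g: "continuous_on UNIV g"
  shows "integrable lborel (\<lambda>z. g (z - height v z *\<^sub>R v) * indicator (prism e v t) z)"
    and "(LINT z|lborel. g (z - height v z *\<^sub>R v) * indicator (prism e v t) z)
       = t * \<bar>\<nu> \<bullet> v\<bar> * (LINT y|surface_measure e. g y)"
proof -
  let ?f = "\<lambda>z. g (z - height v z *\<^sub>R v) * indicator (prism e v t) z"
  have [measurable]: "g \<in> borel_measurable borel"
    using g by (rule borel_measurable_continuous_onI)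
  have [measurable]: "prism e v t \<in> sets borel"
    using v by (rule prism_measurable)
  have m: "?f \<in> borel_measurable lborel"
    by simp
  have gi: "integrable (surface_measure e) g"
    using g by (rule integrable_surface)
  have n: "(\<integral>\<^sup>+z. ennreal (norm (?f z)) \<partial>lborel) = ennreal (t * \<bar>\<nu> \<bullet> v\<bar>) * (\<integral>\<^sup>+y. ennreal (norm (g y)) \<partial>surface_measure e)"
    using nn_integral_prism[OF v t, of "\<lambda>y. ennreal (norm (g y))"]
    by (simp add: abs_mult ennreal_mult ennreal_indicator)
  have p: "(\<integral>\<^sup>+z. ennreal (?f z) \<partial>lborel) = ennreal (t * \<bar>\<nu> \<bullet> v\<bar>) * (\<integral>\<^sup>+y. ennreal (g y) \<partial>surface_measure e)"
    using nn_integral_prism[OF v t, of "\<lambda>y. ennreal (g y)"]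
    by (simp add: ennreal_mult'' ennreal_indicator)
  have q: "(\<integral>\<^sup>+z. ennreal (- ?f z) \<partial>lborel) = ennreal (t * \<bar>\<nu> \<bullet> v\<bar>) * (\<integral>\<^sup>+y. ennreal (- g y) \<partial>surface_measure e)"
    using nn_integral_prism[OF v t, of "\<lambda>y. ennreal (- g y)"]
    by (simp add: ennreal_mult''[symmetric] ennreal_indicator[symmetric])
  show fi: "integrable lborel ?f"
  proof (rule integrableI_bounded)
    show "(\<integral>\<^sup>+z. ennreal (norm (?f z)) \<partial>lborel) < \<infinity>"
      unfolding n using gi by (simp add: integrable_iff_bounded ennreal_mult_less_top)
  qed (rule m)
  show "integral\<^sup>L lborel ?f = t * \<bar>\<nu> \<bullet> v\<bar> * (LINT y|surface_measure e. g y)"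
    unfolding real_lebesgue_integral_def[OF fi] real_lebesgue_integral_def[OF gi] p q
    using t by (simp add: enn2real_mult right_diff_distrib)
qed

text \<open>Transfers null sets of the face to Lebesgue null sets of starting points: the bad points
  of \<open>e\<close> sweep out an oblique prism of volume zero. If \<open>v\<close> is parallel to
  \<open>e\<close>, a hit is possible only from inside the hyperplane of \<open>e\<close>, which is
  itself negligible.\<close>

lemma AE_prism:
  assumes "AE y in surface_measure e. P y" and t: "t > 0"
  shows "AE z in lborel. \<forall>s. 0 < s \<and> s < t \<and> z - s *\<^sub>R v \<in> e \<longrightarrow> \<nu> \<bullet> v \<noteq> 0 \<and> P (z - s *\<^sub>R v)"
proof (cases "\<nu> \<bullet> v = 0")
  case True
  have "negligible {z. \<nu> \<bullet> z = c}"
    using norm_nu by (intro negligible_hyperplane) auto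
  then have "AE z in lborel. \<not> \<nu> \<bullet> z = c"
    using AE_not_in[of "{z. \<nu> \<bullet> z = c}" lborel] by (simp add: negligible_iff_null_sets null_sets_completion_iff)
  then show ?thesis
  proof (rule AE_mp, intro AE_I2 impI allI)
    fix z s assume "\<nu> \<bullet> z \<noteq> c" "0 < s \<and> s < t \<and> z - s *\<^sub>R v \<in> e"
    then show "\<nu> \<bullet> v \<noteq> 0 \<and> P (z - s *\<^sub>R v)"
      using in_plane[of "z - s *\<^sub>R v"] True by (simp add: inner_diff_right)
  qed
next
  case False
  \<comment> \<open>Passing to the uncompleted measure yields an exceptional set \<open>N\<close>
    that is Borel, so that its indicator can be inserted in
    \<open>nn_integral_prism\<close>.\<close>
  have "AE y in base. P y"
    using assms(1) unfolding surface_measure_def AE_completion_iff .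
  then obtain N where N: "{y \<in> space base. \<not> P y} \<subseteq> N" "N \<in> sets base" "emeasure base N = 0"
    by (rule AE_E)
  then have Nb [measurable]: "N \<in> sets borel" and Ne: "N \<subseteq> e"
    by (auto simp: sets_restrict_space_iff sets_restrict_space)
  have "(\<integral>\<^sup>+z. indicator N (z - height v z *\<^sub>R v) * indicator (prism e v t) z \<partial>lborel)
     = ennreal (t * \<bar>\<nu> \<bullet> v\<bar>) * (\<integral>\<^sup>+y. indicator N y \<partial>base)"
    using nn_integral_prism[OF False t, of "indicator N"]
    by (simp add: surface_measure_def nn_integral_completion)
  also have "(\<integral>\<^sup>+y. indicator N y \<partial>base) = emeasure base N"
    by (rule nn_integral_indicator) (rule N)
  finally have "(\<integral>\<^sup>+z. indicator N (z - height v z *\<^sub>R v) * indicator (prism e v t) z \<partial>lborel) = 0"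
    using N by simp
  then have "AE z in lborel. indicator N (z - height v z *\<^sub>R v) * indicator (prism e v t) z = (0::ennreal)"
    using prism_measurable[OF False] by (subst (asm) nn_integral_0_iff_AE) auto
  then show ?thesis
  proof (rule AE_mp, intro AE_I2 impI allI)
    fix z s
    assume z: "indicator N (z - height v z *\<^sub>R v) * indicator (prism e v t) z = (0::ennreal)"
      and s: "0 < s \<and> s < t \<and> z - s *\<^sub>R v \<in> e"
    then have p: "z \<in> prism e v t"
      by (auto simp: prism_def)
    have "height v z = s"
      using in_plane[of "z - s *\<^sub>R v"] s False by (auto simp: height_def inner_diff_right field_simps)
    then have "z - s *\<^sub>R v \<notin> N"
      using z p by (simp add: indicator_def split: if_splits)
    then show "\<nu> \<bullet> v \<noteq> 0 \<and> P (z - s *\<^sub>R v)"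
      using N(1) s False unfolding space_base by blast
  qed
qed

end

section \<open>Polyhedral regions and outward normals\<close>

lemma polyhedral_region_bounded:
  assumes "polyhedral_region m S"
  shows "bounded S"
proof -
  obtain F where "finite F" "\<forall>P\<in>F. polytope P" "closure S = \<Union>F"
    using assms by (auto simp: polyhedral_region_def)
  then have "bounded (closure S)"
    by (simp add: bounded_Union polytope_imp_bounded)
  then show ?thesis
    using bounded_subset closure_subset by blast
qed

text \<open>A polytope of full dimension in the closure has its relative interior inside
  \<open>S\<close>, because \<open>S\<close> is the relative interior of its own closure. What
  remains lies on facets of the polytopes or in polytopes of smaller dimension, and the affine hulls
  of these form the family \<open>\<A>\<close>.\<close>

lemma closure_diff_polyhedral_region:
  fixes S :: "(real^'d) set"
  assumes "polyhedral_region m S"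
  obtains \<A> where "finite \<A>" "\<And>A. A \<in> \<A> \<Longrightarrow> affine A \<and> aff_dim A \<le> m - 1" "closure S - S \<subseteq> \<Union>\<A>"
proof -
  obtain F where F: "finite F" "\<forall>P\<in>F. polytope P" "closure S = \<Union>F"
    and m: "aff_dim S = m" and ri: "rel_interior (closure S) = S"
    using assms by (auto simp: polyhedral_region_def)
  define X where "X = (\<Union>P\<in>F. {G. G facet_of P}) \<union> {P\<in>F. aff_dim P < m}"
  show thesis
  proof
    show "finite ((hull) affine ` X)"
      using F unfolding X_def
      by (intro finite_imageI finite_UnI finite_UN_I finite_polytope_facets) auto
    fix A assume "A \<in> (hull) affine ` X"
    then obtain G where G: "G \<in> X" "A = affine hull G"
      by auto
    have "aff_dim G \<le> m - 1"
    proof (cases "G \<in> F \<and> aff_dim G < m")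
      case False
      then obtain P where P: "P \<in> F" "G facet_of P"
        using G by (auto simp: X_def)
      then have "aff_dim P \<le> aff_dim (closure S)"
        using F by (intro aff_dim_subset) auto
      then show ?thesis
        using P m by (simp add: facet_of_def)
    qed auto
    then show "affine A \<and> aff_dim A \<le> m - 1"
      using G by simp
  next
    show "closure S - S \<subseteq> \<Union>((hull) affine ` X)"
    proof
      fix x assume x: "x \<in> closure S - S"
      then obtain P where P: "P \<in> F" "x \<in> P"
        using F by auto
      have sub: "P \<subseteq> closure S"
        using P F by auto
      have "\<exists>G\<in>X. x \<in> G"
      proof (cases "aff_dim P < m")
        case True
        then show ?thesis
          using P by (auto simp: X_def)
      next
        case False
        have "aff_dim P \<le> m"
          using aff_dim_subset[OF sub] m by simp
        then have "affine hull P = affine hull (closure S)"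
          using False P m hull_mono[OF sub, of affine] by (intro affine_dim_equal) auto
        then have "rel_interior P \<subseteq> S"
          using subset_rel_interior[OF sub] ri by simp
        then have "x \<in> P - rel_interior P"
          using x P by auto
        then obtain G where "G facet_of P" "x \<in> G"
          using rel_boundary_of_polyhedron[of P] F P polytope_imp_polyhedron by blast
        then show ?thesis
          using P by (auto simp: X_def)
      qed
      then obtain G where "G \<in> X" "x \<in> affine hull G"
        using hull_inc by metis
      then show "x \<in> \<Union>((hull) affine ` X)"
        by blast
    qed
  qed
qed

lemma negligible_affine_lowdim:
  fixes A :: "'a::euclidean_space set"
  assumes "affine A" "aff_dim A < DIM('a)"
  shows "negligible A"
  using assms negligible_convex_interior[OF affine_imp_convex[OF assms(1)]] aff_dim_nonempty_interior[of A]
  by force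

text \<open>The swept set lies in the affine hull of \<open>A\<close> and one further point
  \<open>a + v\<close>, so its dimension grows by at most one. Codimension two is therefore thin
  enough for edges to be missed by almost every line in direction \<open>v\<close>.\<close>

lemma negligible_sweep_affine:
  fixes A :: "'a::euclidean_space set"
  assumes "affine A" "aff_dim A \<le> int DIM('a) - 2"
  shows "negligible {x. \<exists>s. x - s *\<^sub>R v \<in> A}"
proof (cases "A = {}")
  case False
  then obtain a where a: "a \<in> A" by auto
  let ?B = "affine hull (insert (a + v) A)"
  have "aff_dim ?B \<le> aff_dim A + 1"
    by (simp add: aff_dim_insert)
  then have "negligible ?B"
    using assms by (intro negligible_affine_lowdim) auto
  moreover have "{x. \<exists>s. x - s *\<^sub>R v \<in> A} \<subseteq> ?B"
  proof
    fix x assume "x \<in> {x. \<exists>s. x - s *\<^sub>R v \<in> A}"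
    then obtain s where s: "x - s *\<^sub>R v \<in> A" by auto
    have B: "affine ?B" "A \<subseteq> ?B" "a + v \<in> ?B"
      using hull_subset[of "insert (a + v) A" affine] by auto
    have "(x - s *\<^sub>R v) + s *\<^sub>R ((a + v) - a) \<in> ?B"
      by (rule mem_affine_3_minus) (use B s a in auto)
    then show "x \<in> ?B"
      by simp
  qed
  ultimately show ?thesis
    by (rule negligible_subset)
qed simp

lemma AE_lborel_not_negligible:
  assumes "negligible N" "\<And>x. x \<notin> N \<Longrightarrow> P x"
  shows "AE x in lborel. P x"
proof -
  have "AE x in lebesgue. x \<notin> N"
    using assms(1) by (intro AE_not_in) (simp add: negligible_iff_null_sets)
  then have "AE x in lborel. x \<notin> N"
    by (simp add: AE_completion_iff)
  then show ?thesis
    by (rule AE_mp) (use assms(2) in auto)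
qed

lemma flat_piece_openin:
  fixes e :: "(real^'d) set"
  assumes "flat_piece e"
  shows "openin (top_of_set (affine hull e)) e"
proof -
  have "rel_interior (closure e) = e"
    using assms by (simp add: flat_piece_def polyhedral_region_def)
  then show ?thesis
    using openin_rel_interior[of "closure e"] by simp
qed

lemma flat_piece_borel:
  fixes e :: "(real^'d) set"
  assumes "flat_piece e"
  shows "e \<in> sets borel"
proof -
  obtain U where "open U" "e = affine hull e \<inter> U"
    using flat_piece_openin[OF assms] by (auto simp: openin_open)
  then show ?thesis
    by (metis affine_affine_hull affine_closed borel_closed borel_open sets.Int)
qed

lemma flat_face_if_flat_piece:
  fixes e :: "(real^'d) set"
  assumes "flat_piece e" "norm \<nu> = 1" "affine hull e = {x. \<nu> \<bullet> x = c}"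
  shows "flat_face e \<nu> c"
  using assms flat_piece_borel[OF assms(1)] polyhedral_region_bounded
  by unfold_locales (auto simp: flat_piece_def)

lemma flat_piece_imp_flat_face:
  fixes e :: "(real^'d) set"
  assumes "flat_piece e"
  obtains \<nu> c where "flat_face e \<nu> c"
proof -
  have "aff_dim e = DIM(real^'d) - 1"
    using assms by (simp add: flat_piece_def polyhedral_region_def)
  then obtain a b where ab: "a \<noteq> 0" "affine hull e = {x. a \<bullet> x = b}"
    unfolding aff_dim_eq_hyperplane by auto
  have "affine hull e = {x. (a /\<^sub>R norm a) \<bullet> x = b / norm a}"
    using ab by (auto simp: field_simps)
  then have "flat_face e (a /\<^sub>R norm a) (b / norm a)"
    using assms ab by (intro flat_face_if_flat_piece) auto
  then show thesis ..
qed

text \<open>The definition of the normal describes only \<open>T\<close>. A nearby point strictly on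
  the outer side has a whole neighbourhood free of \<open>T\<close>, and one strictly on the inner
  side belongs to the open set \<open>T\<close>, so the frontier is confined to the
  hyperplane.\<close>

lemma frontier_outward_normal:
  assumes n: "is_outward_normal T x \<nu>" and "open T"
  obtains \<epsilon> where "\<epsilon> > 0" "\<And>y. y \<in> ball x \<epsilon> \<Longrightarrow> y \<in> T \<longleftrightarrow> \<nu> \<bullet> (y - x) < 0"
    "\<And>y. y \<in> ball x \<epsilon> \<Longrightarrow> y \<in> frontier T \<Longrightarrow> \<nu> \<bullet> (y - x) = 0"
proof -
  obtain \<epsilon> where e: "\<epsilon> > 0" "\<And>y. y \<in> ball x \<epsilon> \<Longrightarrow> y \<in> T \<longleftrightarrow> \<nu> \<bullet> (y - x) < 0"
    using n by (auto simp: is_outward_normal_def)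
  have "\<nu> \<bullet> (y - x) = 0" if y: "y \<in> ball x \<epsilon>" "y \<in> frontier T" for y
  proof -
    have "y \<notin> T"
      using y \<open>open T\<close> by (simp add: frontier_def interior_open)
    then have ge: "\<nu> \<bullet> (y - x) \<ge> 0"
      using e y by force
    have "\<not> \<nu> \<bullet> (y - x) > 0"
    proof
      assume "\<nu> \<bullet> (y - x) > 0"
      then have "y \<in> ball x \<epsilon> \<inter> {z. \<nu> \<bullet> z > \<nu> \<bullet> x}"
        using y by (simp add: inner_diff_right)
      moreover have "open (ball x \<epsilon> \<inter> {z. \<nu> \<bullet> z > \<nu> \<bullet> x})"
        by (intro open_Int open_ball open_halfspace_gt)
      moreover have "y \<in> closure T"
        using y by (simp add: frontier_def)
      ultimately have "ball x \<epsilon> \<inter> {z. \<nu> \<bullet> z > \<nu> \<bullet> x} \<inter> T \<noteq> {}"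
        using open_Int_closure_eq_empty by (metis IntI empty_iff)
      then obtain z where "z \<in> ball x \<epsilon>" "\<nu> \<bullet> z > \<nu> \<bullet> x" "z \<in> T"
        by auto
      then show False
        using e(2)[of z] by (simp add: inner_diff_right)
    qed
    then show ?thesis
      using ge by simp
  qed
  then show thesis
    using e that by blast
qed

text \<open>A mesh provides an outward normal along \<open>e\<close> but does not say that it is
  orthogonal to \<open>e\<close>. Near \<open>x\<close> the piece lies in the hyperplane orthogonal
  to \<open>\<nu>\<close>, and a nonempty relatively open part of \<open>e\<close> already spans the
  affine hull of \<open>e\<close>.\<close>

lemma outward_normal_imp_flat_face:
  fixes e :: "(real^'d) set"
  assumes e: "flat_piece e" and sub: "e \<subseteq> frontier T" and T: "open T"
    and x: "x \<in> e" "is_outward_normal T x \<nu>"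
  shows "flat_face e \<nu> (\<nu> \<bullet> x)"
proof -
  define c where "c = \<nu> \<bullet> x"
  have n: "norm \<nu> = 1"
    using x by (simp add: is_outward_normal_def)
  then have \<nu>: "\<nu> \<noteq> 0"
    by auto
  obtain \<epsilon> where eps: "\<epsilon> > 0" "\<And>y. y \<in> ball x \<epsilon> \<Longrightarrow> y \<in> frontier T \<Longrightarrow> \<nu> \<bullet> (y - x) = 0"
    using frontier_outward_normal[OF x(2) T] by metis
  have "e \<inter> ball x \<epsilon> \<subseteq> {y. \<nu> \<bullet> y = c}"
  proof
    fix y assume "y \<in> e \<inter> ball x \<epsilon>"
    then have "\<nu> \<bullet> (y - x) = 0"
      using eps(2) sub by blast
    then show "y \<in> {y. \<nu> \<bullet> y = c}"
      by (simp add: inner_diff_right c_def)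
  qed
  then have "affine hull (e \<inter> ball x \<epsilon>) \<subseteq> {y. \<nu> \<bullet> y = c}"
    by (rule hull_minimal) (rule affine_hyperplane)
  moreover have "affine hull (e \<inter> ball x \<epsilon>) = affine hull e"
  proof (rule affine_hull_openin)
    show "openin (top_of_set (affine hull e)) (e \<inter> ball x \<epsilon>)"
      using flat_piece_openin[OF e] by (rule openin_Int_open) (rule open_ball)
    have "x \<in> e \<inter> ball x \<epsilon>"
      using x eps(1) by simp
    then show "e \<inter> ball x \<epsilon> \<noteq> {}"
      by blast
  qed
  ultimately have *: "affine hull e \<subseteq> {y. \<nu> \<bullet> y = c}"
    by metis
  have "aff_dim (affine hull e) = aff_dim {y. \<nu> \<bullet> y = c}"
    using e aff_dim_hyperplane[OF \<nu>, of c] by (simp add: flat_piece_def polyhedral_region_def)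
  with * have "affine hull e = {y. \<nu> \<bullet> y = c}"
    using x(1) by (metis affine_dim_equal affine_affine_hull affine_hyperplane hull_inc empty_iff)
  then show ?thesis
    unfolding c_def by (rule flat_face_if_flat_piece[OF e n])
qed

text \<open>For two distinct normals \<open>\<nu>\<close> and \<open>\<nu>'\<close> of length one,
  the direction \<open>\<nu>' - \<nu>\<close> has a negative product with \<open>\<nu>\<close> and a
  positive one with \<open>\<nu>'\<close>. A short step along it would be inside \<open>T\<close> by
  the first normal and outside by the second.\<close>

lemma outward_normal_eq:
  assumes "is_outward_normal T x \<nu>"
  shows "outward_normal T x = \<nu>"
proof -
  have uniq: "\<nu>' = \<nu>" if n': "is_outward_normal T x \<nu>'" for \<nu>'
  proof (rule ccontr)
    assume ne: "\<nu>' \<noteq> \<nu>"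
    have n: "\<nu> \<bullet> \<nu> = 1" "\<nu>' \<bullet> \<nu>' = 1"
      using assms n' by (simp_all add: is_outward_normal_def dot_square_norm)
    obtain a where a: "a > 0" "\<forall>y\<in>ball x a. y \<in> T \<longleftrightarrow> \<nu> \<bullet> (y - x) < 0"
      using assms by (auto simp: is_outward_normal_def)
    obtain b where b: "b > 0" "\<forall>y\<in>ball x b. y \<in> T \<longleftrightarrow> \<nu>' \<bullet> (y - x) < 0"
      using n' by (auto simp: is_outward_normal_def)
    have "0 < (\<nu>' - \<nu>) \<bullet> (\<nu>' - \<nu>)"
      using ne by simp
    then have lt: "\<nu> \<bullet> \<nu>' < 1"
      by (simp add: inner_diff_left inner_diff_right n inner_commute)
    \<comment> \<open>The step length is half of what would leave the smaller of the two
      balls.\<close>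
    define m where "m = min a b / (2 * norm (\<nu>' - \<nu>))"
    have "m * norm (\<nu>' - \<nu>) = min a b / 2"
      using ne by (simp add: m_def)
    moreover have "min a b > 0"
      using a b by simp
    ultimately have m: "m > 0" "m * norm (\<nu>' - \<nu>) < min a b"
      using ne by (simp add: m_def, linarith)
    let ?y = "x + m *\<^sub>R (\<nu>' - \<nu>)"
    have "?y \<in> ball x a" "?y \<in> ball x b"
      using m by (auto simp: dist_norm)
    then have "\<nu> \<bullet> (?y - x) < 0 \<longleftrightarrow> \<nu>' \<bullet> (?y - x) < 0"
      using a b by blast
    then have "m * (\<nu> \<bullet> \<nu>' - 1) < 0 \<longleftrightarrow> m * (1 - \<nu> \<bullet> \<nu>') < 0"
      by (simp add: inner_diff_right n inner_commute)
    then show False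
      using m lt by (simp add: mult_less_0_iff)
  qed
  have "(THE \<nu>. is_outward_normal T x \<nu>) = \<nu>"
    by (rule the_equality) (fact assms, fact uniq)
  then show ?thesis
    using assms by (auto simp: outward_normal_def)
qed

section \<open>The divergence theorem on a polyhedral element\<close>

lemma integrable_on_bounded:
  fixes g :: "'a::euclidean_space \<Rightarrow> real"
  assumes "continuous_on UNIV g" "bounded S" "S \<in> sets borel"
  shows "integrable lborel (\<lambda>x. g x * indicator S x)"
proof -
  have "integrable lborel (\<lambda>x. indicator (closure S) x *\<^sub>R g x)"
    using assms by (intro borel_integrable_compact) (auto intro: continuous_on_subset)
  then have "integrable lborel (\<lambda>x. indicator S x *\<^sub>R indicator (closure S) x *\<^sub>R g x)"
    by (rule integrable_mult_indicator[rotated]) (use assms in simp)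
  also have "(\<lambda>x. indicator S x *\<^sub>R indicator (closure S) x *\<^sub>R g x) = (\<lambda>x. g x * indicator S x)"
    using closure_subset[of S] by (auto simp: indicator_def fun_eq_iff)
  finally show ?thesis .
qed

lemma integral_lborel_translate:
  fixes f :: "'a::euclidean_space \<Rightarrow> real"
  assumes [measurable]: "f \<in> borel_measurable borel"
  shows "(LINT x|lborel. f (x + a)) = (LINT x|lborel. f x)"
proof -
  have "(LINT x|lborel. f x) = (LINT x|distr lborel borel ((+) a). f x)"
    by (simp add: lborel_distr_plus)
  also have "\<dots> = (LINT x|lborel. f (x + a))"
    by (subst integral_distr) (auto simp: add.commute)
  finally show ?thesis by simp
qed

text \<open>The part of the frontier missed by the faces is controlled by affine sets of codimension
  two, rather than by a null set condition, so that its sweep along an arbitrary direction can be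
  bounded.\<close>

locale polyhedral_element =
  fixes T :: "(real^'d) set" and Es :: "(real^'d) set set" and \<nu> :: "(real^'d) set \<Rightarrow> real^'d"
  assumes T_open: "open T" and T_bdd: "bounded T"
    and finite_Es: "finite Es"
    and disj: "pairwise disjnt Es"
    and sub: "e \<in> Es \<Longrightarrow> e \<subseteq> frontier T"
    and face: "e \<in> Es \<Longrightarrow> \<exists>c. flat_face e (\<nu> e) c"
    and normal: "e \<in> Es \<Longrightarrow> AE x in surface_measure e. is_outward_normal T x (\<nu> e)"
    and cover: "\<exists>\<A>. finite \<A> \<and> (\<forall>A\<in>\<A>. affine A \<and> aff_dim A \<le> int CARD('d) - 2) \<and> frontier T \<subseteq> \<Union>Es \<union> \<Union>\<A>"
begin

lemma negligible_frontier: "negligible (frontier T)"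
proof -
  obtain \<A> where A: "finite \<A>" "\<forall>A\<in>\<A>. affine A \<and> aff_dim A \<le> int CARD('d) - 2" "frontier T \<subseteq> \<Union>Es \<union> \<Union>\<A>"
    using cover by blast
  have "negligible e" if e: "e \<in> Es" for e
  proof -
    obtain c where "flat_face e (\<nu> e) c"
      using face[OF e] by blast
    then interpret flat_face e "\<nu> e" c .
    have "negligible {x. \<nu> e \<bullet> x = c}"
      using norm_nu by (intro negligible_hyperplane) auto
    then show ?thesis
      by (rule negligible_subset) (use in_plane in auto)
  qed
  moreover have "negligible A" if "A \<in> \<A>" for A
    using A that by (intro negligible_affine_lowdim) auto
  ultimately have "negligible (\<Union>Es \<union> \<Union>\<A>)"
    using A finite_Es by (intro negligible_Un negligible_Union) auto
  then show ?thesis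
    using A by (blast intro: negligible_subset)
qed

lemma hit_unique:
  assumes "e \<in> Es" "\<nu> e \<bullet> v \<noteq> 0" "x - s *\<^sub>R v \<in> e" "x - s' *\<^sub>R v \<in> e"
  shows "s = s'"
proof -
  obtain c where "flat_face e (\<nu> e) c"
    using face assms by blast
  then interpret flat_face e "\<nu> e" c .
  have "\<nu> e \<bullet> (x - s *\<^sub>R v) = \<nu> e \<bullet> (x - s' *\<^sub>R v)"
    using in_plane assms by simp
  then show ?thesis
    using assms by (simp add: inner_diff_right)
qed

text \<open>Along a line that meets the faces transversally at good points, the indicator of the
  element minus signed Heaviside functions at the crossings is locally constant.\<close>
lemma crossing:
  assumes t: "t > 0" and ends: "x \<notin> frontier T" "x - t *\<^sub>R v \<notin> frontier T"
    and cov: "\<And>s. 0 < s \<Longrightarrow> s < t \<Longrightarrow> x - s *\<^sub>R v \<in> frontier T \<Longrightarrow> x - s *\<^sub>R v \<in> \<Union>Es"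
    and good: "\<And>e s. e \<in> Es \<Longrightarrow> 0 < s \<Longrightarrow> s < t \<Longrightarrow> x - s *\<^sub>R v \<in> e \<Longrightarrow>
      \<nu> e \<bullet> v \<noteq> 0 \<and> is_outward_normal T (x - s *\<^sub>R v) (\<nu> e)"
  shows "indicator T (x - t *\<^sub>R v) - indicator T x
       = (\<Sum>e\<in>Es. sgn (\<nu> e \<bullet> v) * indicator (prism e v t) x :: real)"
proof -
  define y where "y s = x - s *\<^sub>R v" for s
  define hit where "hit e s \<longleftrightarrow> 0 < s \<and> s < t \<and> y s \<in> e" for e s
  \<comment> \<open>\<open>J e\<close> is a Heaviside function with its jump at the hit. For
    \<open>\<nu> e \<bullet> v > 0\<close> the path enters \<open>T\<close> as \<open>s\<close>
    grows, otherwise it leaves. The inequality is strict on entering and weak on leaving because the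
    open set \<open>T\<close> does not contain the crossing point.\<close>
  define J :: "(real^'d) set \<Rightarrow> real \<Rightarrow> real" where
    "J e s = (if \<nu> e \<bullet> v > 0 then of_bool (\<exists>s'. hit e s' \<and> s' < s)
              else - of_bool (\<exists>s'. hit e s' \<and> s' \<le> s))" for e s
  define G where "G s = indicator T (y s) - (\<Sum>e\<in>Es. J e s)" for s
  have uniq: "s = s'" if "e \<in> Es" "hit e s" "hit e s'" for e s s'
    using hit_unique[of e v x s s'] good[of e s] that by (auto simp: hit_def y_def)
  have J_hit: "J e s = (if \<nu> e \<bullet> v > 0 then of_bool (a < s) else - of_bool (a \<le> s))"
    if e: "e \<in> Es" "hit e a" for e a s
  proof -
    have "(\<exists>s'. hit e s' \<and> s' < s) \<longleftrightarrow> a < s" "(\<exists>s'. hit e s' \<and> s' \<le> s) \<longleftrightarrow> a \<le> s"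
      using uniq[OF e] e(2) by metis+
    then show ?thesis
      by (simp add: J_def)
  qed
  have J_const: "\<forall>\<^sub>F s in nhds a. J e s = J e a" if e: "e \<in> Es" and a: "\<not> hit e a" for e a
  proof (cases "\<exists>s0. hit e s0")
    case True
    then obtain s0 where s0: "hit e s0" by auto
    then have "s0 < a \<or> a < s0"
      using a by (metis linorder_neqE_linordered_idom)
    then show ?thesis
    proof
      assume "s0 < a"
      then have "\<forall>\<^sub>F s in nhds a. s \<in> {s0<..}"
        by (intro eventually_nhds_in_open) auto
      then show ?thesis
        by eventually_elim (use \<open>s0 < a\<close> in \<open>simp add: J_hit[OF e s0]\<close>)
    next
      assume "a < s0"
      then have "\<forall>\<^sub>F s in nhds a. s \<in> {..<s0}"
        by (intro eventually_nhds_in_open) auto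
      then show ?thesis
        by eventually_elim (use \<open>a < s0\<close> in \<open>simp add: J_hit[OF e s0]\<close>)
    qed
  next
    case False
    then show ?thesis
      by (simp add: J_def)
  qed
  have y_lim: "filterlim y (nhds (y a)) (nhds a)" for a
    unfolding y_def by (intro tendsto_intros filterlim_ident)
  have G_const: "\<forall>\<^sub>F s in nhds a. G s = G a" if a: "a \<in> {0..t}" for a
  proof (cases "y a \<in> frontier T")
    case False
    have T: "\<forall>\<^sub>F s in nhds a. (y s \<in> T) = (y a \<in> T)"
    proof (cases "y a \<in> T")
      case True
      then have "\<forall>\<^sub>F z in nhds (y a). z \<in> T"
        using T_open by (intro eventually_nhds_in_open)
      then have "\<forall>\<^sub>F s in nhds a. y s \<in> T"
        using y_lim by (rule eventually_compose_filterlim)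
      then show ?thesis
        using True by simp
    next
      case nT: False
      then have "y a \<in> - closure T"
        using False T_open by (simp add: frontier_def interior_open)
      then have "\<forall>\<^sub>F z in nhds (y a). z \<in> - closure T"
        by (intro eventually_nhds_in_open) auto
      then have "\<forall>\<^sub>F s in nhds a. y s \<in> - closure T"
        using y_lim by (rule eventually_compose_filterlim)
      then show ?thesis
        by eventually_elim (use nT closure_subset in blast)
    qed
    have "\<not> hit e a" if "e \<in> Es" for e
      using False sub[OF that] by (auto simp: hit_def)
    then have "\<forall>\<^sub>F s in nhds a. \<forall>e\<in>Es. J e s = J e a"
      using J_const finite_Es by (simp add: eventually_ball_finite_distrib)
    with T show ?thesis
      by eventually_elim (simp add: G_def indicator_def)
  next
    case True
    have at: "0 < a" "a < t"
      using a True ends by (auto simp: y_def less_le)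
    obtain e0 where e0: "e0 \<in> Es" "y a \<in> e0"
      using cov[OF at] True by (auto simp: y_def)
    have h0: "hit e0 a"
      using at e0 by (simp add: hit_def)
    have g: "\<nu> e0 \<bullet> v \<noteq> 0" "is_outward_normal T (y a) (\<nu> e0)"
      using good[OF e0(1) at] e0 by (auto simp: y_def)
    obtain \<epsilon> where eps: "\<epsilon> > 0" "\<And>z. z \<in> ball (y a) \<epsilon> \<Longrightarrow> z \<in> T \<longleftrightarrow> \<nu> e0 \<bullet> (z - y a) < 0"
      using frontier_outward_normal[OF g(2) T_open] by metis
    have "\<forall>\<^sub>F z in nhds (y a). z \<in> ball (y a) \<epsilon>"
      using eps by (intro eventually_nhds_in_open) auto
    then have "\<forall>\<^sub>F s in nhds a. y s \<in> ball (y a) \<epsilon>"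
      using y_lim by (rule eventually_compose_filterlim)
    then have "\<forall>\<^sub>F s in nhds a. y s \<in> T \<longleftrightarrow> \<nu> e0 \<bullet> (y s - y a) < 0"
      by eventually_elim (rule eps)
    moreover have "\<nu> e0 \<bullet> (y s - y a) = (a - s) * (\<nu> e0 \<bullet> v)" for s
      by (simp add: y_def inner_diff_right algebra_simps)
    ultimately have "\<forall>\<^sub>F s in nhds a. y s \<in> T \<longleftrightarrow> (a - s) * (\<nu> e0 \<bullet> v) < 0"
      by simp
    \<comment> \<open>The indicator and \<open>J e0\<close> jump together, so their difference has
      the same value before, at and after the crossing: 1 if the path leaves \<open>T\<close>, and 0
      if it enters.\<close>
    then have main: "\<forall>\<^sub>F s in nhds a. indicator T (y s) - J e0 s = of_bool (\<nu> e0 \<bullet> v < 0)"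
      by eventually_elim (use g(1) in \<open>auto simp: J_hit[OF e0(1) h0] indicator_def mult_less_0_iff\<close>)
    then have main_a: "indicator T (y a) - J e0 a = of_bool (\<nu> e0 \<bullet> v < 0)"
      by (rule eventually_nhds_x_imp_x)
    have "\<not> hit e a" if "e \<in> Es - {e0}" for e
      using disj e0 that by (auto simp: hit_def pairwise_def disjnt_def)
    then have "\<forall>\<^sub>F s in nhds a. \<forall>e\<in>Es - {e0}. J e s = J e a"
      using J_const finite_Es by (simp add: eventually_ball_finite_distrib)
    with main show ?thesis
    proof eventually_elim
      case (elim s)
      have "G r = (indicator T (y r) - J e0 r) - (\<Sum>e\<in>Es - {e0}. J e r)" for r
        using e0 finite_Es by (simp add: G_def sum.remove)
      then show ?case
        using elim main_a by simp
    qed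
  qed
  \<comment> \<open>Local constancy on a connected interval gives \<open>G t = G 0\<close>. At 0 no
    crossing has been counted, at \<open>t\<close> all of them, and this equality is the claimed
    identity.\<close>
  have "G constant_on {0..t}"
  proof (rule locally_constant_imp_constant)
    fix a assume "a \<in> {0..t}"
    then have "\<forall>\<^sub>F s in nhds a. G s = G a"
      by (rule G_const)
    then have "\<exists>U. open U \<and> a \<in> U \<and> (\<forall>s\<in>U. G s = G a)"
      by (simp only: eventually_nhds)
    then obtain U where U: "open U" "a \<in> U" "\<forall>s\<in>U. G s = G a"
      by (elim exE conjE)
    then show "\<exists>U. openin (top_of_set {0..t}) U \<and> a \<in> U \<and> (\<forall>s\<in>U. G s = G a)"
      using \<open>a \<in> {0..t}\<close> by (intro exI[of _ "{0..t} \<inter> U"] conjI openin_open_Int) blast+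
  qed (rule connected_Icc)
  then have "G t = G 0"
    using t unfolding constant_on_def by (metis atLeastAtMost_iff less_eq_real_def)
  moreover have "J e 0 = 0" for e
    by (auto simp: J_def hit_def)
  moreover have "J e t = sgn (\<nu> e \<bullet> v) * indicator (prism e v t) x" if e: "e \<in> Es" for e
  proof -
    have p: "x \<in> prism e v t \<longleftrightarrow> (\<exists>s. hit e s)"
      by (auto simp: prism_def hit_def y_def)
    have "(\<exists>s'. hit e s' \<and> s' < t) \<longleftrightarrow> (\<exists>s. hit e s)" "(\<exists>s'. hit e s' \<and> s' \<le> t) \<longleftrightarrow> (\<exists>s. hit e s)"
      by (auto simp: hit_def)
    moreover have "\<nu> e \<bullet> v \<noteq> 0" if "hit e s" for s
      using that good[OF e] by (auto simp: hit_def y_def)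
    ultimately show ?thesis
      by (cases "\<nu> e \<bullet> v" "0::real" rule: linorder_cases) (auto simp: J_def indicator_def p)
  qed
  ultimately show ?thesis
    by (simp add: G_def y_def)
qed

text \<open>The starting points to be discarded are those with an end of the segment on the frontier
  (the frontier and its translate), those whose line meets an edge (the swept affine sets), and
  those that hit a face tangentially or at a point without the right normal
  (\<open>AE_prism\<close>).\<close>

lemma AE_crossing:
  assumes t: "t > 0"
  shows "AE x in lborel. indicator T (x - t *\<^sub>R v) - indicator T x
       = (\<Sum>e\<in>Es. sgn (\<nu> e \<bullet> v) * indicator (prism e v t) x :: real)"
proof -
  obtain \<A> where A: "finite \<A>" "\<forall>A\<in>\<A>. affine A \<and> aff_dim A \<le> int CARD('d) - 2" "frontier T \<subseteq> \<Union>Es \<union> \<Union>\<A>"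
    using cover by blast
  define N where "N = frontier T \<union> (+) (t *\<^sub>R v) ` frontier T \<union> (\<Union>A\<in>\<A>. {x. \<exists>s. x - s *\<^sub>R v \<in> A})"
  have "negligible N"
    unfolding N_def using A
    by (intro negligible_Un negligible_Union finite_imageI negligible_frontier negligible_translation)
      (auto intro!: negligible_sweep_affine)
  then have 1: "AE x in lborel. x \<notin> N"
    by (rule AE_lborel_not_negligible)
  have 2: "AE x in lborel. \<forall>e\<in>Es. \<forall>s. 0 < s \<and> s < t \<and> x - s *\<^sub>R v \<in> e \<longrightarrow>
      \<nu> e \<bullet> v \<noteq> 0 \<and> is_outward_normal T (x - s *\<^sub>R v) (\<nu> e)"
    using finite_Es
  proof (rule AE_finite_allI)
    fix e assume e: "e \<in> Es"
    then obtain c where "flat_face e (\<nu> e) c"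
      using face by blast
    then interpret flat_face e "\<nu> e" c .
    show "AE x in lborel. \<forall>s. 0 < s \<and> s < t \<and> x - s *\<^sub>R v \<in> e \<longrightarrow>
      \<nu> e \<bullet> v \<noteq> 0 \<and> is_outward_normal T (x - s *\<^sub>R v) (\<nu> e)"
      by (rule AE_prism[OF normal[OF e] t])
  qed
  from 1 2 show ?thesis
  proof eventually_elim
    case (elim x)
    show ?case
    proof (rule crossing[OF t])
      show "x \<notin> frontier T"
        using elim by (simp add: N_def)
      show "x - t *\<^sub>R v \<notin> frontier T"
      proof
        assume "x - t *\<^sub>R v \<in> frontier T"
        then have "x \<in> (+) (t *\<^sub>R v) ` frontier T"
          by (rule rev_image_eqI) simp
        then show False
          using elim by (simp add: N_def)
      qed
    next
      fix s assume "x - s *\<^sub>R v \<in> frontier T"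
      then show "x - s *\<^sub>R v \<in> \<Union>Es"
        using A(3) elim(1) by (auto simp: N_def)
    next
      fix e s assume "e \<in> Es" "0 < s" "s < t" "x - s *\<^sub>R v \<in> e"
      then show "\<nu> e \<bullet> v \<noteq> 0 \<and> is_outward_normal T (x - s *\<^sub>R v) (\<nu> e)"
        using elim(2) by blast
    qed
  qed
qed

end

lemma directional_difference:
  fixes g g' :: "'a::real_normed_vector \<Rightarrow> real"
  assumes deriv: "\<And>x s. ((\<lambda>s. g (x + s *\<^sub>R v)) has_real_derivative g' (x + s *\<^sub>R v)) (at s)"
    and t: "t \<ge> 0" and B: "\<And>s. 0 \<le> s \<Longrightarrow> s \<le> t \<Longrightarrow> \<bar>g' (x + s *\<^sub>R v)\<bar> \<le> B"
  shows "\<bar>g (x + t *\<^sub>R v) - g x\<bar> \<le> B * t"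
proof (cases "t = 0")
  case False
  then obtain z where z: "0 < z" "z < t" "g (x + t *\<^sub>R v) - g (x + 0 *\<^sub>R v) = (t - 0) * g' (x + z *\<^sub>R v)"
    using t MVT2[of 0 t "\<lambda>s. g (x + s *\<^sub>R v)" "\<lambda>s. g' (x + s *\<^sub>R v)"] deriv by auto
  then show ?thesis
    using B[of z] t by (simp add: abs_mult mult.commute mult_right_mono)
qed simp

section \<open>Integrals over the translated element and their derivative at zero\<close>

context polyhedral_element
begin

lemma T_borel [measurable]: "T \<in> sets borel"
  using T_open by simp

text \<open>A translation moves the shift from \<open>g\<close> to the indicator of
  \<open>T\<close>, where \<open>AE_crossing\<close> applies. A face parallel to \<open>v\<close>
  has the coefficient \<open>sgn 0 = 0\<close>, so only transversal prisms contribute.\<close>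

lemma integral_difference:
  fixes g :: "real^'d \<Rightarrow> real"
  assumes g: "continuous_on UNIV g" and t: "t > 0"
  shows "(LINT x|lborel. (g (x + t *\<^sub>R v) - g x) * indicator T x)
       = (\<Sum>e\<in>Es. sgn (\<nu> e \<bullet> v) * (LINT x|lborel. g x * indicator (prism e v t) x))"
proof -
  have [measurable]: "g \<in> borel_measurable borel"
    using g by (rule borel_measurable_continuous_onI)
  have i1: "integrable lborel (\<lambda>x. g x * indicator T x)"
    by (rule integrable_on_bounded[OF g T_bdd T_borel])
  have i2: "integrable lborel (\<lambda>x. g (x + t *\<^sub>R v) * indicator T x)"
    by (rule integrable_on_bounded[OF _ T_bdd T_borel])
      (intro continuous_on_compose2[OF g] continuous_intros, auto)
  let ?T' = "(+) (t *\<^sub>R v) ` T"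
  have T': "indicator T (x - t *\<^sub>R v) = (indicator ?T' x :: real)" for x
    by (auto simp: indicator_def image_iff algebra_simps)
  have "bounded ?T'" "open ?T'"
    using T_bdd T_open by (auto intro: bounded_translation open_translation)
  then have i3: "integrable lborel (\<lambda>x. g x * indicator T (x - t *\<^sub>R v))"
    unfolding T' by (intro integrable_on_bounded g) auto
  have pr: "integrable lborel (\<lambda>x. sgn (\<nu> e \<bullet> v) * (g x * indicator (prism e v t) x))" if e: "e \<in> Es" for e
  proof (cases "\<nu> e \<bullet> v = 0")
    case False
    obtain c where "flat_face e (\<nu> e) c"
      using face[OF e] by blast
    then interpret flat_face e "\<nu> e" c .
    show ?thesis
      using integrable_on_bounded[OF g bounded_prism prism_measurable[OF False]] by simp
  qed simp
  have "(LINT x|lborel. (g (x + t *\<^sub>R v) - g x) * indicator T x)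
      = (LINT x|lborel. g (x + t *\<^sub>R v) * indicator T x) - (LINT x|lborel. g x * indicator T x)"
    using i1 i2 by (simp add: left_diff_distrib)
  also have "(LINT x|lborel. g (x + t *\<^sub>R v) * indicator T x) = (LINT x|lborel. g x * indicator T (x - t *\<^sub>R v))"
    using integral_lborel_translate[of "\<lambda>x. g x * indicator T (x - t *\<^sub>R v)" "t *\<^sub>R v"] by simp
  also have "\<dots> - (LINT x|lborel. g x * indicator T x)
      = (LINT x|lborel. g x * (indicator T (x - t *\<^sub>R v) - indicator T x))"
    using i1 i3 by (simp add: right_diff_distrib)
  also have "\<dots> = (LINT x|lborel. (\<Sum>e\<in>Es. sgn (\<nu> e \<bullet> v) * (g x * indicator (prism e v t) x)))"
  proof (rule integral_cong_AE)
    show "(\<lambda>x. \<Sum>e\<in>Es. sgn (\<nu> e \<bullet> v) * (g x * indicator (prism e v t) x)) \<in> borel_measurable lborel"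
      using pr by (intro borel_measurable_sum borel_measurable_integrable) auto
    show "AE x in lborel. g x * (indicator T (x - t *\<^sub>R v) - indicator T x)
        = (\<Sum>e\<in>Es. sgn (\<nu> e \<bullet> v) * (g x * indicator (prism e v t) x))"
      using AE_crossing[OF t, of v] by eventually_elim (simp add: sum_distrib_left mult_ac)
  qed simp
  also have "\<dots> = (\<Sum>e\<in>Es. sgn (\<nu> e \<bullet> v) * (LINT x|lborel. g x * indicator (prism e v t) x))"
    using pr by simp
  finally show ?thesis .
qed

text \<open>The derivative at t = 0 of the identity for the difference of the integrals over
  the translated and the original element.\<close>
theorem integral_directional_derivative:
  fixes g g' :: "real^'d \<Rightarrow> real"
  assumes g: "continuous_on UNIV g" and g': "continuous_on UNIV g'"
    and deriv: "\<And>x s. ((\<lambda>s. g (x + s *\<^sub>R v)) has_real_derivative g' (x + s *\<^sub>R v)) (at s)"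
  shows "(LINT x|lborel. g' x * indicator T x) = (\<Sum>e\<in>Es. (\<nu> e \<bullet> v) * (LINT y|surface_measure e. g y))"
proof -
  define t :: "nat \<Rightarrow> real" where "t n = inverse (real (Suc n))" for n
  have t: "t n > 0" "t n \<le> 1" for n
    by (simp_all add: t_def field_simps)
  have t_lim: "t \<longlonglongrightarrow> 0"
    unfolding t_def by (rule LIMSEQ_inverse_real_of_nat)
  have [measurable]: "g \<in> borel_measurable borel" "g' \<in> borel_measurable borel"
    using g g' by (auto intro: borel_measurable_continuous_onI)
  have "bounded (closure T)"
    using T_bdd by (rule bounded_closure)
  then obtain R where R: "\<And>x. x \<in> closure T \<Longrightarrow> norm x \<le> R"
    unfolding bounded_iff by blast
  \<comment> \<open>This ball contains \<open>x + s *\<^sub>R v\<close> for all \<open>x\<close> in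
    the closure of \<open>T\<close> and all \<open>s\<close> between 0 and 1.\<close>
  have "compact (g' ` cball 0 (R + norm v))"
    using g' by (intro compact_continuous_image) (auto intro: continuous_on_subset)
  then have "bounded (g' ` cball 0 (R + norm v))"
    by (rule compact_imp_bounded)
  then obtain B where "\<forall>y\<in>g' ` cball 0 (R + norm v). norm y \<le> B"
    unfolding bounded_iff by blast
  then have B0: "\<bar>g' z\<bar> \<le> B" if "norm z \<le> R + norm v" for z
    using that by auto
  \<comment> \<open>This Lipschitz bound serves twice: it dominates the difference quotients on
    \<open>T\<close>, and it controls the variation of \<open>g\<close> across a thin prism.\<close>
  have B: "\<bar>g (x + s *\<^sub>R v) - g x\<bar> \<le> B * s" if x: "x \<in> closure T" and s: "0 \<le> s" "s \<le> 1" for x s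
  proof (rule directional_difference[OF deriv s(1)])
    fix r assume r: "0 \<le> r" "r \<le> s"
    have "norm (x + r *\<^sub>R v) \<le> norm x + r * norm v"
      using r norm_triangle_ineq[of x "r *\<^sub>R v"] by simp
    also have "\<dots> \<le> R + 1 * norm v"
      using R[OF x] r s by (intro add_mono mult_right_mono) auto
    finally show "\<bar>g' (x + r *\<^sub>R v)\<bar> \<le> B"
      by (intro B0) simp
  qed
  have L1: "(\<lambda>n. LINT x|lborel. (g (x + t n *\<^sub>R v) - g x) / t n * indicator T x)
      \<longlonglongrightarrow> (LINT x|lborel. g' x * indicator T x)"
  proof (rule integral_dominated_convergence)
    show "integrable lborel (\<lambda>x. B * indicator T x)"
      by (rule integrable_on_bounded[OF _ T_bdd T_borel]) simp
    show "AE x in lborel. (\<lambda>n. (g (x + t n *\<^sub>R v) - g x) / t n * indicator T x) \<longlonglongrightarrow> g' x * indicator T x"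
    proof (intro AE_I2 tendsto_mult tendsto_const)
      fix x
      have "((\<lambda>s. g (x + s *\<^sub>R v)) has_real_derivative g' x) (at 0)"
        using deriv[of x 0] by simp
      then have "((\<lambda>h. (g (x + h *\<^sub>R v) - g x) / h) \<longlongrightarrow> g' x) (at 0)"
        by (simp add: DERIV_def)
      moreover have "filterlim t (at 0) sequentially"
        using t_lim t by (intro filterlim_atI) (auto simp: less_le)
      ultimately show "(\<lambda>n. (g (x + t n *\<^sub>R v) - g x) / t n) \<longlonglongrightarrow> g' x"
        by (rule filterlim_compose)
    qed
    show "AE x in lborel. norm ((g (x + t n *\<^sub>R v) - g x) / t n * indicator T x) \<le> B * indicator T x" for n
    proof (rule AE_I2)
      fix x show "norm ((g (x + t n *\<^sub>R v) - g x) / t n * indicator T x) \<le> B * indicator T x"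
        using B[of x "t n"] t[of n] closure_subset[of T]
        by (cases "x \<in> T") (auto simp: abs_mult divide_le_eq mult.commute)
    qed
  qed simp_all
  have L2: "(\<lambda>n. sgn (\<nu> e \<bullet> v) * (LINT x|lborel. g x * indicator (prism e v (t n)) x) / t n)
      \<longlonglongrightarrow> (\<nu> e \<bullet> v) * (LINT y|surface_measure e. g y)" if e: "e \<in> Es" for e
  proof (cases "\<nu> e \<bullet> v = 0")
    case False
    obtain c where "flat_face e (\<nu> e) c"
      using face[OF e] by blast
    then interpret flat_face e "\<nu> e" c .
    note [measurable] = prism_measurable[OF False]
    define b where "b = \<bar>\<nu> e \<bullet> v\<bar>"
    define M where "M = (LINT y|surface_measure e. (1::real))"
    let ?P = "\<lambda>n. LINT x|lborel. g x * indicator (prism e v (t n)) x"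
    let ?I = "LINT y|surface_measure e. g y"
    \<comment> \<open>Replacing \<open>g z\<close> by the value of \<open>g\<close> at the foot of
      \<open>z\<close> on the face costs at most \<open>B * t n\<close>, on a prism of volume
      \<open>t n * b * M\<close>. After division by \<open>t n\<close> the error is still of order
      \<open>t n\<close>.\<close>
    have est: "\<bar>?P n / t n - b * ?I\<bar> \<le> B * b * M * t n" for n
    proof -
      let ?f = "\<lambda>z. g (z - height v z *\<^sub>R v) * indicator (prism e v (t n)) z"
      have fi: "integrable lborel ?f" "integral\<^sup>L lborel ?f = t n * b * ?I"
        using integral_prism[OF False t(1) g] by (auto simp: b_def)
      have gi: "integrable lborel (\<lambda>x. g x * indicator (prism e v (t n)) x)"
        by (rule integrable_on_bounded[OF g bounded_prism prism_measurable[OF False]])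
      have oi: "integrable lborel (\<lambda>x. 1 * indicator (prism e v (t n)) x :: real)"
        "(LINT x|lborel. 1 * indicator (prism e v (t n)) x :: real) = t n * b * M"
        using integral_prism[OF False t(1), of "\<lambda>_. 1"] by (auto simp: b_def M_def)
      have "\<bar>?P n - t n * b * ?I\<bar> = \<bar>LINT z|lborel. g z * indicator (prism e v (t n)) z - ?f z\<bar>"
        using fi gi by simp
      also have "\<dots> \<le> (LINT z|lborel. \<bar>g z * indicator (prism e v (t n)) z - ?f z\<bar>)"
        by (rule integral_abs_bound)
      also have "\<dots> \<le> (LINT z|lborel. B * t n * (1 * indicator (prism e v (t n)) z))"
      proof (rule integral_mono)
        show "integrable lborel (\<lambda>z. \<bar>g z * indicator (prism e v (t n)) z - ?f z\<bar>)"
          using fi gi by (intro integrable_abs Bochner_Integration.integrable_diff)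
        show "integrable lborel (\<lambda>z. B * t n * (1 * indicator (prism e v (t n)) z))"
          using oi(1) by simp
        fix z
        show "\<bar>g z * indicator (prism e v (t n)) z - ?f z\<bar> \<le> B * t n * (1 * indicator (prism e v (t n)) z)"
        proof (cases "z \<in> prism e v (t n)")
          case True
          then have h: "0 < height v z" "height v z < t n" "z - height v z *\<^sub>R v \<in> e"
            using prism_iff[OF False] by auto
          then have c: "z - height v z *\<^sub>R v \<in> closure T"
            using sub[OF e] by (auto simp: frontier_def)
          have "\<bar>g z - g (z - height v z *\<^sub>R v)\<bar> \<le> B * height v z"
            using B[OF c, of "height v z"] h t(2)[of n] by simp
          also have "B \<ge> 0"
            using order_trans[OF abs_ge_zero B0[OF order_trans[OF R[OF c]]]] by simp
          then have "B * height v z \<le> B * t n"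
            using h by (intro mult_left_mono) auto
          finally show ?thesis
            using True by simp
        qed simp
      qed
      also have "\<dots> = B * t n * (t n * b * M)"
        by (subst integral_mult_right_zero) (simp only: oi(2))
      finally have "\<bar>?P n - t n * b * ?I\<bar> / t n \<le> B * b * M * t n"
        using t[of n] by (simp add: divide_le_eq mult_ac)
      moreover have "?P n / t n - b * ?I = (?P n - t n * b * ?I) / t n"
        using t(1)[of n] by (simp add: field_simps)
      ultimately show ?thesis
        using t(1)[of n] by simp
    qed
    have "(\<lambda>n. ?P n / t n - b * ?I) \<longlonglongrightarrow> 0"
    proof (rule Lim_null_comparison)
      show "(\<lambda>n. B * b * M * t n) \<longlonglongrightarrow> 0"
        using tendsto_mult[OF tendsto_const t_lim, of "B * b * M"] by simp
      show "\<forall>\<^sub>F n in sequentially. norm (?P n / t n - b * ?I) \<le> B * b * M * t n"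
        using est by (intro always_eventually allI) simp
    qed
    then have "(\<lambda>n. sgn (\<nu> e \<bullet> v) * (?P n / t n - b * ?I) + sgn (\<nu> e \<bullet> v) * (b * ?I)) \<longlonglongrightarrow>
       sgn (\<nu> e \<bullet> v) * 0 + sgn (\<nu> e \<bullet> v) * (b * ?I)"
      by (intro tendsto_intros)
    moreover have "sgn (\<nu> e \<bullet> v) * (b * ?I) = (\<nu> e \<bullet> v) * ?I"
      by (simp add: b_def sgn_if)
    ultimately show ?thesis
      by (simp add: right_diff_distrib)
  qed simp
  have "(LINT x|lborel. (g (x + t n *\<^sub>R v) - g x) / t n * indicator T x)
      = (\<Sum>e\<in>Es. sgn (\<nu> e \<bullet> v) * (LINT x|lborel. g x * indicator (prism e v (t n)) x) / t n)" for n
  proof -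
    have "(LINT x|lborel. (g (x + t n *\<^sub>R v) - g x) / t n * indicator T x)
       = (LINT x|lborel. (g (x + t n *\<^sub>R v) - g x) * indicator T x) / t n"
      by (subst integral_divide_zero[symmetric]) (simp add: field_simps)
    then show ?thesis
      using integral_difference[OF g t(1)[of n], of v] by (simp add: sum_divide_distrib)
  qed
  then have "(\<lambda>n. LINT x|lborel. (g (x + t n *\<^sub>R v) - g x) / t n * indicator T x)
      \<longlonglongrightarrow> (\<Sum>e\<in>Es. (\<nu> e \<bullet> v) * (LINT y|surface_measure e. g y))"
    using L2 by (simp add: tendsto_sum)
  with L1 show ?thesis
    by (rule LIMSEQ_unique)
qed

end

section \<open>Polynomials and their traces\<close>

text \<open>Continuity of the derivative is asked for one fixed direction at a time, which in finite
  dimension is the usual notion of continuous differentiability and is the form that the directional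
  theorem consumes.\<close>

definition c1_fun :: "('a::real_normed_vector \<Rightarrow> real) \<Rightarrow> bool" where
  "c1_fun p \<longleftrightarrow> (\<forall>x. p differentiable (at x)) \<and> (\<forall>v. continuous_on UNIV (\<lambda>x. frechet_derivative p (at x) v))"

lemma c1_funI:
  assumes "\<And>x. (p has_derivative D x) (at x)" "\<And>v. continuous_on UNIV (\<lambda>x. D x v)"
  shows "c1_fun p"
proof -
  have "frechet_derivative p (at x) = D x" for x
    using frechet_derivative_at[OF assms(1)] by simp
  then show ?thesis
    using assms by (auto simp: c1_fun_def differentiable_def)
qed

lemma c1_fun_has_derivative:
  assumes "c1_fun p"
  shows "(p has_derivative frechet_derivative p (at x)) (at x)"
  using assms by (simp add: c1_fun_def frechet_derivative_works)

lemma c1_fun_continuous: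
  assumes "c1_fun p"
  shows "continuous_on UNIV p"
  using assms by (intro continuous_at_imp_continuous_on ballI differentiable_imp_continuous_within)
    (simp add: c1_fun_def)

lemma c1_fun_derivative_continuous:
  assumes "c1_fun p"
  shows "continuous_on UNIV (\<lambda>x. frechet_derivative p (at x) v)"
  using assms by (simp add: c1_fun_def)

lemma c1_fun_const: "c1_fun (\<lambda>x. c)"
  by (rule c1_funI[where D = "\<lambda>x v. 0"]) auto

lemma c1_fun_nth: "c1_fun (\<lambda>x. x $ i)"
  by (rule c1_funI[where D = "\<lambda>x v. v $ i"])
    (auto intro!: bounded_linear_imp_has_derivative bounded_linear_vec_nth)

lemma c1_fun_add:
  assumes "c1_fun p" "c1_fun q"
  shows "c1_fun (\<lambda>x. p x + q x)"
  by (rule c1_funI[OF has_derivative_add[OF assms[THEN c1_fun_has_derivative]]])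
    (intro continuous_intros assms[THEN c1_fun_derivative_continuous])

lemma c1_fun_mult:
  assumes "c1_fun p" "c1_fun q"
  shows "c1_fun (\<lambda>x. p x * q x)"
  by (rule c1_funI[OF has_derivative_mult[OF assms[THEN c1_fun_has_derivative]]])
    (intro continuous_intros assms[THEN c1_fun_derivative_continuous] assms[THEN c1_fun_continuous])

lemma c1_fun_sum:
  assumes "\<And>i. i \<in> I \<Longrightarrow> c1_fun (p i)"
  shows "c1_fun (\<lambda>x. \<Sum>i\<in>I. p i x)"
  using assms by (induction I rule: infinite_finite_induct) (auto intro: c1_fun_const c1_fun_add)

lemma c1_fun_prod:
  assumes "\<And>i. i \<in> I \<Longrightarrow> c1_fun (p i)"
  shows "c1_fun (\<lambda>x. \<Prod>i\<in>I. p i x)"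
  using assms by (induction I rule: infinite_finite_induct) (auto intro: c1_fun_const c1_fun_mult)

lemma c1_fun_power:
  assumes "c1_fun p"
  shows "c1_fun (\<lambda>x. p x ^ n)"
  using assms by (induction n) (auto intro: c1_fun_const c1_fun_mult)

lemma polys_c1_fun: "p \<in> polys j \<Longrightarrow> c1_fun p"
  unfolding polys_def
  by (auto intro!: c1_fun_sum c1_fun_mult c1_fun_const c1_fun_prod c1_fun_power c1_fun_nth)

lemma polys_continuous: "p \<in> polys j \<Longrightarrow> continuous_on UNIV p"
  by (rule c1_fun_continuous[OF polys_c1_fun])

definition monomial :: "('d \<Rightarrow> nat) \<Rightarrow> real^'d \<Rightarrow> real" where
  "monomial m x = (\<Prod>i\<in>UNIV. x $ i ^ m i)"

definition multi_indices :: "nat \<Rightarrow> ('d::finite \<Rightarrow> nat) set" where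
  "multi_indices j = {m. sum m UNIV \<le> j}"

lemma polys_iff: "p \<in> polys j \<longleftrightarrow> (\<exists>c. p = (\<lambda>x. \<Sum>m\<in>multi_indices j. c m * monomial m x))"
  by (simp add: polys_def monomial_def multi_indices_def)

lemma finite_multi_indices: "finite (multi_indices j)"
proof -
  have "multi_indices j \<subseteq> Pi\<^sub>E UNIV (\<lambda>_. {..j})"
    by (auto simp: multi_indices_def PiE_UNIV_domain) (meson finite member_le_sum UNIV_I le_trans zero_le)
  then show ?thesis
    by (rule finite_subset) (intro finite_PiE, auto)
qed

lemma polys_mono: "j \<le> j' \<Longrightarrow> polys j \<subseteq> polys j'"
proof
  fix p :: "real^'d \<Rightarrow> real"
  assume j: "j \<le> j'" and "p \<in> polys j"
  then obtain c where p: "p = (\<lambda>x. \<Sum>m\<in>multi_indices j. c m * monomial m x)"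
    by (auto simp: polys_iff)
  have "p = (\<lambda>x. \<Sum>m\<in>multi_indices j'. (if m \<in> multi_indices j then c m else 0) * monomial m x)"
    unfolding p using j finite_multi_indices[of j']
    by (intro ext sum.mono_neutral_cong_left) (auto simp: multi_indices_def)
  then show "p \<in> polys j'"
    unfolding polys_iff by (intro exI)
qed

lemma polys_zero: "(\<lambda>x. 0) \<in> polys j"
  unfolding polys_iff by (intro exI[of _ "\<lambda>_. 0"]) simp

lemma polys_add:
  assumes "p \<in> polys j" "q \<in> polys j"
  shows "(\<lambda>x. p x + q x) \<in> polys j"
proof -
  obtain c d where p: "p = (\<lambda>x. \<Sum>m\<in>multi_indices j. c m * monomial m x)"
    and q: "q = (\<lambda>x. \<Sum>m\<in>multi_indices j. d m * monomial m x)"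
    using assms by (auto simp: polys_iff)
  have "(\<lambda>x. p x + q x) = (\<lambda>x. \<Sum>m\<in>multi_indices j. (c m + d m) * monomial m x)"
    by (simp add: p q sum.distrib distrib_right)
  then show ?thesis
    unfolding polys_iff by (intro exI)
qed

lemma polys_scale:
  assumes "p \<in> polys j"
  shows "(\<lambda>x. a * p x) \<in> polys j"
proof -
  obtain c where p: "p = (\<lambda>x. \<Sum>m\<in>multi_indices j. c m * monomial m x)"
    using assms by (auto simp: polys_iff)
  have "(\<lambda>x. a * p x) = (\<lambda>x. \<Sum>m\<in>multi_indices j. (a * c m) * monomial m x)"
    by (simp add: p sum_distrib_left mult_ac)
  then show ?thesis
    unfolding polys_iff by (intro exI)
qed

lemma polys_sum:
  assumes "\<And>i. i \<in> I \<Longrightarrow> p i \<in> polys j"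
  shows "(\<lambda>x. \<Sum>i\<in>I. p i x) \<in> polys j"
  using assms by (induction I rule: infinite_finite_induct) (auto intro: polys_zero polys_add)

lemma polys_monomial:
  assumes "m \<in> multi_indices j"
  shows "monomial m \<in> polys j"
proof -
  have "monomial m = (\<lambda>x. \<Sum>m'\<in>multi_indices j. (if m' = m then 1 else 0) * monomial m' x)"
    using assms by (intro ext) (simp add: finite_multi_indices if_distrib[of "\<lambda>c. c * _"] cong: if_cong)
  then show ?thesis
    unfolding polys_iff by (intro exI)
qed

definition vec_polys :: "nat \<Rightarrow> (real^'d \<Rightarrow> real^'d) set" where
  "vec_polys k = {V. \<forall>i. (\<lambda>x. V x $ i) \<in> polys k}"

lemma vec_poly_onE:
  assumes "v \<in> vec_poly_on k D"
  obtains V where "V \<in> vec_polys k" "\<And>x. x \<in> D \<Longrightarrow> v x = V x"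
proof -
  obtain p where p: "\<And>i. p i \<in> polys k" "\<And>i x. x \<in> D \<Longrightarrow> v x $ i = p i x"
    using assms unfolding vec_poly_on_def poly_on_def by (simp add: Bex_def) metis
  show thesis
    by (rule that[of "\<lambda>x. \<chi> i. p i x"]) (auto simp: vec_polys_def p vec_eq_iff)
qed

lemma vec_polys_continuous:
  assumes "V \<in> vec_polys k"
  shows "continuous_on UNIV V"
proof -
  have "continuous_on UNIV (\<lambda>x. \<chi> i. V x $ i)"
    using assms unfolding vec_polys_def
    by (intro continuous_on_vec_lambda) (auto intro: polys_continuous)
  then show ?thesis
    by simp
qed

lemma vec_polys_inner:
  assumes "V \<in> vec_polys k"
  shows "(\<lambda>x. V x \<bullet> n) \<in> polys k"
proof -
  have "(\<lambda>x. \<Sum>i\<in>UNIV. n $ i * V x $ i) \<in> polys k"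
    using assms by (intro polys_sum polys_scale) (auto simp: vec_polys_def)
  also have "(\<lambda>x. \<Sum>i\<in>UNIV. n $ i * V x $ i) = (\<lambda>x. V x \<bullet> n)"
    by (simp add: inner_vec_def mult.commute)
  finally show ?thesis .
qed

text \<open>Members of the broken spaces are polynomial on \<open>T\<close> only and arbitrary
  elsewhere; since \<open>T\<close> is open, their derivatives at points of \<open>T\<close> are
  nevertheless those of the polynomial.\<close>

lemma gradient_eq:
  assumes "open T" "x \<in> T" "c1_fun p" "\<And>y. y \<in> T \<Longrightarrow> g y = p y"
  shows "gradient g x = (\<chi> i. frechet_derivative p (at x) (axis i 1))"
proof -
  have "(g has_derivative frechet_derivative p (at x)) (at x)"
    by (rule has_derivative_transform_within_open[OF c1_fun_has_derivative[OF assms(3)] assms(1,2)])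
      (use assms(4) in auto)
  then have "frechet_derivative g (at x) = frechet_derivative p (at x)"
    using frechet_derivative_at by metis
  then show ?thesis
    by (simp add: gradient_def)
qed

lemma divergence_eq:
  assumes "open T" "x \<in> T" "\<And>i. c1_fun (\<lambda>x. V x $ i)" "\<And>y. y \<in> T \<Longrightarrow> v y = V y"
  shows "divergence v x = (\<Sum>i\<in>UNIV. frechet_derivative (\<lambda>x. V x $ i) (at x) (axis i 1))"
proof -
  define D where "D h = (\<Sum>i\<in>UNIV. frechet_derivative (\<lambda>x. V x $ i) (at x) h *\<^sub>R (axis i 1 :: real^'a))" for h
  have "((\<lambda>x. \<Sum>i\<in>UNIV. V x $ i *\<^sub>R (axis i 1 :: real^'a)) has_derivative D) (at x)"
    unfolding D_def
    by (intro has_derivative_sum has_derivative_scaleR_left c1_fun_has_derivative assms)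
  also have "(\<lambda>x. \<Sum>i\<in>UNIV. V x $ i *\<^sub>R (axis i 1 :: real^'a)) = V"
    using basis_expansion[of "V _"] by (simp add: scalar_mult_eq_scaleR)
  finally have "(v has_derivative D) (at x)"
    by (rule has_derivative_transform_within_open[OF _ assms(1,2)]) (use assms(4) in auto)
  then have "frechet_derivative v (at x) = D"
    using frechet_derivative_at by metis
  moreover have "D h $ i = frechet_derivative (\<lambda>x. V x $ i) (at x) h" for h i
    by (simp add: D_def axis_def if_distrib cong: if_cong)
  ultimately show ?thesis
    by (simp add: divergence_def)
qed

text \<open>A frontier point of an open set lies outside the set, hence is a genuine limit point of
  it. The filter \<open>at x within T\<close> is therefore nontrivial and the limit is
  unique.\<close>

lemma bdry_trace_eq:
  assumes "open T" "x \<in> frontier T" "continuous_on UNIV p" "\<And>y. y \<in> T \<Longrightarrow> g y = p y"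
  shows "bdry_trace T g x = p x"
proof -
  have "x \<in> closure T - T"
    using assms(1,2) by (simp add: frontier_def interior_open)
  then have "at x within T \<noteq> bot"
    by (auto simp: closure_def trivial_limit_within)
  moreover have "(p \<longlongrightarrow> p x) (at x within T)"
    using assms(3) by (simp add: continuous_on_eq_continuous_at continuous_at_imp_continuous_at_within
        flip: continuous_within)
  then have "(g \<longlongrightarrow> p x) (at x within T)"
    by (rule Lim_transform_eventually) (auto simp: eventually_at_filter assms(4))
  ultimately show ?thesis
    unfolding bdry_trace_def by (rule tendsto_Lim)
qed

lemma integral_lebesgue_on_eq:
  assumes T: "T \<in> sets borel" and F: "F \<in> borel_measurable borel" and "\<And>x. x \<in> T \<Longrightarrow> f x = F x"
  shows "(LINT x|lebesgue_on T. f x) = (LINT x|lborel. F x * indicator T x :: real)"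
proof -
  have "(LINT x|lebesgue_on T. f x) = (LINT x|lebesgue_on T. F x)"
    using assms by (intro Bochner_Integration.integral_cong) auto
  also have "\<dots> = (LINT x|lebesgue. indicator T x *\<^sub>R F x)"
    using T by (intro integral_restrict_space) auto
  also have "\<dots> = (LINT x|lborel. indicator T x *\<^sub>R F x)"
    using T F by (intro integral_completion) auto
  finally show ?thesis
    by (simp add: mult.commute)
qed

section \<open>Functions on faces\<close>

text \<open>In a complete measure space, a set that differs from a measurable one by a null set is
  itself measurable; this is applied to the preimages.\<close>

lemma completion_measurable_AE:
  fixes f g :: "'a \<Rightarrow> 'b::topological_space"
  assumes g: "g \<in> borel_measurable (completion M)" and ae: "AE x in completion M. f x = g x"
  shows "f \<in> borel_measurable (completion M)"
proof (rule measurableI)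
  fix A :: "'b set" assume A: "A \<in> sets borel"
  show "f -` A \<inter> space (completion M) \<in> sets (completion M)"
  proof (rule completion.in_sets_AE)
    show "AE x in completion M. (x \<in> g -` A \<inter> space (completion M)) = (x \<in> f -` A \<inter> space (completion M))"
      using ae by eventually_elim auto
    show "g -` A \<inter> space (completion M) \<in> sets (completion M)"
      using g A by (rule measurable_sets)
  qed simp
qed simp

text \<open>Either both functions are measurable or neither is. In the second case both integrals
  have the default value 0.\<close>

lemma integral_completion_cong_AE:
  fixes f g :: "'a \<Rightarrow> real"
  assumes "AE x in completion M. f x = g x"
  shows "integral\<^sup>L (completion M) f = integral\<^sup>L (completion M) g"
proof (cases "f \<in> borel_measurable (completion M)")
  case True
  have "AE x in completion M. g x = f x"
    using assms by eventually_elim simp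
  then show ?thesis
    using completion_measurable_AE[OF True] assms True by (intro integral_cong_AE) auto
next
  case False
  then have "g \<notin> borel_measurable (completion M)"
    using completion_measurable_AE[of g M f] assms by auto
  with False show ?thesis
    by (metis borel_measurable_integrable not_integrable_integral_eq)
qed

lemma surface_integral_cong_AE:
  fixes f g :: "real^'d \<Rightarrow> real"
  assumes "AE x in surface_measure e. f x = g x"
  shows "integral\<^sup>L (surface_measure e) f = integral\<^sup>L (surface_measure e) g"
  using assms unfolding surface_measure_def by (rule integral_completion_cong_AE)

text \<open>The class of face integrands: it contains the traces and the face polynomials, is closed
  under arithmetic, and consists of integrable functions on each bounded face. Linearity of boundary
  integrals is checked within it.\<close>

definition ae_continuous :: "(real^'d) set \<Rightarrow> (real^'d \<Rightarrow> real) \<Rightarrow> bool" where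
  "ae_continuous e f \<longleftrightarrow> (\<exists>p. continuous_on UNIV p \<and> (AE x in surface_measure e. f x = p x))"

lemma ae_continuous_add:
  assumes "ae_continuous e f" "ae_continuous e g"
  shows "ae_continuous e (\<lambda>x. f x + g x)"
proof -
  obtain p q where "continuous_on UNIV p" "AE x in surface_measure e. f x = p x"
    "continuous_on UNIV q" "AE x in surface_measure e. g x = q x"
    using assms by (auto simp: ae_continuous_def)
  then show ?thesis
    unfolding ae_continuous_def by (intro exI[of _ "\<lambda>x. p x + q x"]) (auto intro: continuous_intros)
qed

lemma ae_continuous_mult:
  assumes "ae_continuous e f" "ae_continuous e g"
  shows "ae_continuous e (\<lambda>x. f x * g x)"
proof -
  obtain p q where "continuous_on UNIV p" "AE x in surface_measure e. f x = p x"
    "continuous_on UNIV q" "AE x in surface_measure e. g x = q x"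
    using assms by (auto simp: ae_continuous_def)
  then show ?thesis
    unfolding ae_continuous_def by (intro exI[of _ "\<lambda>x. p x * q x"]) (auto intro: continuous_intros)
qed

lemma ae_continuous_continuous: "continuous_on UNIV f \<Longrightarrow> ae_continuous e f"
  by (auto simp: ae_continuous_def)

lemma ae_continuous_diff:
  assumes "ae_continuous e f" "ae_continuous e g"
  shows "ae_continuous e (\<lambda>x. f x - g x)"
  using ae_continuous_add[OF assms(1) ae_continuous_mult[OF ae_continuous_continuous assms(2)], of "\<lambda>_. -1"]
  by simp

lemma face_poly_ae_continuous: "g \<in> face_poly s e \<Longrightarrow> ae_continuous e g"
  unfolding face_poly_def ae_continuous_def using polys_continuous by blast

lemma polys_face_poly:
  assumes "p \<in> polys j" "j \<le> s" "AE x in surface_measure e. g x = p x"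
  shows "g \<in> face_poly s e"
  using assms polys_mono[OF assms(2)] by (auto simp: face_poly_def)

lemma face_poly_add:
  assumes "g \<in> face_poly s e" "h \<in> face_poly s e"
  shows "(\<lambda>x. g x + h x) \<in> face_poly s e"
proof -
  obtain p q where p: "p \<in> polys s" "AE x in surface_measure e. g x = p x"
    and q: "q \<in> polys s" "AE x in surface_measure e. h x = q x"
    using assms by (auto simp: face_poly_def)
  have "AE x in surface_measure e. g x + h x = p x + q x"
    using p(2) q(2) by eventually_elim simp
  then show ?thesis
    using polys_add[OF p(1) q(1)] by (auto simp: face_poly_def)
qed

lemma face_poly_scale:
  assumes "g \<in> face_poly s e"
  shows "(\<lambda>x. a * g x) \<in> face_poly s e"
proof -
  obtain p where p: "p \<in> polys s" "AE x in surface_measure e. g x = p x"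
    using assms by (auto simp: face_poly_def)
  have "AE x in surface_measure e. a * g x = a * p x"
    using p(2) by eventually_elim simp
  then show ?thesis
    by (rule polys_face_poly[OF polys_scale[OF p(1)] order_refl])
qed

lemma face_poly_diff:
  assumes "g \<in> face_poly s e" "h \<in> face_poly s e"
  shows "(\<lambda>x. g x - h x) \<in> face_poly s e"
  using face_poly_add[OF assms(1) face_poly_scale[OF assms(2), of "-1"]] by simp

lemma face_poly_zero: "(\<lambda>x. 0) \<in> face_poly s e"
  by (rule polys_face_poly[OF polys_zero order_refl]) simp

lemma face_poly_cong_AE:
  assumes "g \<in> face_poly s e" "AE x in surface_measure e. g x = h x"
  shows "h \<in> face_poly s e"
proof -
  obtain p where p: "p \<in> polys s" "AE x in surface_measure e. g x = p x"
    using assms by (auto simp: face_poly_def)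
  have "AE x in surface_measure e. h x = p x"
    using p(2) assms(2) by eventually_elim simp
  then show ?thesis
    using p(1) by (auto simp: face_poly_def)
qed

context flat_face
begin

lemma ae_continuous_integrable:
  assumes "ae_continuous e f"
  shows "integrable (surface_measure e) f"
proof -
  obtain p where p: "continuous_on UNIV p" "AE x in surface_measure e. f x = p x"
    using assms by (auto simp: ae_continuous_def)
  have pi: "integrable (surface_measure e) p"
    by (rule integrable_surface[OF p(1)])
  have "f \<in> borel_measurable (surface_measure e)"
    using borel_measurable_integrable[OF pi] p(2) unfolding surface_measure_def
    by (rule completion_measurable_AE)
  then show ?thesis
    using integrable_cong_AE[OF _ borel_measurable_integrable[OF pi] p(2)] pi by simp
qed

lemma AE_zero_if_integral_square_zero:
  assumes "ae_continuous e f" "(LINT x|surface_measure e. f x * f x) = 0"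
  shows "AE x in surface_measure e. f x = 0"
proof -
  have "integrable (surface_measure e) (\<lambda>x. f x * f x)"
    using assms by (intro ae_continuous_integrable ae_continuous_mult)
  then have "AE x in surface_measure e. f x * f x = 0"
    using assms(2) integral_nonneg_eq_0_iff_AE[of "surface_measure e" "\<lambda>x. f x * f x"] by simp
  then show ?thesis
    by simp
qed

text \<open>The straight prism over the part of \<open>e\<close> in \<open>A\<close> lies in the
  sweep of \<open>A\<close> along the normal, which is Lebesgue negligible.\<close>

lemma AE_not_thin:
  assumes A: "affine A" "aff_dim A \<le> int CARD('d) - 2"
  shows "AE x in surface_measure e. x \<notin> A"
proof -
  have nn: "\<nu> \<bullet> \<nu> = 1"
    using norm_nu by (simp add: dot_square_norm)
  have [measurable]: "A \<in> sets borel"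
    using affine_closed[OF A(1)] by (rule borel_closed)
  have "AE z in lborel. z \<notin> {x. \<exists>s. x - s *\<^sub>R \<nu> \<in> A}"
    using A by (intro AE_lborel_not_negligible[OF negligible_sweep_affine]) auto
  then have "(\<integral>\<^sup>+z. indicator A (z - height \<nu> z *\<^sub>R \<nu>) * indicator (prism e \<nu> 1) z \<partial>lborel) = (\<integral>\<^sup>+z. 0 \<partial>(lborel :: (real^'d) measure))"
    by (intro nn_integral_cong_AE) (auto simp: indicator_def)
  then have "(\<integral>\<^sup>+y. indicator A y \<partial>surface_measure e) = 0"
    using nn_integral_prism[of \<nu> 1 "indicator A"] nn by simp
  then have "AE y in surface_measure e. indicator A y = (0::ennreal)"
    by (subst (asm) nn_integral_0_iff_AE) (auto intro: surface_measurable)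
  then show ?thesis
    by (rule AE_mp) (auto simp: indicator_def split: if_splits)
qed

end

section \<open>Riesz representation on polynomial spaces\<close>

text \<open>The linear span, built up one term at a time so that linear identities can be propagated
  from the generators by induction.\<close>

inductive_set fun_span :: "('a \<Rightarrow> real) set \<Rightarrow> ('a \<Rightarrow> real) set" for S where
  zero: "(\<lambda>x. 0) \<in> fun_span S"
| step: "p \<in> fun_span S \<Longrightarrow> f \<in> S \<Longrightarrow> (\<lambda>x. p x + c * f x) \<in> fun_span S"

lemma fun_span_mono:
  assumes "p \<in> fun_span S" "S \<subseteq> S'"
  shows "p \<in> fun_span S'"
  using assms by (induction p rule: fun_span.induct) (auto intro: fun_span.intros)

lemma fun_span_combination:
  assumes "q \<in> fun_span S" "p \<in> fun_span S"
  shows "(\<lambda>x. p x + a * q x) \<in> fun_span S"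
  using assms
proof (induction q rule: fun_span.induct)
  case (step q f c)
  have "(\<lambda>x. (p x + a * q x) + (a * c) * f x) \<in> fun_span S"
    by (rule fun_span.step[OF step.IH[OF step.prems] step.hyps(2)])
  then show ?case
    by (simp add: algebra_simps)
qed simp

lemma fun_span_sum:
  assumes "finite I"  "\<And>i. i \<in> I \<Longrightarrow> f i \<in> S"
  shows "(\<lambda>x. \<Sum>i\<in>I. c i * f i x) \<in> fun_span S"
  using assms
proof (induction I rule: finite_induct)
  case (insert i I)
  have "(\<lambda>x. (\<Sum>i\<in>I. c i * f i x) + c i * f i x) \<in> fun_span S"
    using insert by (intro fun_span.step) auto
  then show ?case
    using insert by (simp add: add.commute)
qed (simp add: fun_span.zero)

text \<open>Riesz representation by Gram-Schmidt; the form may be degenerate.\<close>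
lemma fun_span_riesz:
  fixes P :: "('a \<Rightarrow> real) set" and B :: "('a \<Rightarrow> real) \<Rightarrow> ('a \<Rightarrow> real) \<Rightarrow> real"
  assumes comb: "\<And>p q a. p \<in> P \<Longrightarrow> q \<in> P \<Longrightarrow> (\<lambda>x. p x + a * q x) \<in> P" and zero: "(\<lambda>x. 0) \<in> P"
    and sym: "\<And>p q. B p q = B q p"
    and lin: "\<And>p q f a. p \<in> P \<Longrightarrow> q \<in> P \<Longrightarrow> f \<in> P \<Longrightarrow> B (\<lambda>x. p x + a * q x) f = B p f + a * B q f"
    and psd: "\<And>p. p \<in> P \<Longrightarrow> B p p \<ge> 0"
    and S: "finite S" "S \<subseteq> P"
    and l_lin: "\<And>p q a. p \<in> P \<Longrightarrow> q \<in> P \<Longrightarrow> l (\<lambda>x. p x + a * q x) = l p + a * l q"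
    and l_null: "\<And>p. p \<in> P \<Longrightarrow> B p p = 0 \<Longrightarrow> l p = 0"
  shows "\<exists>g\<in>fun_span S. \<forall>f\<in>fun_span S. B g f = l f"
proof -
  have span_P: "p \<in> P" if "p \<in> fun_span S'" "S' \<subseteq> P" for p S'
    using that by (induction p rule: fun_span.induct) (auto intro: zero comb)
  have B0: "B (\<lambda>x. 0) f = 0" if "f \<in> P" for f
    using lin[of "\<lambda>x. 0" "\<lambda>x. 0" f "-1"] zero that by simp
  have extend: "B g f = l f"
    if "f \<in> fun_span S'" "S' \<subseteq> P" "g \<in> P" "\<And>f. f \<in> S' \<Longrightarrow> B g f = l f"
      and l_lin: "\<And>p q a. p \<in> P \<Longrightarrow> q \<in> P \<Longrightarrow> l (\<lambda>x. p x + a * q x) = l p + a * l q" for f g S' l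
    using that(1)
  proof (induction f rule: fun_span.induct)
    case zero
    then show ?case
      using l_lin[of "\<lambda>x. 0" "\<lambda>x. 0" "-1"] \<open>(\<lambda>x. 0) \<in> P\<close> B0[OF \<open>g \<in> P\<close>] sym[of g "\<lambda>x. 0"] by simp
  next
    case (step p f c)
    have pf: "p \<in> P" "f \<in> P"
      using span_P that step by auto
    have "B g (\<lambda>x. p x + c * f x) = B g p + c * B g f"
      using lin[OF pf \<open>g \<in> P\<close>] sym by metis
    then show ?case
      using step that pf by simp
  qed
  \<comment> \<open>The Cauchy-Schwarz inequality in the case needed here: if
    \<open>B p p = 0\<close>, then the form on \<open>a + c p\<close> is affine in \<open>c\<close>.
    With a nonzero slope it would become negative; the chosen \<open>c\<close> makes it -1.\<close>
  have null: "B a p = 0" if "p \<in> P" "B p p = 0" "a \<in> P" for a p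
  proof (rule ccontr)
    assume ne: "B a p \<noteq> 0"
    define c where "c = - (B a a + 1) / (2 * B a p)"
    have q: "(\<lambda>x. a x + c * p x) \<in> P"
      using that by (intro comb)
    have "B (\<lambda>x. a x + c * p x) (\<lambda>x. a x + c * p x) = B a (\<lambda>x. a x + c * p x) + c * B p (\<lambda>x. a x + c * p x)"
      using that q by (intro lin)
    also have "B a (\<lambda>x. a x + c * p x) = B a a + c * B a p"
      using lin[OF \<open>a \<in> P\<close> \<open>p \<in> P\<close> \<open>a \<in> P\<close>] sym by metis
    also have "B p (\<lambda>x. a x + c * p x) = B a p + c * B p p"
      using lin[OF \<open>a \<in> P\<close> \<open>p \<in> P\<close> \<open>p \<in> P\<close>] sym by metis
    finally have "B (\<lambda>x. a x + c * p x) (\<lambda>x. a x + c * p x) = B a a + 2 * c * B a p"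
      using that by simp
    also have "\<dots> = -1"
      using ne by (simp add: c_def field_simps)
    finally show False
      using psd[OF q] by simp
  qed
  show ?thesis
    using S l_lin l_null
  proof (induction S arbitrary: l rule: finite_induct)
    case empty
    have "f = (\<lambda>x. 0)" if "f \<in> fun_span {}" for f :: "'a \<Rightarrow> real"
      using that by (cases rule: fun_span.cases) auto
    moreover have "l (\<lambda>x. 0) = 0"
      using empty(2)[of "\<lambda>x. 0" "\<lambda>x. 0" "-1"] zero by simp
    ultimately show ?case
      using B0[OF zero] by (intro bexI[of _ "\<lambda>x. 0"]) (auto intro: fun_span.zero)
  next
    case (insert a S)
    have a: "a \<in> P" and SP: "S \<subseteq> P"
      using insert by auto
    \<comment> \<open>\<open>h\<close> is the projection of the new generator \<open>a\<close> onto
      the old span. It comes from the induction hypothesis applied to the functional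
      \<open>B a\<close>, which is why \<open>l\<close> is generalized in the induction.\<close>
    obtain h where h: "h \<in> fun_span S" "\<And>f. f \<in> fun_span S \<Longrightarrow> B h f = B a f"
    proof -
      have "\<exists>g\<in>fun_span S. \<forall>f\<in>fun_span S. B g f = B a f"
      proof (rule insert.IH[OF SP])
        show "B a (\<lambda>x. p x + c * q x) = B a p + c * B a q" if "p \<in> P" "q \<in> P" for p q c
          using lin[OF that a] sym by metis
      qed (use null a in auto)
      then show thesis
        using that by blast
    qed
    obtain g where g: "g \<in> fun_span S" "\<And>f. f \<in> fun_span S \<Longrightarrow> B g f = l f"
    proof -
      have "\<exists>g\<in>fun_span S. \<forall>f\<in>fun_span S. B g f = l f"
      proof (rule insert.IH[OF SP])
        show "l (\<lambda>x. p x + c * q x) = l p + c * l q" if "p \<in> P" "q \<in> P" for p q c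
          using that by (rule insert.prems(2))
        show "l p = 0" if "p \<in> P" "B p p = 0" for p
          using that by (rule insert.prems(3))
      qed
      then show thesis
        using that by blast
    qed
    have hP: "h \<in> P" and gP: "g \<in> P"
      using h g span_P SP by auto
    define w where "w = (\<lambda>x. a x + (-1) * h x)"
    have wP: "w \<in> P"
      unfolding w_def using a hP by (rule comb)
    have Bw: "B w f = 0" if "f \<in> fun_span S" for f
      unfolding w_def using lin[OF a hP, of f "-1"] h(2)[OF that] span_P[OF that SP] by simp
    \<comment> \<open>If the component \<open>w\<close> of \<open>a\<close> orthogonal to the old
      span is null for the form, then \<open>l w = 0\<close> by assumption and the coefficient 0 is
      correct.\<close>
    define \<kappa> where "\<kappa> = (if B w w = 0 then 0 else l w / B w w)"
    have kw: "\<kappa> * B w w = l w"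
      using insert.prems(3)[OF wP] by (simp add: \<kappa>_def)
    define G where "G = (\<lambda>x. g x + \<kappa> * w x)"
    have sub: "fun_span S \<subseteq> fun_span (insert a S)"
      using fun_span_mono by blast
    have a_span: "a \<in> fun_span (insert a S)"
      using fun_span.step[OF fun_span.zero, of a "insert a S" 1] by simp
    have "w \<in> fun_span (insert a S)"
      unfolding w_def using h(1) sub a_span by (intro fun_span_combination) auto
    then have G: "G \<in> fun_span (insert a S)"
      unfolding G_def using g(1) sub by (intro fun_span_combination) auto
    have GP: "G \<in> P"
      unfolding G_def using gP wP by (rule comb)
    have BG: "B G f = B g f + \<kappa> * B w f" if "f \<in> P" for f
      unfolding G_def using gP wP that by (rule lin)
    have a_eq: "a = (\<lambda>x. w x + 1 * h x)"
      by (simp add: w_def)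
    have "B G w = B g w + \<kappa> * B w w"
      using BG[OF wP] .
    moreover have "B g w = 0"
      using Bw[OF g(1)] sym by metis
    moreover have "B G h = l h"
      using BG[OF hP] Bw[OF h(1)] g(2)[OF h(1)] by simp
    moreover have "B G a = B G w + 1 * B G h"
      using lin[OF wP hP GP, of 1] sym a_eq by metis
    moreover have "l a = l w + 1 * l h"
      using insert.prems(2)[OF wP hP, of 1] a_eq by metis
    ultimately have Ga: "B G a = l a"
      using kw by simp
    have "B G f = l f" if "f \<in> insert a S" for f
    proof (cases "f = a")
      case False
      then have "f \<in> fun_span S" "f \<in> P"
        using that SP fun_span.step[OF fun_span.zero, of f S 1] by auto
      then show ?thesis
        using BG Bw g(2) by simp
    qed (use Ga in simp)
    then have "B G f = l f" if "f \<in> fun_span (insert a S)" for f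
      using extend[OF that insert.prems(1) GP] insert.prems(2) by blast
    then show ?case
      using G by blast
  qed
qed

lemma polys_eq_fun_span: "(polys j :: (real^'d \<Rightarrow> real) set) = fun_span (monomial ` multi_indices j)"
proof
  show "(polys j :: (real^'d \<Rightarrow> real) set) \<subseteq> fun_span (monomial ` multi_indices j)"
    using finite_multi_indices by (auto simp: polys_iff intro!: fun_span_sum)
  show "fun_span (monomial ` multi_indices j) \<subseteq> (polys j :: (real^'d \<Rightarrow> real) set)"
  proof
    fix p :: "real^'d \<Rightarrow> real"
    assume "p \<in> fun_span (monomial ` multi_indices j)"
    then show "p \<in> polys j"
    proof (induction rule: fun_span.induct)
      case (step p f c)
      then show ?case
        by (auto intro!: polys_add[OF _ polys_scale[OF polys_monomial]])
    qed (rule polys_zero)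
  qed
qed

section \<open>Integration by parts for polynomials\<close>

lemma c1_fun_directional_derivative:
  assumes "c1_fun g"
  shows "((\<lambda>s. g (x + s *\<^sub>R v)) has_real_derivative frechet_derivative g (at (x + s *\<^sub>R v)) v) (at s)"
proof -
  let ?D = "frechet_derivative g (at (x + s *\<^sub>R v))"
  have D: "(g has_derivative ?D) (at (x + s *\<^sub>R v))"
    by (rule c1_fun_has_derivative[OF assms])
  have "((\<lambda>s. x + s *\<^sub>R v) has_derivative (\<lambda>h. h *\<^sub>R v)) (at s)"
    by (auto intro!: derivative_eq_intros)
  from has_derivative_compose[OF this D]
  have "((\<lambda>s. g (x + s *\<^sub>R v)) has_derivative (\<lambda>h. ?D (h *\<^sub>R v))) (at s)" .
  moreover have "?D (h *\<^sub>R v) = ?D v * h" for h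
    using linear_scale[OF has_derivative_linear[OF D]] by simp
  ultimately show ?thesis
    by (simp add: has_field_derivative_def)
qed

text \<open>The divergence of the polynomial that represents a field on \<open>T\<close>: it agrees
  with \<open>divergence\<close> at points of \<open>T\<close>, and is continuous on the whole
  space.\<close>

definition poly_div :: "(real^'d \<Rightarrow> real^'d) \<Rightarrow> real^'d \<Rightarrow> real" where
  "poly_div V x = (\<Sum>i\<in>UNIV. frechet_derivative (\<lambda>x. V x $ i) (at x) (axis i 1))"

definition poly_grad :: "(real^'d \<Rightarrow> real) \<Rightarrow> real^'d \<Rightarrow> real^'d" where
  "poly_grad U x = (\<chi> i. frechet_derivative U (at x) (axis i 1))"

lemma poly_div_continuous:
  assumes "V \<in> vec_polys k"
  shows "continuous_on UNIV (poly_div V)"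
  unfolding poly_div_def using assms
  by (intro continuous_on_sum c1_fun_derivative_continuous) (auto simp: vec_polys_def intro: polys_c1_fun)

lemma poly_grad_continuous:
  assumes "U \<in> polys k"
  shows "continuous_on UNIV (poly_grad U)"
  unfolding poly_grad_def using assms
  by (intro continuous_on_vec_lambda c1_fun_derivative_continuous) (rule polys_c1_fun)

context polyhedral_element
begin

text \<open>Apply the directional theorem to \<open>U\<close> times the \<open>i\<close>-th
  component of \<open>V\<close> in the \<open>i\<close>-th coordinate direction and sum over
  \<open>i\<close>. The factors \<open>\<nu> e \<bullet> axis i 1\<close> are the components of the
  normal and reassemble the normal component of \<open>V\<close>.\<close>

lemma gauss_polys:
  assumes U: "U \<in> polys r" and V: "V \<in> vec_polys k"
  shows "(LINT x|lborel. U x * poly_div V x * indicator T x) + (LINT x|lborel. (V x \<bullet> poly_grad U x) * indicator T x)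
      = (\<Sum>e\<in>Es. LINT y|surface_measure e. U y * (V y \<bullet> \<nu> e))"
proof -
  let ?d = "\<lambda>i x. U x * frechet_derivative (\<lambda>x. V x $ i) (at x) (axis i 1)
      + frechet_derivative U (at x) (axis i 1) * V x $ i"
  have cU: "c1_fun U"
    using U by (rule polys_c1_fun)
  have cV: "c1_fun (\<lambda>x. V x $ i)" for i
    using V by (auto simp: vec_polys_def intro: polys_c1_fun)
  have contd: "continuous_on UNIV (?d i)" for i
    by (intro continuous_intros c1_fun_derivative_continuous c1_fun_continuous cU cV)
  have contg: "continuous_on UNIV (\<lambda>x. U x * V x $ i)" for i
    by (intro continuous_intros c1_fun_continuous cU cV)
  have "(LINT x|lborel. ?d i x * indicator T x)
      = (\<Sum>e\<in>Es. (\<nu> e \<bullet> axis i 1) * (LINT y|surface_measure e. U y * V y $ i))" for i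
  proof (rule integral_directional_derivative[OF contg contd])
    fix x :: "real^'d" and s :: real
    have "frechet_derivative (\<lambda>x. U x * V x $ i) (at y) = (\<lambda>h. U y * frechet_derivative (\<lambda>x. V x $ i) (at y) h
      + frechet_derivative U (at y) h * V y $ i)" for y
      using frechet_derivative_at[OF has_derivative_mult[OF cU[THEN c1_fun_has_derivative] cV[THEN c1_fun_has_derivative]]]
      by metis
    then show "((\<lambda>s. U (x + s *\<^sub>R axis i 1) * V (x + s *\<^sub>R axis i 1) $ i) has_real_derivative ?d i (x + s *\<^sub>R axis i 1)) (at s)"
      using c1_fun_directional_derivative[OF c1_fun_mult[OF cU cV[of i]], of x "axis i 1" s] by simp
  qed
  then have "(\<Sum>i\<in>UNIV. LINT x|lborel. ?d i x * indicator T x)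
      = (\<Sum>i\<in>UNIV. \<Sum>e\<in>Es. \<nu> e $ i * (LINT y|surface_measure e. U y * V y $ i))"
    by (simp add: inner_axis)
  also have "\<dots> = (\<Sum>e\<in>Es. \<Sum>i\<in>UNIV. \<nu> e $ i * (LINT y|surface_measure e. U y * V y $ i))"
    by (rule sum.swap)
  also have "\<dots> = (\<Sum>e\<in>Es. LINT y|surface_measure e. U y * (V y \<bullet> \<nu> e))"
  proof (rule sum.cong[OF refl])
    fix e assume e: "e \<in> Es"
    then obtain c where "flat_face e (\<nu> e) c"
      using face by blast
    then interpret flat_face e "\<nu> e" c .
    have "(\<Sum>i\<in>UNIV. \<nu> e $ i * (LINT y|surface_measure e. U y * V y $ i))
        = (LINT y|surface_measure e. (\<Sum>i\<in>UNIV. \<nu> e $ i * (U y * V y $ i)))"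
      using integrable_surface[OF contg] by simp
    also have "(\<lambda>y. \<Sum>i\<in>UNIV. \<nu> e $ i * (U y * V y $ i)) = (\<lambda>y. U y * (V y \<bullet> \<nu> e))"
      by (simp add: inner_vec_def sum_distrib_left mult_ac)
    finally show "(\<Sum>i\<in>UNIV. \<nu> e $ i * (LINT y|surface_measure e. U y * V y $ i))
        = (LINT y|surface_measure e. U y * (V y \<bullet> \<nu> e))" .
  qed
  also have "(\<Sum>i\<in>UNIV. LINT x|lborel. ?d i x * indicator T x) = (LINT x|lborel. (\<Sum>i\<in>UNIV. ?d i x * indicator T x))"
    by (rule Bochner_Integration.integral_sum[symmetric]) (rule integrable_on_bounded[OF contd T_bdd T_borel])
  also have "(\<lambda>x. \<Sum>i\<in>UNIV. ?d i x * indicator T x)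
      = (\<lambda>x. U x * poly_div V x * indicator T x + (V x \<bullet> poly_grad U x) * indicator T x)"
    by (auto simp: poly_div_def poly_grad_def inner_vec_def sum_distrib_left sum.distrib
        indicator_def mult_ac)
  also have "(LINT x|lborel. U x * poly_div V x * indicator T x + (V x \<bullet> poly_grad U x) * indicator T x)
     = (LINT x|lborel. U x * poly_div V x * indicator T x) + (LINT x|lborel. (V x \<bullet> poly_grad U x) * indicator T x)"
    by (intro Bochner_Integration.integral_add integrable_on_bounded T_bdd T_borel continuous_intros
        polys_continuous[OF U] vec_polys_continuous[OF V] poly_div_continuous[OF V] poly_grad_continuous[OF U])
  finally show ?thesis .
qed

end

section \<open>Polyhedral meshes\<close>

lemma polyhedral_domain_regular:
  fixes D :: "(real^'d) set"
  assumes "polyhedral_domain D"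
  shows "interior (closure D) = D" "open D" "bounded D" "D \<noteq> {}"
proof -
  have D: "aff_dim D = int CARD('d)" "rel_interior (closure D) = D"
    using assms by (auto simp: polyhedral_domain_def polyhedral_region_def)
  then have "rel_interior (closure D) = interior (closure D)"
    by (intro rel_interior_interior) (simp add: aff_dim_eq_full[symmetric])
  then show 1: "interior (closure D) = D"
    using D by simp
  then show "open D"
    by (metis open_interior)
  show "bounded D"
    using assms polyhedral_region_bounded by (auto simp: polyhedral_domain_def)
  show "D \<noteq> {}"
    using D(1) by auto
qed

locale polyhedral_mesh =
  fixes \<Omega> :: "(real^'d) set" and \<T> \<E> :: "(real^'d) set set"
  assumes domain: "polyhedral_domain \<Omega>"
    and mesh: "is_mesh \<Omega> \<T> \<E>"
begin

definition faces :: "(real^'d) set \<Rightarrow> (real^'d) set set" where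
  "faces T = {e\<in>\<E>. e \<subseteq> frontier T}"

text \<open>Both conditions are asked of the same vector, which thus is at once a normal of the
  hyperplane of \<open>e\<close> and the outward normal almost everywhere on
  \<open>e\<close>.\<close>

definition face_normal :: "(real^'d) set \<Rightarrow> (real^'d) set \<Rightarrow> real^'d" where
  "face_normal T e = (SOME \<nu>. (\<exists>c. flat_face e \<nu> c) \<and> (AE x in surface_measure e. is_outward_normal T x \<nu>))"

lemma finite_T: "finite \<T>"
  and elem: "T \<in> \<T> \<Longrightarrow> polyhedral_domain T" "T \<in> \<T> \<Longrightarrow> T \<subseteq> \<Omega>"
  and elems_disjnt: "pairwise disjnt \<T>"
  and elems_cover: "closure \<Omega> = (\<Union>T\<in>\<T>. closure T)"
  and finite_E: "finite \<E>"
  and flat: "e \<in> \<E> \<Longrightarrow> flat_piece e"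
  and pieces_disjnt: "pairwise disjnt \<E>"
  and frontier_cover: "T \<in> \<T> \<Longrightarrow> frontier T = (\<Union>e\<in>faces T. closure e)"
  and normal_exists: "T \<in> \<T> \<Longrightarrow> e \<in> faces T \<Longrightarrow> \<exists>\<nu>. AE x in surface_measure e. is_outward_normal T x \<nu>"
  using mesh unfolding is_mesh_def faces_def by auto

lemma elem_regular:
  assumes "T \<in> \<T>"
  shows "interior (closure T) = T" "open T" "bounded T" "T \<noteq> {}"
  using polyhedral_domain_regular[OF elem(1)[OF assms]] by auto

lemma face_normal:
  assumes T: "T \<in> \<T>" and e: "e \<in> faces T"
  shows "\<exists>c. flat_face e (face_normal T e) c"
    and "AE x in surface_measure e. is_outward_normal T x (face_normal T e)"
proof -
  have fl: "flat_piece e" and sub: "e \<subseteq> frontier T"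
    using e flat by (auto simp: faces_def)
  obtain \<nu> where \<nu>: "AE x in surface_measure e. is_outward_normal T x \<nu>"
    using normal_exists[OF assms] by blast
  have "\<exists>\<nu>. (\<exists>c. flat_face e \<nu> c) \<and> (AE x in surface_measure e. is_outward_normal T x \<nu>)"
  proof (cases "\<exists>x\<in>e. is_outward_normal T x \<nu>")
    case True
    then show ?thesis
      using \<nu> outward_normal_imp_flat_face[OF fl sub elem_regular(2)[OF T]] by blast
  next
    \<comment> \<open>If no point of \<open>e\<close> has the normal \<open>\<nu>\<close>, the
      almost everywhere statement is contradictory on \<open>e\<close> and hence true of every
      vector; a unit normal of the hyperplane can then be taken.\<close>
    case False
    obtain \<nu>' c where f: "flat_face e \<nu>' c"
      using flat_piece_imp_flat_face[OF fl] .
    have "AE x in surface_measure e. x \<in> e"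
      using flat_face.space_surface[OF f] AE_space[of "surface_measure e"] by simp
    with \<nu> have "AE x in surface_measure e. is_outward_normal T x \<nu>'"
      by eventually_elim (use False in blast)
    then show ?thesis
      using f by blast
  qed
  then have "(\<exists>c. flat_face e (face_normal T e) c) \<and> (AE x in surface_measure e. is_outward_normal T x (face_normal T e))"
    unfolding face_normal_def by (rule someI_ex)
  then show "\<exists>c. flat_face e (face_normal T e) c"
    and "AE x in surface_measure e. is_outward_normal T x (face_normal T e)"
    by auto
qed

lemma thin_boundary:
  assumes "e \<in> \<E>"
  obtains \<A> where "finite \<A>" "\<And>A. A \<in> \<A> \<Longrightarrow> affine A \<and> aff_dim A \<le> int CARD('d) - 2"
    "closure e - e \<subseteq> \<Union>\<A>"
proof -
  have "polyhedral_region (int CARD('d) - 1) e"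
    using flat[OF assms] by (simp add: flat_piece_def)
  then obtain \<A> where "finite \<A>" "\<And>A. A \<in> \<A> \<Longrightarrow> affine A \<and> aff_dim A \<le> int CARD('d) - 1 - 1"
    "closure e - e \<subseteq> \<Union>\<A>"
    by (rule closure_diff_polyhedral_region) blast
  then show thesis
    by (intro that[of \<A>]) auto
qed

text \<open>The closures of the faces cover the frontier, so what the faces themselves miss lies in
  their relative boundaries, which are contained in finitely many affine sets of codimension
  two.\<close>

lemma element:
  assumes T: "T \<in> \<T>"
  shows "polyhedral_element T (faces T) (face_normal T)"
proof
  show "open T" "bounded T"
    using elem_regular[OF T] by auto
  show "finite (faces T)"
    using finite_E by (simp add: faces_def)
  show "pairwise disjnt (faces T)"
    using pieces_disjnt by (rule pairwise_subset) (auto simp: faces_def)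
  show "e \<subseteq> frontier T" if "e \<in> faces T" for e
    using that by (simp add: faces_def)
  show "\<exists>c. flat_face e (face_normal T e) c" "AE x in surface_measure e. is_outward_normal T x (face_normal T e)"
    if "e \<in> faces T" for e
    using face_normal[OF T that] by auto
  have "\<exists>\<A>. finite \<A> \<and> (\<forall>A\<in>\<A>. affine A \<and> aff_dim A \<le> int CARD('d) - 2) \<and> closure e - e \<subseteq> \<Union>\<A>"
    if e: "e \<in> faces T" for e
    using thin_boundary[of e] e unfolding faces_def by (metis mem_Collect_eq)
  then obtain \<A> where A: "\<And>e. e \<in> faces T \<Longrightarrow> finite (\<A> e)"
    "\<And>e A. e \<in> faces T \<Longrightarrow> A \<in> \<A> e \<Longrightarrow> affine A \<and> aff_dim A \<le> int CARD('d) - 2"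
    "\<And>e. e \<in> faces T \<Longrightarrow> closure e - e \<subseteq> \<Union>(\<A> e)"
    by metis
  show "\<exists>\<A>. finite \<A> \<and> (\<forall>A\<in>\<A>. affine A \<and> aff_dim A \<le> int CARD('d) - 2) \<and> frontier T \<subseteq> \<Union>(faces T) \<union> \<Union>\<A>"
  proof (intro exI[of _ "\<Union>(\<A> ` faces T)"] conjI ballI)
    show "finite (\<Union>(\<A> ` faces T))"
      using A(1) \<open>finite (faces T)\<close> by auto
    show "frontier T \<subseteq> \<Union>(faces T) \<union> \<Union>(\<Union>(\<A> ` faces T))"
    proof
      fix x assume "x \<in> frontier T"
      then obtain e where e: "e \<in> faces T" "x \<in> closure e"
        unfolding frontier_cover[OF T] by auto
      then show "x \<in> \<Union>(faces T) \<union> \<Union>(\<Union>(\<A> ` faces T))"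
        using A(3)[OF e(1)] by (cases "x \<in> e") auto
    qed
    fix A assume "A \<in> \<Union>(\<A> ` faces T)"
    then show "affine A" "aff_dim A \<le> int CARD('d) - 2"
      using A(2) by auto
  qed
qed

lemma piece_flat_face:
  assumes "e \<in> \<E>"
  obtains \<nu> c where "flat_face e \<nu> c"
  using flat_piece_imp_flat_face[OF flat[OF assms]] .

lemma AE_in_piece:
  assumes "e \<in> \<E>"
  shows "AE x in surface_measure e. x \<in> e"
proof -
  obtain \<nu> c where "flat_face e \<nu> c"
    using piece_flat_face[OF assms] .
  then show ?thesis
    using flat_face.space_surface AE_space[of "surface_measure e"] by metis
qed

text \<open>Mesh pieces are pairwise disjoint, so a piece that is not a face of \<open>T\<close> can
  meet the frontier of \<open>T\<close> only in the relative boundaries of faces, and those are too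
  thin to have surface measure.\<close>

lemma AE_not_frontier:
  assumes T: "T \<in> \<T>" and e: "e \<in> \<E>" "e \<notin> faces T"
  shows "AE x in surface_measure e. x \<notin> frontier T"
proof -
  obtain \<nu> c where f: "flat_face e \<nu> c"
    using piece_flat_face[OF e(1)] .
  then interpret flat_face e \<nu> c .
  have fin: "finite (faces T)"
    using finite_E by (simp add: faces_def)
  have "AE x in surface_measure e. x \<notin> closure e' - e'" if e': "e' \<in> faces T" for e'
  proof -
    have "e' \<in> \<E>"
      using e' by (simp add: faces_def)
    then obtain \<A> where A: "finite \<A>" "\<And>A. A \<in> \<A> \<Longrightarrow> affine A \<and> aff_dim A \<le> int CARD('d) - 2"
      "closure e' - e' \<subseteq> \<Union>\<A>"
      using thin_boundary by blast
    have "AE x in surface_measure e. \<forall>A\<in>\<A>. x \<notin> A"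
      using A by (intro AE_finite_allI AE_not_thin) auto
    then show ?thesis
      by eventually_elim (use A(3) in blast)
  qed
  then have "AE x in surface_measure e. \<forall>e'\<in>faces T. x \<notin> closure e' - e'"
    using fin by (intro AE_finite_allI)
  with AE_in_piece[OF e(1)] show ?thesis
  proof eventually_elim
    case (elim x)
    have "x \<notin> e'" if "e' \<in> faces T" for e'
      using elim(1) that e pieces_disjnt by (auto simp: faces_def pairwise_def disjnt_def)
    then show ?case
      using elim(2) unfolding frontier_cover[OF T] by blast
  qed
qed

text \<open>Each piece contributes either completely or not at all, so the restriction to the
  frontier of \<open>T\<close> becomes a selection of pieces.\<close>

lemma surf_ip_frontier:
  fixes g h :: "real^'d \<Rightarrow> 'b::real_inner"
  assumes T: "T \<in> \<T>"
  shows "surf_ip \<E> (frontier T) g h = (\<Sum>e\<in>faces T. LINT x|surface_measure e. g x \<bullet> h x)"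
proof -
  have "surf_ip \<E> (frontier T) g h = (\<Sum>e\<in>\<E>. if e \<in> faces T then LINT x|surface_measure e. g x \<bullet> h x else 0)"
    unfolding surf_ip_def
  proof (rule sum.cong[OF refl])
    fix e assume e: "e \<in> \<E>"
    show "(LINT x:frontier T|surface_measure e. g x \<bullet> h x) = (if e \<in> faces T then LINT x|surface_measure e. g x \<bullet> h x else 0)"
    proof (cases "e \<in> faces T")
      case True
      have "AE x in surface_measure e. indicator (frontier T) x *\<^sub>R (g x \<bullet> h x) = g x \<bullet> h x"
        using AE_in_piece[OF e] by eventually_elim (use True in \<open>auto simp: faces_def\<close>)
      then show ?thesis
        using True unfolding set_lebesgue_integral_def by (simp add: surface_integral_cong_AE)
    next
      case False
      have "AE x in surface_measure e. indicator (frontier T) x *\<^sub>R (g x \<bullet> h x) = 0"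
        using AE_not_frontier[OF T e False] by eventually_elim simp
      then show ?thesis
        using False unfolding set_lebesgue_integral_def by (simp add: integral_eq_zero_AE)
    qed
  qed
  then show ?thesis
    using finite_E by (simp add: faces_def sum.If_cases Int_def)
qed

text \<open>Near a point with outward normals the mesh consists of one or of two half balls.\<close>
lemma frontier_domain_dichotomy:
  assumes e: "e \<in> \<E>"
  shows "(AE x in surface_measure e. x \<in> frontier \<Omega>) \<or> (AE x in surface_measure e. x \<notin> frontier \<Omega>)"
proof -
  have reg: "interior (closure \<Omega>) = \<Omega>" "open \<Omega>"
    using polyhedral_domain_regular[OF domain] by auto
  have fr: "frontier \<Omega> = closure \<Omega> - \<Omega>"
    using reg(2) by (simp add: frontier_def interior_open)
  have frT: "frontier T = closure T - T" if "T \<in> \<T>" for T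
    using elem_regular[OF that] by (simp add: frontier_def interior_open)
  \<comment> \<open>The number of elements with the face \<open>e\<close> decides. With exactly one,
    almost every point of \<open>e\<close> is on the outer boundary; with none, or with two or more,
    almost no point is.\<close>
  consider "\<forall>T\<in>\<T>. e \<notin> faces T" | T where "T \<in> \<T>" "e \<in> faces T" "\<forall>T'\<in>\<T> - {T}. e \<notin> faces T'"
    | T T' where "T \<in> \<T>" "T' \<in> \<T>" "T \<noteq> T'" "e \<in> faces T" "e \<in> faces T'"
    by blast
  then show ?thesis
  proof cases
    case 1
    have "AE x in surface_measure e. \<forall>T\<in>\<T>. x \<notin> frontier T"
      using 1 by (intro AE_finite_allI finite_T AE_not_frontier e) auto
    then have "AE x in surface_measure e. x \<notin> frontier \<Omega>"
    proof eventually_elim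
      case (elim x)
      then show ?case
        using frT elem(2) unfolding fr elems_cover by blast
    qed
    then show ?thesis ..
  next
    case (2 T)
    have "AE x in surface_measure e. \<forall>T'\<in>\<T> - {T}. x \<notin> frontier T'"
      using 2 finite_T by (intro AE_finite_allI AE_not_frontier e) auto
    then have "AE x in surface_measure e. x \<in> frontier \<Omega>"
      using AE_in_piece[OF e]
    proof eventually_elim
      case (elim x)
      then have x: "x \<in> closure T" "x \<notin> T"
        using 2 frT by (auto simp: faces_def)
      have "x \<notin> closure T'" if "T' \<in> \<T> - {T}" for T'
      proof -
        have "T' \<inter> T = {}"
          using that 2(1) elems_disjnt by (auto simp: pairwise_def disjnt_def)
        then have "T' \<inter> closure T = {}"
          using open_Int_closure_eq_empty[OF elem_regular(2)] that by blast
        then show ?thesis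
          using elim(1) frT that x(1) by blast
      qed
      \<comment> \<open>Outside the other closed elements the domain is contained in the closure of
        \<open>T\<close>. A point of \<open>\<Omega>\<close> in \<open>U\<close> would thus be
        interior to the closure of \<open>T\<close>, that is, in \<open>T\<close>.\<close>
      moreover define U where "U = - (\<Union>T'\<in>\<T> - {T}. closure T')"
      ultimately have U: "open U" "x \<in> U"
        using finite_T by auto
      have "x \<notin> \<Omega>"
      proof
        assume "x \<in> \<Omega>"
        then have "x \<in> U \<inter> \<Omega>" "open (U \<inter> \<Omega>)"
          using U reg by auto
        moreover have "U \<inter> \<Omega> \<subseteq> closure T"
          using closure_subset[of \<Omega>] elems_cover by (auto simp: U_def)
        ultimately have "x \<in> interior (closure T)"
          by (meson interiorI)
        then show False
          using x elem_regular(1)[OF 2(1)] by simp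
      qed
      then show ?case
        using x(1) 2(1) unfolding fr elems_cover by blast
    qed
    then show ?thesis ..
  next
    case (3 T T')
    have "AE x in surface_measure e. x \<notin> frontier \<Omega>"
      using face_normal(2)[OF 3(1,4)] face_normal(2)[OF 3(2,5)]
    proof eventually_elim
      case (elim x)
      let ?n = "face_normal T e" and ?n' = "face_normal T' e"
      obtain a where a: "a > 0" "\<And>y. y \<in> ball x a \<Longrightarrow> y \<in> T \<longleftrightarrow> ?n \<bullet> (y - x) < 0"
        "\<And>y. y \<in> ball x a \<Longrightarrow> y \<in> frontier T \<Longrightarrow> ?n \<bullet> (y - x) = 0"
        using frontier_outward_normal[OF elim(1) elem_regular(2)[OF 3(1)]] by metis
      obtain b where b: "b > 0" "\<And>y. y \<in> ball x b \<Longrightarrow> y \<in> T' \<longleftrightarrow> ?n' \<bullet> (y - x) < 0"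
        "\<And>y. y \<in> ball x b \<Longrightarrow> y \<in> frontier T' \<Longrightarrow> ?n' \<bullet> (y - x) = 0"
        using frontier_outward_normal[OF elim(2) elem_regular(2)[OF 3(2)]] by metis
      have n1: "norm ?n = 1" "norm ?n' = 1"
        using elim by (auto simp: is_outward_normal_def)
      have dj: "T \<inter> T' = {}"
        using 3 elems_disjnt by (auto simp: pairwise_def disjnt_def)
      \<comment> \<open>If the normals were not opposite, then \<open>z = - (n + n')\<close> would
        point strictly into both half balls, and the disjoint elements would have a common point
        near \<open>x\<close>.\<close>
      have opp: "?n' = - ?n"
      proof (rule ccontr)
        assume ne: "?n' \<noteq> - ?n"
        define z where "z = - (?n + ?n')"
        have n2: "?n \<bullet> ?n = 1" "?n' \<bullet> ?n' = 1"
          using n1 by (simp_all add: dot_square_norm)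
        have "?n + ?n' \<noteq> 0"
          using ne by (metis add.commute eq_neg_iff_add_eq_0)
        then have z0: "z \<noteq> 0"
          by (simp add: z_def add_eq_0_iff)
        have "0 < (?n + ?n') \<bullet> (?n + ?n')"
          using \<open>?n + ?n' \<noteq> 0\<close> by simp
        then have "?n \<bullet> ?n' > -1"
          by (simp add: inner_add_left inner_add_right n2 inner_commute)
        then have neg: "?n \<bullet> z < 0" "?n' \<bullet> z < 0"
          by (simp_all add: z_def inner_add_right inner_diff_right n2 inner_commute)
        define m where "m = min a b / (2 * norm z)"
        have "m * norm z = min a b / 2"
          using z0 by (simp add: m_def)
        moreover have "min a b > 0"
          using a b by simp
        ultimately have m: "m > 0" "m * norm z < min a b"
          using z0 by (simp add: m_def, linarith)
        have "x + m *\<^sub>R z \<in> ball x a" "x + m *\<^sub>R z \<in> ball x b"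
          using m by (auto simp: dist_norm)
        then have "x + m *\<^sub>R z \<in> T" "x + m *\<^sub>R z \<in> T'"
          using a(2) b(2) neg m by (auto simp: mult_pos_neg)
        then show False
          using dj by blast
      qed
      define U where "U = ball x (min a b)"
      \<comment> \<open>Two opposite open half balls miss only points of the common hyperplane, and
        from such a point an arbitrarily short step against the normal leads into \<open>T\<close>.
        Hence \<open>x\<close> is interior to the closure of the domain, and so in the
        domain.\<close>
      have "U \<subseteq> closure T \<union> closure T'"
      proof
        fix y assume y: "y \<in> U"
        have ball: "y \<in> ball x a" "y \<in> ball x b"
          using y by (auto simp: U_def)
        show "y \<in> closure T \<union> closure T'"
        proof (rule ccontr)
          assume ny: "y \<notin> closure T \<union> closure T'"
          then have "y \<notin> T" "y \<notin> T'"
            using closure_subset by auto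
          then have "?n \<bullet> (y - x) = 0"
            using a(2)[OF ball(1)] b(2)[OF ball(2)] opp by (simp add: inner_minus_left)
          moreover have "open (U - closure T)"
            by (auto simp: U_def)
          then obtain d where d: "d > 0" "ball y d \<subseteq> U - closure T"
            using y ny openE by blast
          moreover define z where "z = y - (d / 2) *\<^sub>R ?n"
          ultimately have "z \<in> U - closure T" "?n \<bullet> (z - x) = - d / 2"
            using n1 by (auto simp: dist_norm inner_diff_right dot_square_norm subset_iff)
          then have "z \<in> T"
            using a(2)[of z] d by (auto simp: U_def)
          then show False
            using \<open>z \<in> U - closure T\<close> closure_subset by auto
        qed
      qed
      also have "\<dots> \<subseteq> closure \<Omega>"
        using 3 unfolding elems_cover by blast
      finally have "x \<in> interior (closure \<Omega>)"
        using a b by (intro interiorI[of U]) (auto simp: U_def)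
      then show ?case
        unfolding fr reg by simp
    qed
    then show ?thesis ..
  qed
qed

end

section \<open>The weak Galerkin and HDG equations on a mesh\<close>

definition normal_trace :: "(real^'d) set \<Rightarrow> (real^'d \<Rightarrow> real^'d) \<Rightarrow> real^'d \<Rightarrow> real" where
  "normal_trace T v x = bdry_trace T v x \<bullet> outward_normal T x"

section \<open>Boundary integrals, traces and integration by parts on a mesh element\<close>

context polyhedral_mesh
begin

definition bdry_int :: "(real^'d) set \<Rightarrow> (real^'d \<Rightarrow> real) \<Rightarrow> real" where
  "bdry_int T f = (\<Sum>e\<in>faces T. LINT x|surface_measure e. f x)"

lemma face_in_E: "e \<in> faces T \<Longrightarrow> e \<in> \<E>"
  by (simp add: faces_def)

lemma finite_faces: "finite (faces T)"
  using finite_E by (simp add: faces_def)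

lemma ae_on_frontier_iff:
  assumes T: "T \<in> \<T>"
  shows "ae_on \<E> (frontier T) P \<longleftrightarrow> (\<forall>e\<in>faces T. AE x in surface_measure e. P x)"
proof
  assume *: "ae_on \<E> (frontier T) P"
  show "\<forall>e\<in>faces T. AE x in surface_measure e. P x"
  proof
    fix e assume e: "e \<in> faces T"
    have "AE x in surface_measure e. x \<in> frontier T \<longrightarrow> P x"
      using * face_in_E[OF e] by (simp add: ae_on_def)
    with AE_in_piece[OF face_in_E[OF e]] show "AE x in surface_measure e. P x"
      by eventually_elim (use e in \<open>auto simp: faces_def\<close>)
  qed
next
  assume *: "\<forall>e\<in>faces T. AE x in surface_measure e. P x"
  show "ae_on \<E> (frontier T) P"
    unfolding ae_on_def
  proof
    fix e assume e: "e \<in> \<E>"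
    show "AE x in surface_measure e. x \<in> frontier T \<longrightarrow> P x"
    proof (cases "e \<in> faces T")
      case True
      with * have "AE x in surface_measure e. P x" by blast
      then show ?thesis by eventually_elim simp
    next
      case False
      from AE_not_frontier[OF T e this] show ?thesis
        by eventually_elim simp
    qed
  qed
qed

lemma piece_integrable:
  assumes "e \<in> \<E>" "ae_continuous e f"
  shows "integrable (surface_measure e) f"
proof -
  obtain \<nu> c where "flat_face e \<nu> c"
    using piece_flat_face[OF assms(1)] .
  then show ?thesis
    by (rule flat_face.ae_continuous_integrable) (rule assms(2))
qed

lemma bdry_int_cong_AE:
  assumes "\<And>e. e \<in> faces T \<Longrightarrow> AE x in surface_measure e. f x = g x"
  shows "bdry_int T f = bdry_int T g"
  unfolding bdry_int_def using assms by (intro sum.cong refl surface_integral_cong_AE)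

lemma bdry_int_add:
  assumes "\<And>e. e \<in> faces T \<Longrightarrow> ae_continuous e f" "\<And>e. e \<in> faces T \<Longrightarrow> ae_continuous e g"
  shows "bdry_int T (\<lambda>x. f x + g x) = bdry_int T f + bdry_int T g"
  unfolding bdry_int_def sum.distrib[symmetric] using assms
  by (intro sum.cong refl Bochner_Integration.integral_add piece_integrable face_in_E)

lemma bdry_int_scale: "bdry_int T (\<lambda>x. c * f x) = c * bdry_int T f"
  by (simp add: bdry_int_def sum_distrib_left)

lemma bdry_int_square_zero:
  assumes cont: "\<And>e. e \<in> faces T \<Longrightarrow> ae_continuous e f" and z: "bdry_int T (\<lambda>x. f x * f x) = 0" and e: "e \<in> faces T"
  shows "AE x in surface_measure e. f x = 0"
proof -
  have "(LINT x|surface_measure e. f x * f x) = 0"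
    using z finite_faces e unfolding bdry_int_def
    by (subst (asm) sum_nonneg_eq_0_iff) auto
  moreover obtain \<nu> c where "flat_face e \<nu> c"
    using piece_flat_face[OF face_in_E[OF e]] .
  ultimately show ?thesis
    using flat_face.AE_zero_if_integral_square_zero cont[OF e] by blast
qed

lemma surf_ip_frontier_real:
  assumes "T \<in> \<T>"
  shows "surf_ip \<E> (frontier T) f g = bdry_int T (\<lambda>x. f x * g x)"
  using surf_ip_frontier[OF assms, of f g] by (simp add: bdry_int_def)

lemma AE_outward_normal:
  assumes "T \<in> \<T>" "e \<in> faces T"
  shows "AE x in surface_measure e. outward_normal T x = face_normal T e \<and> face_normal T e \<bullet> face_normal T e = 1"
  using face_normal(2)[OF assms]
proof eventually_elim
  case (elim x)
  then have "outward_normal T x = face_normal T e"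
    by (rule outward_normal_eq)
  moreover have "norm (face_normal T e) = 1"
    using elim by (simp add: is_outward_normal_def)
  ultimately show ?case
    by (simp add: dot_square_norm)
qed

lemma poly_trace:
  assumes T: "T \<in> \<T>" and u: "u \<in> poly_on r T"
  obtains U where "U \<in> polys r" "\<And>x. x \<in> T \<Longrightarrow> u x = U x" "\<forall>x\<in>frontier T. bdry_trace T u x = U x"
proof -
  obtain U where U: "U \<in> polys r" "\<And>x. x \<in> T \<Longrightarrow> u x = U x"
    using u by (auto simp: poly_on_def)
  then show thesis
    using bdry_trace_eq[OF elem_regular(2)[OF T] _ polys_continuous[OF U(1)]] by (intro that) auto
qed

lemma AE_on_frontier:
  assumes "e \<in> faces T"
  shows "AE x in surface_measure e. x \<in> frontier T"
  using AE_in_piece[OF face_in_E[OF assms]] by eventually_elim (use assms in \<open>auto simp: faces_def\<close>)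

lemma AE_poly_trace:
  assumes "\<forall>x\<in>frontier T. bdry_trace T u x = U x" "e \<in> faces T"
  shows "AE x in surface_measure e. bdry_trace T u x = U x"
  using AE_on_frontier[OF assms(2)] by eventually_elim (simp add: assms(1))

lemma trace_face_poly:
  assumes "T \<in> \<T>" "u \<in> poly_on r T" "r \<le> s" "e \<in> faces T"
  shows "bdry_trace T u \<in> face_poly s e"
proof -
  obtain U where U: "U \<in> polys r" "\<forall>x\<in>frontier T. bdry_trace T u x = U x"
    using poly_trace[OF assms(1,2)] by metis
  show ?thesis
    by (rule polys_face_poly[OF U(1) assms(3) AE_poly_trace[OF U(2) assms(4)]])
qed

lemma vec_poly_trace:
  assumes T: "T \<in> \<T>" and v: "v \<in> vec_poly_on k T"
  obtains V where "V \<in> vec_polys k" "\<And>x. x \<in> T \<Longrightarrow> v x = V x"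
    "\<And>e. e \<in> faces T \<Longrightarrow> AE x in surface_measure e. normal_trace T v x = V x \<bullet> face_normal T e"
proof -
  obtain V where V: "V \<in> vec_polys k" "\<And>x. x \<in> T \<Longrightarrow> v x = V x"
    using vec_poly_onE[OF v] by metis
  have tr: "bdry_trace T v x = V x" if "x \<in> frontier T" for x
    using that by (rule bdry_trace_eq[OF elem_regular(2)[OF T] _ vec_polys_continuous[OF V(1)] V(2)])
  have "AE x in surface_measure e. normal_trace T v x = V x \<bullet> face_normal T e" if e: "e \<in> faces T" for e
    using AE_on_frontier[OF e] AE_outward_normal[OF T e]
    by eventually_elim (simp add: normal_trace_def tr)
  then show thesis
    using V by (intro that)
qed

lemma normal_trace_face_poly:
  assumes "T \<in> \<T>" "v \<in> vec_poly_on k T" "k \<le> s" "e \<in> faces T"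
  shows "normal_trace T v \<in> face_poly s e"
proof -
  obtain V where V: "V \<in> vec_polys k"
    "\<And>e. e \<in> faces T \<Longrightarrow> AE x in surface_measure e. normal_trace T v x = V x \<bullet> face_normal T e"
    using vec_poly_trace[OF assms(1,2)] by metis
  show ?thesis
    by (rule polys_face_poly[OF vec_polys_inner[OF V(1)] assms(3) V(2)[OF assms(4)]])
qed

lemma vol_ip_eq:
  assumes "T \<in> \<T>" "continuous_on UNIV F" "\<And>x. x \<in> T \<Longrightarrow> g x \<bullet> h x = F x"
  shows "vol_ip T g h = (LINT x|lborel. F x * indicator T x)"
  unfolding vol_ip_def using assms elem_regular(2)[OF assms(1)]
  by (intro integral_lebesgue_on_eq) (auto intro: borel_measurable_continuous_onI)

lemma vol_ip_zero:
  assumes "\<And>x. x \<in> T \<Longrightarrow> g x \<bullet> h x = 0"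
  shows "vol_ip T g h = 0"
proof -
  have "vol_ip T g h = (LINT x|lebesgue_on T. 0)"
    unfolding vol_ip_def using assms by (intro Bochner_Integration.integral_cong) auto
  then show ?thesis by simp
qed

lemma vol_ip_cong:
  assumes "\<And>x. x \<in> T \<Longrightarrow> g x = g' x" "\<And>x. x \<in> T \<Longrightarrow> h x = h' x"
  shows "vol_ip T g h = vol_ip T g' h'"
  unfolding vol_ip_def using assms by (intro Bochner_Integration.integral_cong) auto

lemma vec_polys_component: "V \<in> vec_polys k \<Longrightarrow> c1_fun (\<lambda>x. V x $ i)"
  by (auto simp: vec_polys_def intro: polys_c1_fun)

lemma divergence_poly:
  assumes "T \<in> \<T>" "V \<in> vec_polys k" "\<And>x. x \<in> T \<Longrightarrow> v x = V x" "x \<in> T"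
  shows "divergence v x = poly_div V x"
  unfolding poly_div_def
  by (rule divergence_eq[OF elem_regular(2)[OF assms(1)] assms(4) vec_polys_component[OF assms(2)] assms(3)])

lemma gradient_poly:
  assumes "T \<in> \<T>" "U \<in> polys k" "\<And>x. x \<in> T \<Longrightarrow> u x = U x" "x \<in> T"
  shows "gradient u x = poly_grad U x"
  unfolding poly_grad_def
  by (rule gradient_eq[OF elem_regular(2)[OF assms(1)] assms(4) polys_c1_fun[OF assms(2)] assms(3)])

lemma integration_by_parts:
  assumes T: "T \<in> \<T>" and u: "u \<in> poly_on r T" and v: "v \<in> vec_poly_on k T"
  shows "vol_ip T u (divergence v) + vol_ip T v (gradient u)
       = bdry_int T (\<lambda>x. bdry_trace T u x * normal_trace T v x)"
proof -
  interpret polyhedral_element T "faces T" "face_normal T"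
    by (rule element[OF T])
  obtain U where U: "U \<in> polys r" "\<And>x. x \<in> T \<Longrightarrow> u x = U x" "\<forall>x\<in>frontier T. bdry_trace T u x = U x"
    using poly_trace[OF T u] by metis
  obtain V where V: "V \<in> vec_polys k" "\<And>x. x \<in> T \<Longrightarrow> v x = V x"
    "\<And>e. e \<in> faces T \<Longrightarrow> AE x in surface_measure e. normal_trace T v x = V x \<bullet> face_normal T e"
    using vec_poly_trace[OF T v] by metis
  have "vol_ip T u (divergence v) = (LINT x|lborel. U x * poly_div V x * indicator T x)"
    using U(2) divergence_poly[OF T V(1,2)]
    by (intro vol_ip_eq[OF T] continuous_intros polys_continuous[OF U(1)] poly_div_continuous[OF V(1)]) simp
  moreover have "vol_ip T v (gradient u) = (LINT x|lborel. (V x \<bullet> poly_grad U x) * indicator T x)"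
    using V(2) gradient_poly[OF T U(1,2)]
    by (intro vol_ip_eq[OF T] continuous_intros vec_polys_continuous[OF V(1)] poly_grad_continuous[OF U(1)]) simp
  moreover have "bdry_int T (\<lambda>x. bdry_trace T u x * normal_trace T v x)
     = (\<Sum>e\<in>faces T. LINT y|surface_measure e. U y * (V y \<bullet> face_normal T e))"
    unfolding bdry_int_def
  proof (intro sum.cong refl surface_integral_cong_AE)
    fix e assume e: "e \<in> faces T"
    show "AE x in surface_measure e. bdry_trace T u x * normal_trace T v x = U x * (V x \<bullet> face_normal T e)"
      using AE_poly_trace[OF U(3) e] V(3)[OF e] by eventually_elim simp
  qed
  ultimately show ?thesis
    using gauss_polys[OF U(1) V(1)] by simp
qed

section \<open>Existence of the discrete weak divergence, and the face projection of normal
  traces\<close>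

lemma polys_zero_on_if_integral_square_zero:
  assumes T: "T \<in> \<T>" and p: "p \<in> polys r" and z: "(LINT x|lborel. p x * p x * indicator T x) = 0" and x: "x \<in> T"
  shows "p x = 0"
proof (rule ccontr)
  assume ne: "p x \<noteq> 0"
  have c: "continuous_on UNIV p"
    using p by (rule polys_continuous)
  have "integrable lborel (\<lambda>x. p x * p x * indicator T x)"
    using elem_regular[OF T] c by (intro integrable_on_bounded continuous_intros) auto
  then have ae: "AE x in lborel. p x * p x * indicator T x = 0"
    using z by (subst (asm) integral_nonneg_eq_0_iff_AE) (auto simp: indicator_def)
  let ?U = "T \<inter> p -` (- {0})"
  have U: "open ?U"
    using elem_regular(2)[OF T] c by (intro open_Int) (auto intro!: open_vimage)
  have "AE x in lborel. x \<notin> ?U"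
    using ae by eventually_elim auto
  then have "?U \<in> null_sets lborel"
    using U by (subst AE_iff_null_sets) auto
  then have "negligible ?U"
    by (simp add: negligible_iff_null_sets null_sets_completionI)
  then show False
    using open_not_negligible[OF U] x ne by blast
qed

text \<open>Riesz representation of the right-hand side with respect to the inner product of square
  integrable functions on \<open>T\<close>, restricted to polynomials. It supplies the witness for
  the choice in \<open>weak_div\<close>.\<close>

lemma weak_div_exists:
  assumes T: "T \<in> \<T>" and v: "v0 \<in> vec_poly_on k T" and vb: "\<And>e. e \<in> faces T \<Longrightarrow> vb \<in> face_poly s e"
  shows "\<exists>p\<in>polys r. \<forall>\<phi>\<in>polys r. vol_ip T p \<phi>
      = - vol_ip T v0 (gradient \<phi>) + bdry_int T (\<lambda>x. vb x * \<phi> x)"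
proof -
  interpret polyhedral_element T "faces T" "face_normal T"
    by (rule element[OF T])
  obtain V where V: "V \<in> vec_polys k" "\<And>x. x \<in> T \<Longrightarrow> v0 x = V x"
    using vec_poly_trace[OF T v] by metis
  define B :: "(real^'d \<Rightarrow> real) \<Rightarrow> (real^'d \<Rightarrow> real) \<Rightarrow> real" where
    "B p q = (LINT x|lborel. p x * q x * indicator T x)" for p q
  define g where "g x = vb x - normal_trace T v0 x" for x
  \<comment> \<open>Integration by parts has moved the derivative from the test polynomial to
    \<open>v0\<close>, leaving the boundary weight \<open>g\<close>. In this form the functional
    depends on \<open>\<phi>\<close> only through its values on the closure of
    \<open>T\<close>.\<close>
  define l where "l \<phi> = B \<phi> (poly_div V) + bdry_int T (\<lambda>x. g x * \<phi> x)" for \<phi>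
  have gc: "ae_continuous e g" if "e \<in> faces T" for e
    unfolding g_def using vb[OF that] normal_trace_face_poly[OF T v order_refl that]
    by (intro ae_continuous_diff face_poly_ae_continuous)
  have gp: "ae_continuous e (\<lambda>x. g x * h x)" if "e \<in> faces T" "h \<in> polys r" for e h
    using that by (intro ae_continuous_mult gc ae_continuous_continuous polys_continuous)
  have B_lin: "B (\<lambda>x. p x + a * q x) f = B p f + a * B q f"
    if "p \<in> polys r" "q \<in> polys r" and f: "continuous_on UNIV f" for p q f a
  proof -
    have i: "integrable lborel (\<lambda>x. h x * f x * indicator T x)" if h: "h \<in> polys r" for h
      by (intro integrable_on_bounded continuous_intros polys_continuous[OF h] f T_bdd T_borel)
    have "B (\<lambda>x. p x + a * q x) f = (LINT x|lborel. p x * f x * indicator T x + a * (q x * f x * indicator T x))"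
      unfolding B_def by (rule arg_cong[where f = "integral\<^sup>L lborel"]) (simp add: fun_eq_iff algebra_simps)
    also have "\<dots> = B p f + a * B q f"
      unfolding B_def using i that by simp
    finally show ?thesis .
  qed
  have vol_B: "vol_ip T p \<phi> = B p \<phi>" if "p \<in> polys r" "\<phi> \<in> polys r" for p \<phi>
    unfolding B_def using that by (intro vol_ip_eq[OF T] continuous_intros) (auto intro: polys_continuous)
  have "\<exists>p\<in>fun_span (monomial ` multi_indices r). \<forall>\<phi>\<in>fun_span (monomial ` multi_indices r). B p \<phi> = l \<phi>"
  proof (rule fun_span_riesz[where P = "polys r"])
    show "(\<lambda>x. p x + a * q x) \<in> polys r" if "p \<in> polys r" "q \<in> polys r" for p q :: "real^'d \<Rightarrow> real" and a
      using that by (intro polys_add polys_scale)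
    show "B p q = B q p" for p q
      by (simp add: B_def mult.commute)
    show "B (\<lambda>x. p x + a * q x) f = B p f + a * B q f"
      if "p \<in> polys r" "q \<in> polys r" "f \<in> polys r" for p q f a
      using B_lin[OF that(1,2) polys_continuous[OF that(3)]] .
    show "B p p \<ge> 0" for p
      unfolding B_def by (intro Bochner_Integration.integral_nonneg) (simp add: indicator_def)
    show "l (\<lambda>x. p x + a * q x) = l p + a * l q" if "p \<in> polys r" "q \<in> polys r" for p q a
    proof -
      have "bdry_int T (\<lambda>x. g x * (p x + a * q x)) = bdry_int T (\<lambda>x. g x * p x + a * (g x * q x))"
        by (simp add: algebra_simps)
      also have "\<dots> = bdry_int T (\<lambda>x. g x * p x) + bdry_int T (\<lambda>x. a * (g x * q x))"
        by (intro bdry_int_add gp that ae_continuous_mult[OF ae_continuous_continuous[OF continuous_on_const]])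
      finally show ?thesis
        using B_lin[OF that poly_div_continuous[OF V(1)]]
        by (simp add: l_def bdry_int_scale distrib_left)
    qed
    \<comment> \<open>A polynomial with vanishing square integral is zero on \<open>T\<close>, and
      by continuity on the frontier; this suffices for \<open>l p = 0\<close>. That it is the zero
      polynomial is never shown, which is why the Riesz lemma admits degenerate forms.\<close>
    show "l p = 0" if p: "p \<in> polys r" "B p p = 0" for p
    proof -
      have z: "p x = 0" if "x \<in> T" for x
        by (rule polys_zero_on_if_integral_square_zero[OF T p(1) p(2)[unfolded B_def] that])
      have "p x = 0" if fr: "x \<in> frontier T" for x
      proof -
        have "bdry_trace T p x = p x"
          by (rule bdry_trace_eq[OF T_open fr polys_continuous[OF p(1)] refl])
        moreover have "bdry_trace T p x = 0"
          by (rule bdry_trace_eq[OF T_open fr continuous_on_const z])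
        ultimately show ?thesis
          by metis
      qed
      then have "AE x in surface_measure e. g x * p x = 0" if "e \<in> faces T" for e
        using AE_on_frontier[OF that] by (auto elim!: eventually_mono)
      then have "bdry_int T (\<lambda>x. g x * p x) = bdry_int T (\<lambda>x. 0)"
        by (rule bdry_int_cong_AE)
      moreover have "B p (poly_div V) = (LINT x|(lborel :: (real^'d) measure). 0)"
        unfolding B_def using z by (intro Bochner_Integration.integral_cong) (auto simp: indicator_def)
      ultimately show ?thesis
        by (simp add: l_def bdry_int_def)
    qed
  qed (auto simp: finite_multi_indices polys_zero polys_monomial)
  then obtain p where p: "p \<in> polys r" "\<And>\<phi>. \<phi> \<in> polys r \<Longrightarrow> B p \<phi> = l \<phi>"
    unfolding polys_eq_fun_span[symmetric] by blast
  have "l \<phi> = - vol_ip T v0 (gradient \<phi>) + bdry_int T (\<lambda>x. vb x * \<phi> x)" if \<phi>: "\<phi> \<in> polys r" for \<phi>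
  proof -
    have on: "\<phi> \<in> poly_on r T"
      using \<phi> by (auto simp: poly_on_def)
    have "vol_ip T \<phi> (divergence v0) = B \<phi> (poly_div V)"
      unfolding B_def using divergence_poly[OF T V(1,2)] \<phi>
      by (intro vol_ip_eq[OF T] continuous_intros poly_div_continuous[OF V(1)] polys_continuous) auto
    moreover have "bdry_int T (\<lambda>x. bdry_trace T \<phi> x * normal_trace T v0 x) = bdry_int T (\<lambda>x. \<phi> x * normal_trace T v0 x)"
    proof (rule bdry_int_cong_AE)
      fix e assume e: "e \<in> faces T"
      have "AE x in surface_measure e. bdry_trace T \<phi> x = \<phi> x"
        by (rule AE_poly_trace[OF _ e], rule ballI,
            rule bdry_trace_eq[OF T_open _ polys_continuous[OF \<phi>] refl])
      then show "AE x in surface_measure e. bdry_trace T \<phi> x * normal_trace T v0 x = \<phi> x * normal_trace T v0 x"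
        by eventually_elim simp
    qed
    ultimately have "B \<phi> (poly_div V) = bdry_int T (\<lambda>x. \<phi> x * normal_trace T v0 x) - vol_ip T v0 (gradient \<phi>)"
      using integration_by_parts[OF T on v] by simp
    moreover have "bdry_int T (\<lambda>x. g x * \<phi> x + \<phi> x * normal_trace T v0 x)
        = bdry_int T (\<lambda>x. g x * \<phi> x) + bdry_int T (\<lambda>x. \<phi> x * normal_trace T v0 x)"
      by (intro bdry_int_add gp \<phi> ae_continuous_mult[OF ae_continuous_continuous[OF polys_continuous[OF \<phi>]]]
          face_poly_ae_continuous[OF normal_trace_face_poly[OF T v order_refl]])
    moreover have "(\<lambda>x. g x * \<phi> x + \<phi> x * normal_trace T v0 x) = (\<lambda>x. vb x * \<phi> x)"
      by (simp add: g_def algebra_simps)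
    ultimately show ?thesis
      by (simp add: l_def)
  qed
  then show ?thesis
    using p vol_B by (intro bexI[of _ p] ballI) auto
qed

text \<open>The definition tests with all functions that agree with a polynomial on
  \<open>T\<close>. Since each term depends only on the values of the test function on
  \<open>T\<close>, existence for genuine polynomials extends to these, and the chosen function has
  the defining property.\<close>

lemma weak_div:
  assumes T: "T \<in> \<T>" and v: "v0 \<in> vec_poly_on k T" and vb: "\<And>e. e \<in> faces T \<Longrightarrow> vb \<in> face_poly s e"
    and \<phi>: "\<phi> \<in> poly_on r T"
  shows "vol_ip T (weak_div \<E> r T v0 vb) \<phi>
      = - vol_ip T v0 (gradient \<phi>) + bdry_int T (\<lambda>x. vb x * bdry_trace T \<phi> x)"
proof -
  have surf: "surf_ip \<E> (frontier T) (\<lambda>x. vb x *\<^sub>R outward_normal T x) (\<lambda>x. bdry_trace T \<phi> x *\<^sub>R outward_normal T x)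
      = bdry_int T (\<lambda>x. vb x * bdry_trace T \<phi> x)" for \<phi> :: "real^'d \<Rightarrow> real"
    unfolding surf_ip_frontier[OF T] bdry_int_def
  proof (intro sum.cong refl surface_integral_cong_AE)
    fix e assume e: "e \<in> faces T"
    show "AE x in surface_measure e. (vb x *\<^sub>R outward_normal T x) \<bullet> (bdry_trace T \<phi> x *\<^sub>R outward_normal T x)
       = vb x * bdry_trace T \<phi> x"
      using AE_outward_normal[OF T e] by eventually_elim simp
  qed
  let ?P = "\<lambda>p. p \<in> poly_on r T \<and> (\<forall>\<phi>\<in>poly_on r T. vol_ip T p \<phi>
      = - vol_ip T v0 (gradient \<phi>) + bdry_int T (\<lambda>x. vb x * bdry_trace T \<phi> x))"
  have "\<exists>p. ?P p"
  proof -
    obtain p where p: "p \<in> polys r" "\<And>\<phi>. \<phi> \<in> polys r \<Longrightarrow> vol_ip T p \<phi>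
      = - vol_ip T v0 (gradient \<phi>) + bdry_int T (\<lambda>x. vb x * \<phi> x)"
      using weak_div_exists[OF T v vb] by blast
    have "vol_ip T p \<phi> = - vol_ip T v0 (gradient \<phi>) + bdry_int T (\<lambda>x. vb x * bdry_trace T \<phi> x)"
      if \<phi>: "\<phi> \<in> poly_on r T" for \<phi>
    proof -
      obtain U where U: "U \<in> polys r" "\<And>x. x \<in> T \<Longrightarrow> \<phi> x = U x" "\<forall>x\<in>frontier T. bdry_trace T \<phi> x = U x"
        using poly_trace[OF T \<phi>] by metis
      have "vol_ip T p \<phi> = vol_ip T p U"
        using U(2) by (intro vol_ip_cong) auto
      moreover have "vol_ip T v0 (gradient \<phi>) = vol_ip T v0 (gradient U)"
        using gradient_poly[OF T U(1,2)] gradient_poly[OF T U(1) refl] by (intro vol_ip_cong) auto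
      moreover have "bdry_int T (\<lambda>x. vb x * bdry_trace T \<phi> x) = bdry_int T (\<lambda>x. vb x * U x)"
      proof (rule bdry_int_cong_AE)
        fix e assume e: "e \<in> faces T"
        show "AE x in surface_measure e. vb x * bdry_trace T \<phi> x = vb x * U x"
          using AE_poly_trace[OF U(3) e] by eventually_elim simp
      qed
      ultimately show ?thesis
        using p(2)[OF U(1)] by simp
    qed
    then show ?thesis
      using p(1) by (intro exI[of _ p]) (auto simp: poly_on_def)
  qed
  then have "?P (weak_div \<E> r T v0 vb)"
    unfolding weak_div_def surf by (rule someI_ex)
  then show ?thesis
    using \<phi> by blast
qed

text \<open>The outward normal is constant on each face, so the normal trace is a face polynomial of
  degree at most \<open>k\<close> and is itself an admissible choice for the projection. The
  function actually chosen differs from it by a face polynomial orthogonal to all of its space, in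
  particular to itself.\<close>

lemma Q_b_normal_trace:
  assumes T: "T \<in> \<T>" and v: "v \<in> vec_poly_on k T" and ks: "k \<le> s" and e: "e \<in> faces T"
  shows "AE x in surface_measure e. Q_b \<E> s T (normal_trace T v) x = normal_trace T v x"
proof -
  let ?g = "normal_trace T v"
  let ?P = "\<lambda>p. \<forall>e\<in>\<E>. e \<subseteq> frontier T \<longrightarrow>
        p \<in> face_poly s e \<and> (\<forall>\<phi>\<in>face_poly s e. (LINT x|surface_measure e. (?g x - p x) * \<phi> x) = 0)"
  have gf: "?g \<in> face_poly s e'" if "e' \<in> faces T" for e'
    by (rule normal_trace_face_poly[OF T v ks that])
  then have "?P ?g"
    by (simp add: faces_def)
  then have "?P (Q_b \<E> s T ?g)"
    unfolding Q_b_def by (rule someI[where P = ?P])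
  then have Q: "Q_b \<E> s T ?g \<in> face_poly s e"
    "\<And>\<phi>. \<phi> \<in> face_poly s e \<Longrightarrow> (LINT x|surface_measure e. (?g x - Q_b \<E> s T ?g x) * \<phi> x) = 0"
    using e by (auto simp: faces_def)
  have d: "(\<lambda>x. ?g x - Q_b \<E> s T ?g x) \<in> face_poly s e"
    using gf[OF e] Q(1) by (rule face_poly_diff)
  obtain \<nu> c where "flat_face e \<nu> c"
    using piece_flat_face[OF face_in_E[OF e]] .
  then have "AE x in surface_measure e. ?g x - Q_b \<E> s T ?g x = 0"
    by (rule flat_face.AE_zero_if_integral_square_zero[OF _ face_poly_ae_continuous[OF d] Q(2)[OF d]])
  then show ?thesis
    by eventually_elim simp
qed

lemma Z_local_iff: "(v0, vb) \<in> Z_local \<E> k s T \<longleftrightarrow> v0 \<in> vec_poly_on k T \<and> (\<forall>e\<in>faces T. vb \<in> face_poly s e)"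
  by (auto simp: Z_local_def faces_def)

lemma stabilizer_eq:
  assumes T: "T \<in> \<T>" and q: "q0 \<in> vec_poly_on k T" and v: "v0 \<in> vec_poly_on k T" and ks: "k \<le> s"
  shows "stabilizer \<E> s \<rho> \<alpha> T q0 qb v0 vb = \<rho> * diameter T powr \<alpha> *
     bdry_int T (\<lambda>x. (normal_trace T q0 x - qb x) * (normal_trace T v0 x - vb x))"
proof -
  have "bdry_int T (\<lambda>x. (Q_b \<E> s T (normal_trace T q0) x - qb x) * (Q_b \<E> s T (normal_trace T v0) x - vb x))
     = bdry_int T (\<lambda>x. (normal_trace T q0 x - qb x) * (normal_trace T v0 x - vb x))"
  proof (rule bdry_int_cong_AE)
    fix e assume e: "e \<in> faces T"
    show "AE x in surface_measure e. (Q_b \<E> s T (normal_trace T q0) x - qb x) * (Q_b \<E> s T (normal_trace T v0) x - vb x)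
      = (normal_trace T q0 x - qb x) * (normal_trace T v0 x - vb x)"
      using Q_b_normal_trace[OF T q ks e] Q_b_normal_trace[OF T v ks e] by eventually_elim simp
  qed
  moreover have "(\<lambda>y. bdry_trace T w y \<bullet> outward_normal T y) = normal_trace T w" for w
    by (simp add: fun_eq_iff normal_trace_def)
  ultimately show ?thesis
    by (simp only: stabilizer_def surf_ip_frontier_real[OF T])
qed

lemma surf_ip_normal_component:
  assumes T: "T \<in> \<T>"
  shows "surf_ip \<E> (frontier T) \<sigma> (\<lambda>x. (vb x *\<^sub>R outward_normal T x) \<bullet> outward_normal T x)
    = bdry_int T (\<lambda>x. \<sigma> x * vb x)"
  unfolding surf_ip_frontier_real[OF T]
proof (rule bdry_int_cong_AE)
  fix e assume e: "e \<in> faces T"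
  show "AE x in surface_measure e. \<sigma> x * ((vb x *\<^sub>R outward_normal T x) \<bullet> outward_normal T x) = \<sigma> x * vb x"
    using AE_outward_normal[OF T e] by eventually_elim simp
qed

text \<open>A power \<open>powr\<close> of base 0 is 0; only for a positive diameter is the weight
  of the stabilizer nonzero and the reciprocal of \<open>\<tau>\<close>.\<close>

lemma elem_diameter_pos:
  assumes "T \<in> \<T>"
  shows "diameter T > 0"
proof -
  note T = elem_regular[OF assms]
  obtain x where x: "x \<in> T"
    using T(4) by auto
  then obtain d where d: "d > 0" "ball x d \<subseteq> T"
    using T(2) openE by blast
  obtain n :: "real^'d" where n: "norm n = 1"
    using vector_choose_size[of 1] by auto
  have "x + (d / 2) *\<^sub>R n \<in> T"
    using d n by (intro subsetD[OF d(2)]) (simp add: dist_norm)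
  then have "dist x (x + (d / 2) *\<^sub>R n) \<le> diameter T"
    using T(3) x by (intro diameter_bounded_bound)
  then show ?thesis
    using d n by (simp add: dist_norm)
qed

section \<open>The local equations of both methods on one element\<close>

definition hdg_local ::
    "(real^'d \<Rightarrow> real^'d^'d) \<Rightarrow> (real^'d \<Rightarrow> real^'d) \<Rightarrow> (real^'d \<Rightarrow> real) \<Rightarrow> (real^'d \<Rightarrow> real) \<Rightarrow>
      (real^'d) set \<Rightarrow> (real^'d \<Rightarrow> real^'d) \<Rightarrow> real" where
  "hdg_local a q u uhat T v =
     vol_ip T (\<lambda>x. matrix_inv (a x) *v q x) v - vol_ip T u (divergence v)
     + surf_ip \<E> (frontier T) uhat (\<lambda>x. bdry_trace T v x \<bullet> outward_normal T x)"

lemma bdry_int_diff: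
  assumes "\<And>e. e \<in> faces T \<Longrightarrow> ae_continuous e f" "\<And>e. e \<in> faces T \<Longrightarrow> ae_continuous e g"
  shows "bdry_int T (\<lambda>x. f x - g x) = bdry_int T f - bdry_int T g"
  unfolding bdry_int_def sum_subtractf[symmetric] using assms
  by (intro sum.cong refl Bochner_Integration.integral_diff piece_integrable face_in_E)

lemma hdg_local_eq:
  assumes "T \<in> \<T>"
  shows "hdg_local a q u uhat T v = vol_ip T (\<lambda>x. matrix_inv (a x) *v q x) v - vol_ip T u (divergence v)
     + bdry_int T (\<lambda>x. uhat x * normal_trace T v x)"
  unfolding hdg_local_def surf_ip_frontier_real[OF assms] normal_trace_def ..

text \<open>In the weak Galerkin equation the boundary component of the test function only enters
  through the last term, which vanishes if and only if the boundary unknown is the HDG flux.\<close>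
lemma wg_residual:
  assumes T: "T \<in> \<T>" and q: "q0 \<in> vec_poly_on k T" and qb: "\<And>e. e \<in> faces T \<Longrightarrow> qb \<in> face_poly s e"
    and v: "v0 \<in> vec_poly_on k T" and vb: "\<And>e. e \<in> faces T \<Longrightarrow> vb \<in> face_poly s e"
    and u: "u \<in> poly_on r T" and ub: "\<And>e. e \<in> faces T \<Longrightarrow> ub \<in> face_poly s e"
    and ks: "k \<le> s" and \<rho>: "\<rho> > 0" and \<tau>: "\<And>x. \<tau> T x = inverse \<rho> * diameter T powr (- \<alpha>)"
  shows "stabilizer \<E> s \<rho> \<alpha> T q0 qb v0 vb + vol_ip T (\<lambda>x. matrix_inv (a x) *v q0 x) v0
     - vol_ip T (weak_div \<E> r T v0 vb) u
     + surf_ip \<E> (frontier T) ub (\<lambda>x. (vb x *\<^sub>R outward_normal T x) \<bullet> outward_normal T x)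
   = hdg_local a q0 u ub T v0 + \<rho> * diameter T powr \<alpha> *
       bdry_int T (\<lambda>x. (hdg_flux \<tau> q0 u ub T x - qb x) * (normal_trace T v0 x - vb x))"
proof -
  define c where "c = inverse \<rho> * diameter T powr (- \<alpha>)"
  define H where "H = \<rho> * diameter T powr \<alpha>"
  \<comment> \<open>\<open>\<tau>\<close> is the reciprocal of the stabilization weight. Multiplied
    by the weight, the part \<open>\<tau> (u - ub)\<close> of the flux leaves the difference of the
    trace of \<open>u\<close> and \<open>ub\<close> with coefficient 1.\<close>
  have Hc: "H * c = 1"
    using elem_diameter_pos[OF T] \<rho> by (simp add: H_def c_def powr_minus field_simps)
  let ?t = "bdry_trace T u" and ?N = "normal_trace T q0" and ?V = "normal_trace T v0"
  have ae: "ae_continuous e ?t" "ae_continuous e ?N" "ae_continuous e ?V" "ae_continuous e ub"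
    "ae_continuous e qb" "ae_continuous e vb" if e: "e \<in> faces T" for e
    using trace_face_poly[OF T u order_refl e] normal_trace_face_poly[OF T q ks e]
      normal_trace_face_poly[OF T v ks e] ub[OF e] qb[OF e] vb[OF e]
    by (auto intro: face_poly_ae_continuous)
  \<comment> \<open>The four products in \<open>?J\<close> are the boundary terms by which the two
    methods differ: trace against \<open>?V\<close> from integration by parts, trace against
    \<open>vb\<close> from the weak divergence, \<open>ub\<close> against \<open>?V\<close> from
    HDG, and \<open>ub\<close> against \<open>vb\<close> from weak Galerkin.\<close>
  let ?J = "bdry_int T (\<lambda>x. (?t x - ub x) * (?V x - vb x))"
  have "?J = bdry_int T (\<lambda>x. (?t x * ?V x - vb x * ?t x) - (ub x * ?V x - ub x * vb x))"
    by (simp add: algebra_simps)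
  also have "\<dots> = bdry_int T (\<lambda>x. ?t x * ?V x - vb x * ?t x) - bdry_int T (\<lambda>x. ub x * ?V x - ub x * vb x)"
    by (intro bdry_int_diff ae_continuous_diff ae_continuous_mult ae)
  also have "bdry_int T (\<lambda>x. ?t x * ?V x - vb x * ?t x) = bdry_int T (\<lambda>x. ?t x * ?V x) - bdry_int T (\<lambda>x. vb x * ?t x)"
    by (intro bdry_int_diff ae_continuous_mult ae)
  also have "bdry_int T (\<lambda>x. ub x * ?V x - ub x * vb x) = bdry_int T (\<lambda>x. ub x * ?V x) - bdry_int T (\<lambda>x. ub x * vb x)"
    by (intro bdry_int_diff ae_continuous_mult ae)
  finally have J: "?J = bdry_int T (\<lambda>x. ?t x * ?V x) - bdry_int T (\<lambda>x. vb x * ?t x)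
      - (bdry_int T (\<lambda>x. ub x * ?V x) - bdry_int T (\<lambda>x. ub x * vb x))" .
  have "bdry_int T (\<lambda>x. (hdg_flux \<tau> q0 u ub T x - qb x) * (?V x - vb x))
      = bdry_int T (\<lambda>x. (?N x - qb x) * (?V x - vb x) + c * ((?t x - ub x) * (?V x - vb x)))"
    by (simp add: hdg_flux_def normal_trace_def \<tau> c_def algebra_simps)
  also have "\<dots> = bdry_int T (\<lambda>x. (?N x - qb x) * (?V x - vb x)) + bdry_int T (\<lambda>x. c * ((?t x - ub x) * (?V x - vb x)))"
    by (intro bdry_int_add ae_continuous_diff ae_continuous_mult ae ae_continuous_continuous continuous_on_const)
  finally have "H * bdry_int T (\<lambda>x. (hdg_flux \<tau> q0 u ub T x - qb x) * (?V x - vb x))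
      = H * bdry_int T (\<lambda>x. (?N x - qb x) * (?V x - vb x)) + (H * c) * ?J"
    by (simp add: bdry_int_scale distrib_left)
  moreover have "vol_ip T (weak_div \<E> r T v0 vb) u
      = - vol_ip T v0 (gradient u) + bdry_int T (\<lambda>x. vb x * ?t x)"
    using vb by (rule weak_div[OF T v _ u])
  ultimately show ?thesis
    unfolding stabilizer_eq[OF T q v ks] surf_ip_normal_component[OF T]
      hdg_local_eq[OF T] H_def[symmetric] Hc
    using J integration_by_parts[OF T u v] by linarith
qed

lemma vec_poly_on_zero: "(\<lambda>x. 0) \<in> vec_poly_on k T"
  unfolding vec_poly_on_def poly_on_def by (auto intro!: bexI[OF _ polys_zero])

lemma poly_on_zero: "(\<lambda>x. 0) \<in> poly_on k T"
  unfolding poly_on_def by (auto intro!: bexI[OF _ polys_zero])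

lemma vec_poly_on_cong: "v \<in> vec_poly_on k T \<Longrightarrow> (\<And>x. x \<in> T \<Longrightarrow> v x = w x) \<Longrightarrow> w \<in> vec_poly_on k T"
  by (simp add: vec_poly_on_def poly_on_def)

lemma poly_on_cong: "v \<in> poly_on k T \<Longrightarrow> (\<And>x. x \<in> T \<Longrightarrow> v x = w x) \<Longrightarrow> w \<in> poly_on k T"
  by (simp add: poly_on_def)

text \<open>The two functions have the same limits at every point, so the values agree even where no
  limit exists and \<open>Lim\<close> is an arbitrary choice.\<close>

lemma bdry_trace_cong:
  assumes "\<And>x. x \<in> T \<Longrightarrow> g x = h x"
  shows "bdry_trace T g = bdry_trace T h"
proof
  fix x
  have "(g \<longlongrightarrow> l) (at x within T) \<longleftrightarrow> (h \<longlongrightarrow> l) (at x within T)" for l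
    using assms by (intro tendsto_cong) (auto simp: eventually_at_filter)
  then show "bdry_trace T g x = bdry_trace T h x"
    by (simp add: bdry_trace_def Topological_Spaces.Lim_def)
qed

lemma hdg_local_cong:
  assumes T: "T \<in> \<T>" and v: "v \<in> vec_poly_on k T" and eq: "\<And>x. x \<in> T \<Longrightarrow> v x = w x"
  shows "hdg_local a q u uhat T v = hdg_local a q u uhat T w"
proof -
  obtain V where V: "V \<in> vec_polys k" "\<And>x. x \<in> T \<Longrightarrow> v x = V x"
    using vec_poly_onE[OF v] by metis
  have w: "w x = V x" if "x \<in> T" for x
    using eq[OF that] V(2)[OF that] by simp
  have "vol_ip T u (divergence v) = vol_ip T u (divergence w)"
    using divergence_poly[OF T V] divergence_poly[OF T V(1) w] by (intro vol_ip_cong) auto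
  moreover have "vol_ip T (\<lambda>x. matrix_inv (a x) *v q x) v = vol_ip T (\<lambda>x. matrix_inv (a x) *v q x) w"
    using eq by (intro vol_ip_cong) auto
  moreover have "normal_trace T v = normal_trace T w"
    using bdry_trace_cong[of T v w] eq by (simp add: normal_trace_def fun_eq_iff)
  ultimately show ?thesis
    by (simp add: hdg_local_eq[OF T])
qed

lemma bdry_trace_zero:
  assumes "T \<in> \<T>" "x \<in> frontier T"
  shows "bdry_trace T (\<lambda>x. 0 :: 'b::real_normed_vector) x = 0"
  by (rule bdry_trace_eq[OF elem_regular(2)[OF assms(1)] assms(2) continuous_on_const refl])

lemma hdg_local_zero:
  assumes T: "T \<in> \<T>"
  shows "hdg_local a q u uhat T (\<lambda>x. 0) = 0"
proof -
  have "divergence (\<lambda>x::real^'d. 0) = (\<lambda>x. 0)"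
    by (simp add: divergence_def fun_eq_iff)
  moreover have "bdry_int T (\<lambda>x. uhat x * normal_trace T (\<lambda>x. 0) x) = bdry_int T (\<lambda>x. 0)"
  proof (rule bdry_int_cong_AE)
    fix e assume e: "e \<in> faces T"
    show "AE x in surface_measure e. uhat x * normal_trace T (\<lambda>x. 0) x = 0"
      using AE_on_frontier[OF e] by eventually_elim (simp add: normal_trace_def bdry_trace_zero[OF T])
  qed
  ultimately show ?thesis
    by (simp add: hdg_local_eq[OF T] vol_ip_zero bdry_int_def)
qed

text \<open>The membership of the unknown in \<open>Z_local\<close> belongs to the left side only:
  on the right it follows from the equality with the flux, which is a face polynomial of degree at
  most \<open>s\<close> because \<open>k\<close> and \<open>r\<close> do not exceed
  \<open>s\<close>.\<close>

lemma wg_local_iff: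
  assumes T: "T \<in> \<T>" and q: "q0 \<in> vec_poly_on k T"
    and u: "u \<in> poly_on r T" and ub: "\<And>e. e \<in> faces T \<Longrightarrow> ub \<in> face_poly s e"
    and ks: "k \<le> s" and rs: "r \<le> s" and \<rho>: "\<rho> > 0" and \<tau>: "\<And>x. \<tau> T x = inverse \<rho> * diameter T powr (- \<alpha>)"
  shows "(q0, qb) \<in> Z_local \<E> k s T \<and> (\<forall>(v0, vb)\<in>Z_local \<E> k s T.
      stabilizer \<E> s \<rho> \<alpha> T q0 qb v0 vb + vol_ip T (\<lambda>x. matrix_inv (a x) *v q0 x) v0
     - vol_ip T (weak_div \<E> r T v0 vb) u
     + surf_ip \<E> (frontier T) ub (\<lambda>x. (vb x *\<^sub>R outward_normal T x) \<bullet> outward_normal T x) = 0)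
   \<longleftrightarrow> ae_on \<E> (frontier T) (\<lambda>x. qb x = hdg_flux \<tau> q0 u ub T x)
      \<and> (\<forall>v\<in>vec_poly_on k T. hdg_local a q0 u ub T v = 0)"
    (is "?L \<longleftrightarrow> ?R")
proof -
  define F where "F = hdg_flux \<tau> q0 u ub T"
  define H where "H = \<rho> * diameter T powr \<alpha>"
  have H: "H \<noteq> 0"
    using \<rho> elem_diameter_pos[OF T] by (simp add: H_def)
  have "(\<lambda>x. normal_trace T q0 x + (inverse \<rho> * diameter T powr (- \<alpha>)) * (bdry_trace T u x - ub x)) \<in> face_poly s e"
    if "e \<in> faces T" for e
    using that by (intro face_poly_add face_poly_scale face_poly_diff normal_trace_face_poly[OF T q ks]
        trace_face_poly[OF T u rs] ub)
  then have F: "F \<in> face_poly s e" if "e \<in> faces T" for e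
    using that by (simp add: F_def hdg_flux_def[abs_def] \<tau> normal_trace_def)
  have res: "stabilizer \<E> s \<rho> \<alpha> T q0 qb v0 vb + vol_ip T (\<lambda>x. matrix_inv (a x) *v q0 x) v0
     - vol_ip T (weak_div \<E> r T v0 vb) u
     + surf_ip \<E> (frontier T) ub (\<lambda>x. (vb x *\<^sub>R outward_normal T x) \<bullet> outward_normal T x)
     = hdg_local a q0 u ub T v0 + H * bdry_int T (\<lambda>x. (F x - qb x) * (normal_trace T v0 x - vb x))"
    if "(v0, vb) \<in> Z_local \<E> k s T" "(q0, qb) \<in> Z_local \<E> k s T" for v0 vb
    unfolding F_def H_def using that unfolding Z_local_iff
    by (intro wg_residual[where k = k and s = s]) (use T q u ub ks \<rho> \<tau> in auto)
  show ?thesis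
  proof
    assume L: ?L
    then have Z: "(q0, qb) \<in> Z_local \<E> k s T"
      by blast
    have eq: "hdg_local a q0 u ub T v0 + H * bdry_int T (\<lambda>x. (F x - qb x) * (normal_trace T v0 x - vb x)) = 0"
      if "(v0, vb) \<in> Z_local \<E> k s T" for v0 vb
      using L that unfolding res[OF that Z, symmetric] by blast
    have d: "(\<lambda>x. F x - qb x) \<in> face_poly s e" if "e \<in> faces T" for e
      using F[OF that] Z that by (intro face_poly_diff) (auto simp: Z_local_iff)
    \<comment> \<open>With \<open>v0 = 0\<close> the local HDG expression vanishes, and this
      boundary component turns the remaining term into the integral of the square of
      \<open>F - qb\<close>.\<close>
    have "(\<lambda>x. 0, \<lambda>x. -1 * (F x - qb x)) \<in> Z_local \<E> k s T"
      unfolding Z_local_iff using d vec_poly_on_zero face_poly_scale by blast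
    from eq[OF this] have "bdry_int T (\<lambda>x. (F x - qb x) * (normal_trace T (\<lambda>x. 0) x - -1 * (F x - qb x))) = 0"
      using H by (simp add: hdg_local_zero[OF T])
    also have "bdry_int T (\<lambda>x. (F x - qb x) * (normal_trace T (\<lambda>x. 0) x - -1 * (F x - qb x)))
        = bdry_int T (\<lambda>x. (F x - qb x) * (F x - qb x))"
    proof (rule bdry_int_cong_AE)
      fix e assume e: "e \<in> faces T"
      show "AE x in surface_measure e. (F x - qb x) * (normal_trace T (\<lambda>x. 0) x - -1 * (F x - qb x)) = (F x - qb x) * (F x - qb x)"
        using AE_on_frontier[OF e] by eventually_elim (simp add: normal_trace_def bdry_trace_zero[OF T])
    qed
    finally have *: "AE x in surface_measure e. F x - qb x = 0" if "e \<in> faces T" for e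
      using bdry_int_square_zero[OF face_poly_ae_continuous[OF d]] that by blast
    have "AE x in surface_measure e. qb x = F x" if "e \<in> faces T" for e
      using *[OF that] by eventually_elim simp
    moreover have "hdg_local a q0 u ub T v = 0" if v: "v \<in> vec_poly_on k T" for v
    proof -
      have "bdry_int T (\<lambda>x. (F x - qb x) * (normal_trace T v x - 0)) = bdry_int T (\<lambda>x. 0)"
      proof (rule bdry_int_cong_AE)
        fix e assume "e \<in> faces T"
        from *[OF this] show "AE x in surface_measure e. (F x - qb x) * (normal_trace T v x - 0) = 0"
          by eventually_elim simp
      qed
      moreover have "(v, \<lambda>x. 0) \<in> Z_local \<E> k s T"
        unfolding Z_local_iff using v face_poly_zero by blast
      ultimately show ?thesis
        using eq[of v "\<lambda>x. 0"] by (simp add: bdry_int_def)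
    qed
    ultimately show ?R
      by (simp add: ae_on_frontier_iff[OF T] F_def)
  next
    assume R: ?R
    then have qF: "AE x in surface_measure e. qb x = F x" if "e \<in> faces T" for e
      using that by (simp add: ae_on_frontier_iff[OF T] F_def)
    have "qb \<in> face_poly s e" if "e \<in> faces T" for e
    proof (rule face_poly_cong_AE[OF F[OF that]])
      show "AE x in surface_measure e. F x = qb x"
        using qF[OF that] by eventually_elim simp
    qed
    then have Z: "(q0, qb) \<in> Z_local \<E> k s T"
      using q by (simp add: Z_local_iff)
    have "hdg_local a q0 u ub T v0 + H * bdry_int T (\<lambda>x. (F x - qb x) * (normal_trace T v0 x - vb x)) = 0"
      if "(v0, vb) \<in> Z_local \<E> k s T" for v0 vb
    proof -
      have "bdry_int T (\<lambda>x. (F x - qb x) * (normal_trace T v0 x - vb x)) = bdry_int T (\<lambda>x. 0)"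
      proof (rule bdry_int_cong_AE)
        fix e assume "e \<in> faces T"
        from qF[OF this] show "AE x in surface_measure e. (F x - qb x) * (normal_trace T v0 x - vb x) = 0"
          by eventually_elim simp
      qed
      then show ?thesis
        using R that by (simp add: Z_local_iff bdry_int_def)
    qed
    then show ?L
      using Z res[OF _ Z] by auto
  qed
qed

section \<open>Splitting integrals over the domain, and broken polynomial spaces\<close>

lemma negligible_skeleton: "negligible (\<Omega> - \<Union>\<T>)"
proof -
  have "\<Omega> - \<Union>\<T> \<subseteq> (\<Union>T\<in>\<T>. frontier T)"
  proof
    fix x assume x: "x \<in> \<Omega> - \<Union>\<T>"
    then obtain T where "T \<in> \<T>" "x \<in> closure T"
      using closure_subset[of \<Omega>] unfolding elems_cover by blast
    then show "x \<in> (\<Union>T\<in>\<T>. frontier T)"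
      using x elem_regular(2)[of T] by (auto simp: frontier_def interior_open)
  qed
  moreover have "negligible (\<Union>T\<in>\<T>. frontier T)"
    using finite_T polyhedral_element.negligible_frontier[OF element] by (intro negligible_Union) auto
  ultimately show ?thesis
    by (rule negligible_subset[rotated])
qed

lemma sum_elem_indicator:
  fixes g :: "(real^'d) set \<Rightarrow> 'b::real_vector"
  assumes "x \<in> T" "T \<in> \<T>"
  shows "(\<Sum>T\<in>\<T>. indicator T x *\<^sub>R g T) = g T"
proof -
  have "indicator T' x *\<^sub>R g T' = (if T' = T then g T else 0)" if "T' \<in> \<T>" for T'
    using assms that elems_disjnt by (auto simp: indicator_def pairwise_def disjnt_def)
  then show ?thesis
    using assms finite_T by simp
qed

lemma AE_sum_elem_indicator:
  fixes g :: "real^'d \<Rightarrow> 'b::real_vector"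
  shows "AE x in lebesgue. indicator \<Omega> x *\<^sub>R g x = (\<Sum>T\<in>\<T>. indicator T x *\<^sub>R g x)"
proof -
  have "AE x in lborel. x \<notin> \<Omega> - \<Union>\<T>"
    by (rule AE_lborel_not_negligible[OF negligible_skeleton])
  then have "AE x in lebesgue. x \<notin> \<Omega> - \<Union>\<T>"
    by (rule AE_completion)
  then show ?thesis
  proof eventually_elim
    case (elim x)
    show ?case
    proof (cases "x \<in> \<Omega>")
      case True
      then obtain T where "T \<in> \<T>" "x \<in> T"
        using elim by blast
      then show ?thesis
        using sum_elem_indicator[of x T "\<lambda>_. g x"] True by simp
    next
      case False
      then have "indicator T x *\<^sub>R g x = 0" if "T \<in> \<T>" for T
        using elem(2)[OF that] by (auto simp: indicator_def)
      then have "(\<Sum>T\<in>\<T>. indicator T x *\<^sub>R g x) = 0"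
        by (rule sum.neutral[OF ballI])
      then show ?thesis
        using False by simp
    qed
  qed
qed

lemma domain_sets: "\<Omega> \<inter> space lebesgue \<in> sets lebesgue"
  using polyhedral_domain_regular(2)[OF domain] by simp

text \<open>The values on the skeleton are arbitrary, but the skeleton is negligible and Lebesgue
  measure is complete. Consequently membership in the broken polynomial spaces reduces to a
  condition on single elements.\<close>

lemma elementwise_continuous_L2:
  fixes g :: "real^'d \<Rightarrow> 'b::euclidean_space"
  assumes "\<And>T. T \<in> \<T> \<Longrightarrow> \<exists>G. continuous_on UNIV G \<and> (\<forall>x\<in>T. g x = G x)"
  shows "g \<in> L2 \<Omega>"
proof -
  obtain G where G: "\<And>T. T \<in> \<T> \<Longrightarrow> continuous_on UNIV (G T)" "\<And>T x. T \<in> \<T> \<Longrightarrow> x \<in> T \<Longrightarrow> g x = G T x"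
    using assms by metis
  have eq: "indicator T x *\<^sub>R g x = indicator T x *\<^sub>R G T x" if "T \<in> \<T>" for T x
    using G(2)[OF that] by (auto simp: indicator_def)
  have Tb: "T \<in> sets borel" if "T \<in> \<T>" for T
    using elem_regular(2)[OF that] by simp
  have "AE x in lebesgue. indicator \<Omega> x *\<^sub>R g x = (\<Sum>T\<in>\<T>. indicator T x *\<^sub>R G T x)"
    using AE_sum_elem_indicator[of g] by eventually_elim (simp add: eq)
  moreover have "(\<lambda>x. \<Sum>T\<in>\<T>. indicator T x *\<^sub>R G T x) \<in> borel_measurable lebesgue"
    using Tb by (intro borel_measurable_sum borel_measurable_scaleR borel_measurable_indicator measurable_completion)
      (auto intro: borel_measurable_continuous_onI G)
  ultimately have "(\<lambda>x. indicator \<Omega> x *\<^sub>R g x) \<in> borel_measurable lebesgue"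
    by (rule completion_measurable_AE[rotated])
  then have m: "g \<in> borel_measurable (lebesgue_on \<Omega>)"
    by (subst borel_measurable_restrict_space_iff[OF domain_sets])
  have eq2: "indicator T x *\<^sub>R (norm (g x))\<^sup>2 = (norm (G T x))\<^sup>2 * indicator T x" if "T \<in> \<T>" for T x
    using G(2)[OF that] by (auto simp: indicator_def)
  have ae: "AE x in lebesgue. indicator \<Omega> x *\<^sub>R (norm (g x))\<^sup>2 = (\<Sum>T\<in>\<T>. (norm (G T x))\<^sup>2 * indicator T x)"
    using AE_sum_elem_indicator[of "\<lambda>x. (norm (g x))\<^sup>2"] by eventually_elim (simp only: eq2 cong: sum.cong)
  have int: "integrable lebesgue (\<lambda>x. \<Sum>T\<in>\<T>. (norm (G T x))\<^sup>2 * indicator T x)"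
  proof (rule Bochner_Integration.integrable_sum)
    fix T assume T: "T \<in> \<T>"
    have "integrable lborel (\<lambda>x. (norm (G T x))\<^sup>2 * indicator T x)"
      using elem_regular(3)[OF T] Tb[OF T] G(1)[OF T] by (intro integrable_on_bounded continuous_intros)
    then show "integrable lebesgue (\<lambda>x. (norm (G T x))\<^sup>2 * indicator T x)"
      using borel_measurable_integrable by (subst integrable_completion) auto
  qed
  then have "integrable lebesgue (\<lambda>x. indicator \<Omega> x *\<^sub>R (norm (g x))\<^sup>2)"
    using completion_measurable_AE[OF borel_measurable_integrable[OF int] ae] ae
    by (subst integrable_cong_AE[OF _ borel_measurable_integrable[OF int] ae])
  then have "integrable (lebesgue_on \<Omega>) (\<lambda>x. (norm (g x))\<^sup>2)"
    by (subst integrable_restrict_space[OF domain_sets])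
  with m show ?thesis
    by (simp add: L2_def)
qed

lemma broken_poly_iff: "g \<in> broken_space \<Omega> \<T> (poly_on r) \<longleftrightarrow> (\<forall>T\<in>\<T>. g \<in> poly_on r T)"
proof
  assume *: "\<forall>T\<in>\<T>. g \<in> poly_on r T"
  have "g \<in> L2 \<Omega>"
  proof (rule elementwise_continuous_L2)
    fix T assume "T \<in> \<T>"
    then show "\<exists>G. continuous_on UNIV G \<and> (\<forall>x\<in>T. g x = G x)"
      using * polys_continuous unfolding poly_on_def by blast
  qed
  then show "g \<in> broken_space \<Omega> \<T> (poly_on r)"
    using * by (simp add: broken_space_def)
qed (simp add: broken_space_def)

lemma broken_vec_poly_iff: "v \<in> broken_space \<Omega> \<T> (vec_poly_on k) \<longleftrightarrow> (\<forall>T\<in>\<T>. v \<in> vec_poly_on k T)"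
proof
  assume *: "\<forall>T\<in>\<T>. v \<in> vec_poly_on k T"
  have "v \<in> L2 \<Omega>"
  proof (rule elementwise_continuous_L2)
    fix T assume "T \<in> \<T>"
    then obtain V where "V \<in> vec_polys k" "\<And>x. x \<in> T \<Longrightarrow> v x = V x"
      using * vec_poly_onE by metis
    then show "\<exists>G. continuous_on UNIV G \<and> (\<forall>x\<in>T. v x = G x)"
      using vec_polys_continuous by blast
  qed
  then show "v \<in> broken_space \<Omega> \<T> (vec_poly_on k)"
    using * by (simp add: broken_space_def)
qed (simp add: broken_space_def)

section \<open>Localization of the HDG equations\<close>

lemma elem_notin_other:
  assumes "T \<in> \<T>" "T' \<in> \<T>" "T' \<noteq> T" "x \<in> T'"
  shows "x \<notin> T"
  using assms elems_disjnt by (auto simp: pairwise_def disjnt_def)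

lemma localize_vec_poly:
  assumes "T \<in> \<T>" "v \<in> vec_poly_on k T"
  shows "(\<lambda>x. if x \<in> T then v x else 0) \<in> broken_space \<Omega> \<T> (vec_poly_on k)"
  unfolding broken_vec_poly_iff
proof
  fix T' assume "T' \<in> \<T>"
  then show "(\<lambda>x. if x \<in> T then v x else 0) \<in> vec_poly_on k T'"
    using vec_poly_on_cong[OF assms(2)] vec_poly_on_cong[OF vec_poly_on_zero[of k T']]
      elem_notin_other[OF assms(1), of T'] by (cases "T' = T") auto
qed

lemma localize_poly:
  assumes "T \<in> \<T>" "w \<in> poly_on k T"
  shows "(\<lambda>x. if x \<in> T then w x else 0) \<in> broken_space \<Omega> \<T> (poly_on k)"
  unfolding broken_poly_iff
proof
  fix T' assume "T' \<in> \<T>"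
  then show "(\<lambda>x. if x \<in> T then w x else 0) \<in> poly_on k T'"
    using poly_on_cong[OF assms(2)] poly_on_cong[OF poly_on_zero[of k T']]
      elem_notin_other[OF assms(1), of T'] by (cases "T' = T") auto
qed

text \<open>No continuity between elements is imposed on the test space, so a local test function
  extended by zero is admissible, and only its own element contributes to the sum.\<close>

lemma hdg_first_equation_iff:
  "(\<forall>v\<in>broken_space \<Omega> \<T> (vec_poly_on k). (\<Sum>T\<in>\<T>. hdg_local a q u uhat T v) = 0)
    \<longleftrightarrow> (\<forall>T\<in>\<T>. \<forall>v\<in>vec_poly_on k T. hdg_local a q u uhat T v = 0)"
proof (intro iffI ballI)
  fix T v assume *: "\<forall>v\<in>broken_space \<Omega> \<T> (vec_poly_on k). (\<Sum>T\<in>\<T>. hdg_local a q u uhat T v) = 0"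
    and T: "T \<in> \<T>" and v: "v \<in> vec_poly_on k T"
  let ?v = "\<lambda>x. if x \<in> T then v x else 0"
  have "hdg_local a q u uhat T' ?v = (if T' = T then hdg_local a q u uhat T v else 0)" if T': "T' \<in> \<T>" for T'
  proof (cases "T' = T")
    case True
    then show ?thesis
      using hdg_local_cong[OF T v, of ?v] by simp
  next
    case False
    then show ?thesis
      using hdg_local_cong[OF T' vec_poly_on_zero, of ?v] elem_notin_other[OF T T' False] hdg_local_zero[OF T'] by simp
  qed
  then have "(\<Sum>T'\<in>\<T>. hdg_local a q u uhat T' ?v) = hdg_local a q u uhat T v"
    using T finite_T by simp
  then show "hdg_local a q u uhat T v = 0"
    using bspec[OF * localize_vec_poly[OF T v]] by simp
qed (simp add: broken_vec_poly_iff)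

definition mass_local ::
    "(real^'d \<Rightarrow> real^'d) \<Rightarrow> (real^'d \<Rightarrow> real) \<Rightarrow> (real^'d) set \<Rightarrow> (real^'d \<Rightarrow> real) \<Rightarrow> real" where
  "mass_local q F T w = - vol_ip T q (gradient w) + surf_ip \<E> (frontier T) F (bdry_trace T w)"

lemma mass_local_eq:
  assumes "T \<in> \<T>"
  shows "mass_local q F T w = - vol_ip T q (gradient w) + bdry_int T (\<lambda>x. F x * bdry_trace T w x)"
  by (simp add: mass_local_def surf_ip_frontier_real[OF assms])

lemma mass_local_cong:
  assumes T: "T \<in> \<T>" and v: "v \<in> poly_on r T" and eq: "\<And>x. x \<in> T \<Longrightarrow> v x = w x"
  shows "mass_local q F T v = mass_local q F T w"
proof -
  obtain U where U: "U \<in> polys r" "\<And>x. x \<in> T \<Longrightarrow> v x = U x"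
    using poly_trace[OF T v] by metis
  have w: "w x = U x" if "x \<in> T" for x
    using eq[OF that] U(2)[OF that] by simp
  have "vol_ip T q (gradient v) = vol_ip T q (gradient w)"
    using gradient_poly[OF T U] gradient_poly[OF T U(1) w] by (intro vol_ip_cong) auto
  moreover have "bdry_trace T v = bdry_trace T w"
    by (rule bdry_trace_cong) (rule eq)
  ultimately show ?thesis
    by (simp add: mass_local_eq[OF T])
qed

lemma mass_local_zero:
  assumes T: "T \<in> \<T>"
  shows "mass_local q F T (\<lambda>x. 0) = 0"
proof -
  have "gradient (\<lambda>x::real^'d. 0) = (\<lambda>x. 0)"
    by (simp add: gradient_def fun_eq_iff vec_eq_iff)
  moreover have "bdry_int T (\<lambda>x. F x * bdry_trace T (\<lambda>x. 0) x) = bdry_int T (\<lambda>x. 0)"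
  proof (rule bdry_int_cong_AE)
    fix e assume e: "e \<in> faces T"
    show "AE x in surface_measure e. F x * bdry_trace T (\<lambda>x. 0) x = 0"
      using AE_on_frontier[OF e] by eventually_elim (simp add: bdry_trace_zero[OF T])
  qed
  ultimately show ?thesis
    by (simp add: mass_local_eq[OF T] vol_ip_zero bdry_int_def)
qed

text \<open>The bound \<open>\<bar>a * b\<bar> \<le> a\<^sup>2 + b\<^sup>2\<close> makes the product
  integrable, so that its integral can be split along the elements; the skeleton left between them
  is negligible.\<close>

lemma vol_ip_domain:
  assumes f: "f \<in> L2 \<Omega>" and w: "w \<in> L2 \<Omega>"
  shows "vol_ip \<Omega> f w = (\<Sum>T\<in>\<T>. vol_ip T f (w :: real^'d \<Rightarrow> real))"
proof -
  let ?h = "\<lambda>x. f x * w x"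
  have i: "integrable (lebesgue_on \<Omega>) ?h"
  proof (rule Bochner_Integration.integrable_bound)
    show "integrable (lebesgue_on \<Omega>) (\<lambda>x. (norm (f x))\<^sup>2 + (norm (w x))\<^sup>2)"
      using f w by (auto simp: L2_def)
    show "?h \<in> borel_measurable (lebesgue_on \<Omega>)"
      using f w by (auto simp: L2_def)
    have "\<bar>a * b\<bar> \<le> a\<^sup>2 + b\<^sup>2" for a b :: real
    proof -
      have "2 * (\<bar>a\<bar> * \<bar>b\<bar>) \<le> a\<^sup>2 + b\<^sup>2" "0 \<le> \<bar>a\<bar> * \<bar>b\<bar>"
        using sum_squares_bound[of "\<bar>a\<bar>" "\<bar>b\<bar>"] by (simp_all add: mult.assoc)
      then show ?thesis
        unfolding abs_mult by linarith
    qed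
    then show "AE x in lebesgue_on \<Omega>. norm (?h x) \<le> norm ((norm (f x))\<^sup>2 + (norm (w x))\<^sup>2)"
      by (intro AE_I2) simp
  qed
  then have i: "integrable lebesgue (\<lambda>x. indicator \<Omega> x *\<^sub>R ?h x)"
    by (subst (asm) integrable_restrict_space[OF domain_sets])
  have Ti: "integrable lebesgue (\<lambda>x. indicator T x *\<^sub>R ?h x)" if T: "T \<in> \<T>" for T
  proof -
    have "integrable lebesgue (\<lambda>x. indicator T x *\<^sub>R (indicator \<Omega> x *\<^sub>R ?h x))"
      by (rule integrable_mult_indicator[OF _ i]) (use elem_regular(2)[OF T] in simp)
    also have "(\<lambda>x. indicator T x *\<^sub>R (indicator \<Omega> x *\<^sub>R ?h x)) = (\<lambda>x. indicator T x *\<^sub>R ?h x)"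
      using elem(2)[OF T] by (auto simp: indicator_def fun_eq_iff)
    finally show ?thesis .
  qed
  have "vol_ip \<Omega> f w = (LINT x|lebesgue. indicator \<Omega> x *\<^sub>R ?h x)"
    by (simp add: vol_ip_def integral_restrict_space[OF domain_sets])
  also have "\<dots> = (LINT x|lebesgue. (\<Sum>T\<in>\<T>. indicator T x *\<^sub>R ?h x))"
    by (rule integral_completion_cong_AE[OF AE_sum_elem_indicator])
  also have "\<dots> = (\<Sum>T\<in>\<T>. LINT x|lebesgue. indicator T x *\<^sub>R ?h x)"
    using Ti by (rule Bochner_Integration.integral_sum)
  also have "\<dots> = (\<Sum>T\<in>\<T>. vol_ip T f w)"
  proof (rule sum.cong[OF refl])
    fix T assume T: "T \<in> \<T>"
    have "T \<inter> space lebesgue \<in> sets lebesgue"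
      using elem_regular(2)[OF T] by simp
    then show "(LINT x|lebesgue. indicator T x *\<^sub>R ?h x) = vol_ip T f w"
      by (simp add: vol_ip_def integral_restrict_space)
  qed
  finally show ?thesis .
qed

lemma hdg_second_equation_iff:
  assumes f: "f \<in> L2 \<Omega>"
  shows "(\<forall>w\<in>broken_space \<Omega> \<T> (poly_on r). (\<Sum>T\<in>\<T>. mass_local q (F T) T w) = vol_ip \<Omega> f w)
    \<longleftrightarrow> (\<forall>w\<in>broken_space \<Omega> \<T> (poly_on r). \<forall>T\<in>\<T>. mass_local q (F T) T w = vol_ip T f w)"
proof (intro iffI ballI)
  fix T w assume *: "\<forall>w\<in>broken_space \<Omega> \<T> (poly_on r). (\<Sum>T\<in>\<T>. mass_local q (F T) T w) = vol_ip \<Omega> f w"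
    and w: "w \<in> broken_space \<Omega> \<T> (poly_on r)" and T: "T \<in> \<T>"
  have wT: "w \<in> poly_on r T"
    using w T by (simp add: broken_poly_iff)
  let ?w = "\<lambda>x. if x \<in> T then w x else 0"
  have "mass_local q (F T') T' ?w = (if T' = T then mass_local q (F T) T w else 0)" if T': "T' \<in> \<T>" for T'
  proof (cases "T' = T")
    case True
    then show ?thesis
      using mass_local_cong[OF T wT, of ?w] by simp
  next
    case False
    then show ?thesis
      using mass_local_cong[OF T' poly_on_zero, of ?w] elem_notin_other[OF T T' False] mass_local_zero[OF T'] by simp
  qed
  then have "(\<Sum>T'\<in>\<T>. mass_local q (F T') T' ?w) = mass_local q (F T) T w"
    using T finite_T by simp
  moreover have W: "?w \<in> broken_space \<Omega> \<T> (poly_on r)"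
    by (rule localize_poly[OF T wT])
  moreover have "vol_ip T' f ?w = (if T' = T then vol_ip T f w else 0)" if T': "T' \<in> \<T>" for T'
  proof (cases "T' = T")
    case True
    then show ?thesis
      by (auto intro: vol_ip_cong)
  next
    case False
    then show ?thesis
      using elem_notin_other[OF T T' False] by (auto intro: vol_ip_zero)
  qed
  then have "vol_ip \<Omega> f ?w = vol_ip T f w"
    using vol_ip_domain[OF f, of ?w] W T finite_T by (simp add: broken_space_def)
  ultimately show "mass_local q (F T) T w = vol_ip T f w"
    using bspec[OF * W] by simp
next
  fix w assume *: "\<forall>w\<in>broken_space \<Omega> \<T> (poly_on r). \<forall>T\<in>\<T>. mass_local q (F T) T w = vol_ip T f w"
    and w: "w \<in> broken_space \<Omega> \<T> (poly_on r)"
  then show "(\<Sum>T\<in>\<T>. mass_local q (F T) T w) = vol_ip \<Omega> f w"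
    using vol_ip_domain[OF f, of w] by (simp add: broken_space_def)
qed

section \<open>The boundary condition and the conservation equation\<close>

lemma surf_ip_domain_boundary_iff:
  assumes u: "u \<in> skeleton_space \<E> (face_poly s)"
  shows "(\<forall>\<mu>\<in>skeleton_space \<E> (face_poly s). surf_ip \<E> (frontier \<Omega>) u \<mu> = 0)
    \<longleftrightarrow> ae_on \<E> (frontier \<Omega>) (\<lambda>x. u x = 0)"
proof
  assume "\<forall>\<mu>\<in>skeleton_space \<E> (face_poly s). surf_ip \<E> (frontier \<Omega>) u \<mu> = 0"
  then have z: "(\<Sum>e\<in>\<E>. LINT x:frontier \<Omega>|surface_measure e. u x * u x) = 0"
    using u by (auto simp: surf_ip_def)
  have "(LINT x:frontier \<Omega>|surface_measure e. u x * u x) \<ge> 0" for e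
    unfolding set_lebesgue_integral_def by (intro Bochner_Integration.integral_nonneg) (simp add: indicator_def)
  then have ze: "(LINT x:frontier \<Omega>|surface_measure e. u x * u x) = 0" if "e \<in> \<E>" for e
    using z finite_E that by (subst (asm) sum_nonneg_eq_0_iff) auto
  show "ae_on \<E> (frontier \<Omega>) (\<lambda>x. u x = 0)"
    unfolding ae_on_def
  proof
    fix e assume e: "e \<in> \<E>"
    \<comment> \<open>The test function is \<open>u\<close> itself, so each piece contributes a
      vanishing integral of a square over its part on the outer boundary. Positivity is available
      for integrals over a whole piece, and by the dichotomy that part is the whole piece or a null
      set.\<close>
    from frontier_domain_dichotomy[OF e] show "AE x in surface_measure e. x \<in> frontier \<Omega> \<longrightarrow> u x = 0"
    proof
      assume ae: "AE x in surface_measure e. x \<in> frontier \<Omega>"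
      then have "AE x in surface_measure e. indicator (frontier \<Omega>) x *\<^sub>R (u x * u x) = u x * u x"
        by eventually_elim simp
      then have "(LINT x|surface_measure e. u x * u x) = 0"
        using ze[OF e] unfolding set_lebesgue_integral_def by (metis surface_integral_cong_AE)
      moreover have "ae_continuous e u"
        using u e by (auto simp: skeleton_space_def intro: face_poly_ae_continuous)
      moreover obtain \<nu> c where "flat_face e \<nu> c"
        using piece_flat_face[OF e] .
      ultimately have "AE x in surface_measure e. u x = 0"
        using flat_face.AE_zero_if_integral_square_zero by blast
      then show ?thesis
        by eventually_elim simp
    next
      assume "AE x in surface_measure e. x \<notin> frontier \<Omega>"
      then show ?thesis
        by eventually_elim simp
    qed
  qed
next
  assume *: "ae_on \<E> (frontier \<Omega>) (\<lambda>x. u x = 0)"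
  show "\<forall>\<mu>\<in>skeleton_space \<E> (face_poly s). surf_ip \<E> (frontier \<Omega>) u \<mu> = 0"
  proof
    fix \<mu> :: "real^'d \<Rightarrow> real"
    have "(LINT x:frontier \<Omega>|surface_measure e. u x \<bullet> \<mu> x) = 0" if "e \<in> \<E>" for e
    proof -
      have "AE x in surface_measure e. x \<in> frontier \<Omega> \<longrightarrow> u x = 0"
        using * that by (simp add: ae_on_def)
      then have "AE x in surface_measure e. indicator (frontier \<Omega>) x *\<^sub>R (u x \<bullet> \<mu> x) = 0"
        by eventually_elim (auto simp: indicator_def)
      then show ?thesis
        unfolding set_lebesgue_integral_def by (rule integral_eq_zero_AE)
    qed
    then show "surf_ip \<E> (frontier \<Omega>) u \<mu> = 0"
      by (simp add: surf_ip_def)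
  qed
qed

text \<open>Shifts the exclusion of the outer boundary from the domain of integration, as in HDG, to
  the test function, as in weak Galerkin.\<close>

lemma surf_ip_interior:
  fixes F \<mu> :: "real^'d \<Rightarrow> real"
  shows "surf_ip \<E> (frontier T - frontier \<Omega>) F \<mu>
     = surf_ip \<E> (frontier T) (\<lambda>x. if x \<in> frontier \<Omega> then 0 else \<mu> x) F"
  unfolding surf_ip_def set_lebesgue_integral_def
  by (intro sum.cong refl arg_cong2[where f = "lebesgue_integral"]) (auto simp: indicator_def)

text \<open>Setting an HDG test function to zero on the outer boundary gives a weak Galerkin test
  function with the same boundary integrals: by the dichotomy the result is, on each piece, almost
  everywhere 0 or almost everywhere the old function, hence still a face polynomial. Conversely, a
  weak Galerkin test function is unchanged by the cut up to null sets.\<close>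

lemma third_equation_iff:
  assumes qF: "\<And>T. T \<in> \<T> \<Longrightarrow> ae_on \<E> (frontier T) (\<lambda>x. qb T x = F T x)"
  shows "(\<forall>\<sigma>\<in>{\<sigma>\<in>skeleton_space \<E> (face_poly s). ae_on \<E> (frontier \<Omega>) (\<lambda>x. \<sigma> x = 0)}.
      (\<Sum>T\<in>\<T>. surf_ip \<E> (frontier T) \<sigma> (\<lambda>x. (qb T x *\<^sub>R outward_normal T x) \<bullet> outward_normal T x)) = 0)
    \<longleftrightarrow> (\<forall>\<mu>\<in>skeleton_space \<E> (face_poly s). (\<Sum>T\<in>\<T>. surf_ip \<E> (frontier T - frontier \<Omega>) (F T) \<mu>) = 0)"
    (is "?L \<longleftrightarrow> ?R")
proof -
  define cut where "cut \<mu> = (\<lambda>x. if x \<in> frontier \<Omega> then 0 else \<mu> x)" for \<mu> :: "real^'d \<Rightarrow> real"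
  have l: "surf_ip \<E> (frontier T) \<sigma> (\<lambda>x. (qb T x *\<^sub>R outward_normal T x) \<bullet> outward_normal T x)
     = bdry_int T (\<lambda>x. \<sigma> x * F T x)" if T: "T \<in> \<T>" for T \<sigma>
    unfolding surf_ip_normal_component[OF T]
  proof (rule bdry_int_cong_AE)
    fix e assume "e \<in> faces T"
    then have "AE x in surface_measure e. qb T x = F T x"
      using qF[OF T] by (simp add: ae_on_frontier_iff[OF T])
    then show "AE x in surface_measure e. \<sigma> x * qb T x = \<sigma> x * F T x"
      by eventually_elim simp
  qed
  have r: "surf_ip \<E> (frontier T - frontier \<Omega>) (F T) \<mu> = bdry_int T (\<lambda>x. cut \<mu> x * F T x)" if T: "T \<in> \<T>" for T \<mu>
    unfolding surf_ip_interior surf_ip_frontier_real[OF T] cut_def ..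
  show ?thesis
  proof
    assume L: ?L
    show ?R
    proof
      fix \<mu> assume \<mu>: "\<mu> \<in> skeleton_space \<E> (face_poly s)"
      have "cut \<mu> \<in> face_poly s e" if e: "e \<in> \<E>" for e
        using frontier_domain_dichotomy[OF e]
      proof
        assume "AE x in surface_measure e. x \<in> frontier \<Omega>"
        then have "AE x in surface_measure e. 0 = cut \<mu> x"
          by eventually_elim (simp add: cut_def)
        then show ?thesis
          by (rule face_poly_cong_AE[OF face_poly_zero])
      next
        assume "AE x in surface_measure e. x \<notin> frontier \<Omega>"
        then have "AE x in surface_measure e. \<mu> x = cut \<mu> x"
          by eventually_elim (simp add: cut_def)
        moreover have "\<mu> \<in> face_poly s e"
          using \<mu> e by (simp add: skeleton_space_def)
        ultimately show ?thesis
          by (rule face_poly_cong_AE[rotated])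
      qed
      then have "cut \<mu> \<in> {\<sigma>\<in>skeleton_space \<E> (face_poly s). ae_on \<E> (frontier \<Omega>) (\<lambda>x. \<sigma> x = 0)}"
        by (auto simp: skeleton_space_def ae_on_def cut_def)
      with L have "(\<Sum>T\<in>\<T>. surf_ip \<E> (frontier T) (cut \<mu>) (\<lambda>x. (qb T x *\<^sub>R outward_normal T x) \<bullet> outward_normal T x)) = 0"
        by blast
      then show "(\<Sum>T\<in>\<T>. surf_ip \<E> (frontier T - frontier \<Omega>) (F T) \<mu>) = 0"
        by (simp only: l r cong: sum.cong)
    qed
  next
    assume R: ?R
    show ?L
    proof
      fix \<sigma> assume \<sigma>: "\<sigma> \<in> {\<sigma>\<in>skeleton_space \<E> (face_poly s). ae_on \<E> (frontier \<Omega>) (\<lambda>x. \<sigma> x = 0)}"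
      have "bdry_int T (\<lambda>x. \<sigma> x * F T x) = bdry_int T (\<lambda>x. cut \<sigma> x * F T x)" if "T \<in> \<T>" for T
      proof (rule bdry_int_cong_AE)
        fix e assume "e \<in> faces T"
        then have "AE x in surface_measure e. x \<in> frontier \<Omega> \<longrightarrow> \<sigma> x = 0"
          using \<sigma> face_in_E by (simp add: ae_on_def)
        then show "AE x in surface_measure e. \<sigma> x * F T x = cut \<sigma> x * F T x"
          by eventually_elim (simp add: cut_def)
      qed
      moreover have "(\<Sum>T\<in>\<T>. surf_ip \<E> (frontier T - frontier \<Omega>) (F T) \<sigma>) = 0"
        using R \<sigma> by blast
      ultimately show "(\<Sum>T\<in>\<T>. surf_ip \<E> (frontier T) \<sigma> (\<lambda>x. (qb T x *\<^sub>R outward_normal T x) \<bullet> outward_normal T x)) = 0"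
        by (simp only: l r cong: sum.cong)
    qed
  qed
qed

end

theorem mainTheorem2:
  fixes \<Omega> :: "(real^'d) set" and \<T> \<E> :: "(real^'d) set set"
    and a :: "real^'d \<Rightarrow> real^'d^'d" and f :: "real^'d \<Rightarrow> real"
    and k s r :: nat and \<rho> \<alpha> :: real
    and q0 :: "real^'d \<Rightarrow> real^'d" and qb :: "(real^'d) set \<Rightarrow> real^'d \<Rightarrow> real"
    and uh ub :: "real^'d \<Rightarrow> real"
  defines "\<tau> \<equiv> (\<lambda>T x. inverse \<rho> * diameter T powr (- \<alpha>))"
  assumes "CARD('d) = 2 \<or> CARD('d) = 3"
    and "polyhedral_domain \<Omega>"
    and "admissible_coefficient \<Omega> a"
    and "f \<in> L2 \<Omega>"
    and "is_mesh \<Omega> \<T> \<E>"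
    and "\<rho> > 0"
    and "s \<ge> k" and "s \<ge> r"
  shows "wg_solution \<Omega> \<T> \<E> a f k s r \<rho> \<alpha> q0 qb uh ub \<longleftrightarrow>
         hdg_solution \<Omega> \<T> \<E> a f (vec_poly_on k) (poly_on r) (face_poly s) \<tau> q0 uh ub \<and>
         (\<forall>T\<in>\<T>. ae_on \<E> (frontier T) (\<lambda>x. qb T x = hdg_flux \<tau> q0 uh ub T x))"
proof -
  interpret polyhedral_mesh \<Omega> \<T> \<E>
    by unfold_locales (fact assms)+
  let ?F = "hdg_flux \<tau> q0 uh ub"
  let ?W = "broken_space \<Omega> \<T> (poly_on r)" and ?\<Lambda> = "skeleton_space \<E> (face_poly s)"
  let ?\<Sigma> = "{\<sigma>\<in>?\<Lambda>. ae_on \<E> (frontier \<Omega>) (\<lambda>x. \<sigma> x = 0)}"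
  let ?B = "(\<forall>T\<in>\<T>. q0 \<in> vec_poly_on k T) \<and> uh \<in> ?W \<and> ub \<in> ?\<Lambda>"
  let ?flux = "\<forall>T\<in>\<T>. ae_on \<E> (frontier T) (\<lambda>x. qb T x = ?F T x)"
  let ?wg1 = "\<forall>T\<in>\<T>. (q0, qb T) \<in> Z_local \<E> k s T \<and> (\<forall>(v0, vb)\<in>Z_local \<E> k s T.
            stabilizer \<E> s \<rho> \<alpha> T q0 (qb T) v0 vb
            + vol_ip T (\<lambda>x. matrix_inv (a x) *v q0 x) v0
            - vol_ip T (weak_div \<E> r T v0 vb) uh
            + surf_ip \<E> (frontier T) ub
                (\<lambda>x. (vb x *\<^sub>R outward_normal T x) \<bullet> outward_normal T x) = 0)"
  let ?wg2 = "\<forall>w\<in>?W. \<forall>T\<in>\<T>. vol_ip T (weak_div \<E> r T q0 (qb T)) w = vol_ip T f w"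
  let ?wg3 = "\<forall>\<sigma>\<in>?\<Sigma>. (\<Sum>T\<in>\<T>. surf_ip \<E> (frontier T) \<sigma>
            (\<lambda>x. (qb T x *\<^sub>R outward_normal T x) \<bullet> outward_normal T x)) = 0"
  let ?hdg1 = "\<forall>v\<in>broken_space \<Omega> \<T> (vec_poly_on k). (\<Sum>T\<in>\<T>. hdg_local a q0 uh ub T v) = 0"
  let ?hdg2 = "\<forall>w\<in>?W. (\<Sum>T\<in>\<T>. mass_local q0 (?F T) T w) = vol_ip \<Omega> f w"
  let ?hdg3 = "\<forall>\<mu>\<in>?\<Lambda>. (\<Sum>T\<in>\<T>. surf_ip \<E> (frontier T - frontier \<Omega>) (?F T) \<mu>) = 0"
  let ?hdg4 = "\<forall>\<mu>\<in>?\<Lambda>. surf_ip \<E> (frontier \<Omega>) ub \<mu> = 0"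
  have Z: "q0 \<in> vec_poly_on k T" if "(q0, qb T) \<in> Z_local \<E> k s T" for T
    using that by (simp add: Z_local_iff)
  \<comment> \<open>The membership of each \<open>(q0, qb T)\<close> is moved into
    \<open>?wg1\<close>, and only its consequence for \<open>q0\<close> is kept in
    \<open>?B\<close>, so that \<open>?B\<close> is common to both methods.\<close>
  have wg: "wg_solution \<Omega> \<T> \<E> a f k s r \<rho> \<alpha> q0 qb uh ub \<longleftrightarrow>
      ?B \<and> ?wg1 \<and> ae_on \<E> (frontier \<Omega>) (\<lambda>x. ub x = 0) \<and> ?wg2 \<and> ?wg3"
    unfolding wg_solution_def Let_def using Z by blast
  have hdg: "hdg_solution \<Omega> \<T> \<E> a f (vec_poly_on k) (poly_on r) (face_poly s) \<tau> q0 uh ub \<longleftrightarrow>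
      ?B \<and> ?hdg1 \<and> ?hdg2 \<and> ?hdg3 \<and> ?hdg4"
    unfolding hdg_solution_def hdg_local_def mass_local_def broken_vec_poly_iff[of q0 k] by blast
  have 1: "?wg1 \<longleftrightarrow> ?flux \<and> ?hdg1" if B: ?B
  proof -
    have "(q0, qb T) \<in> Z_local \<E> k s T \<and> (\<forall>(v0, vb)\<in>Z_local \<E> k s T.
            stabilizer \<E> s \<rho> \<alpha> T q0 (qb T) v0 vb
            + vol_ip T (\<lambda>x. matrix_inv (a x) *v q0 x) v0
            - vol_ip T (weak_div \<E> r T v0 vb) uh
            + surf_ip \<E> (frontier T) ub
                (\<lambda>x. (vb x *\<^sub>R outward_normal T x) \<bullet> outward_normal T x) = 0)
      \<longleftrightarrow> ae_on \<E> (frontier T) (\<lambda>x. qb T x = ?F T x) \<and> (\<forall>v\<in>vec_poly_on k T. hdg_local a q0 uh ub T v = 0)"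
      if T: "T \<in> \<T>" for T
    proof (rule wg_local_iff[OF T])
      show "q0 \<in> vec_poly_on k T" "uh \<in> poly_on r T"
        using B T by (auto simp: broken_poly_iff)
      show "ub \<in> face_poly s e" if "e \<in> faces T" for e
        using B face_in_E[OF that] by (simp add: skeleton_space_def)
      show "\<tau> T x = inverse \<rho> * diameter T powr (- \<alpha>)" for x
        by (simp add: \<tau>_def)
    qed (use assms in auto)
    then have "?wg1 \<longleftrightarrow> (\<forall>T\<in>\<T>. ae_on \<E> (frontier T) (\<lambda>x. qb T x = ?F T x)
        \<and> (\<forall>v\<in>vec_poly_on k T. hdg_local a q0 uh ub T v = 0))"
      by (rule ball_cong[OF refl])
    then show ?thesis
      unfolding hdg_first_equation_iff by blast
  qed
  have 2: "?wg2 \<longleftrightarrow> ?hdg2" if B: ?B and w1: ?wg1 and fl: ?flux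
  proof -
    have "vol_ip T (weak_div \<E> r T q0 (qb T)) w = mass_local q0 (?F T) T w"
      if w: "w \<in> ?W" and T: "T \<in> \<T>" for w T
    proof -
      have wT: "w \<in> poly_on r T" and q: "q0 \<in> vec_poly_on k T"
        using w B T by (auto simp: broken_poly_iff)
      have "qb T \<in> face_poly s e" if "e \<in> faces T" for e
        using w1 T that by (simp add: Z_local_iff)
      then have "vol_ip T (weak_div \<E> r T q0 (qb T)) w
          = - vol_ip T q0 (gradient w) + bdry_int T (\<lambda>x. qb T x * bdry_trace T w x)"
        by (rule weak_div[OF T q _ wT])
      also have "bdry_int T (\<lambda>x. qb T x * bdry_trace T w x) = bdry_int T (\<lambda>x. ?F T x * bdry_trace T w x)"
      proof (rule bdry_int_cong_AE)
        fix e assume "e \<in> faces T"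
        then have "AE x in surface_measure e. qb T x = ?F T x"
          using fl T by (simp add: ae_on_frontier_iff)
        then show "AE x in surface_measure e. qb T x * bdry_trace T w x = ?F T x * bdry_trace T w x"
          by eventually_elim simp
      qed
      finally show ?thesis
        by (simp add: mass_local_eq[OF T])
    qed
    then show ?thesis
      unfolding hdg_second_equation_iff[OF \<open>f \<in> L2 \<Omega>\<close>] by (intro ball_cong refl) metis
  qed
  have 3: "?wg3 \<longleftrightarrow> ?hdg3" if fl: ?flux
    using fl by (intro third_equation_iff) blast
  have 4: "?hdg4 \<longleftrightarrow> ae_on \<E> (frontier \<Omega>) (\<lambda>x. ub x = 0)" if B: ?B
    using B by (intro surf_ip_domain_boundary_iff) blast
  \<comment> \<open>The equivalences for the second and third equations presuppose the flux
    identity. It is at hand in both directions: one side asserts it, and the other yields it through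
    the first equivalence, which also recovers \<open>?wg1\<close> from the HDG side.\<close>
  show ?thesis
    unfolding wg hdg using 1 2 3 4 by argo
qed


end
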